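(* Let $(\mathfrak g,\mu_{\mathfrak g})$ be a finite-dimensional real Lie algebra and $\mathfrak i\lhd(\mathfrak g,\mu_{\mathfrak g})$ an ideal of dimension $k$. If $H^1(\mathfrak i\lhd\mathfrak g)=0$, then $\mathfrak i$ is a (topologically) stable ideal. Furthermore, in this case, the space of $k$-dimensional Lie ideals $\mathbf I_k(\mathfrak g)\subset\mathrm{Gr}_k(\mathfrak g)$ is, locally around $\mathfrak i$, a manifold of dimension equal to $\dim Z^0(\mathfrak i\lhd\mathfrak g)$. In particular, $Z^0(\mathfrak i\lhd\mathfrak g)$ is the tangent space of $\mathbf I_k(\mathfrak g)$ at $\mathfrak i$, and each infinitesimal deformation of $\mathfrak i\lhd\mathfrak g$ is a deformation class.
   Context: $\bar x$ denotes the class of $x$ in $\mathfrak g/\mathfrak i$. $Z^\bullet(\mathfrak i\lhd\mathfrak g)$ and $H^\bullet(\mathfrak i\lhd\mathfrak g)$ are the cocycles and cohomology of the Chevalley–Eilenberg complex $\wedge^\bullet\mathfrak g^*\otimes\mathrm{Hom}(\mathfrak i,\mathfrak g/\mathfrak i)$ of $\mathfrak g$ with values in the representation $\mathrm{ad}^{\mathrm{Hom}}_x(\phi)(u)=[\bar x,\phi(u)]-\phi([x,u])$. $\mathrm{Gr}_k(\mathfrak g)$ is the Grassmannian of $k$-dimensional subspaces, $\mathbf I_k(\mathfrak g)$ its subset of ideals of $(\mathfrak g,\mu_{\mathfrak g})$; $T_{\mathfrak i}\mathrm{Gr}_k(\mathfrak g)\simeq\mathrm{Hom}(\mathfrak i,\mathfrak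 g/\mathfrak i)$ canonically (if $W_t=\mathrm{graph}(\phi(t))$ with $\phi(t)\in\mathrm{Hom}(\mathfrak i,\mathfrak i^c)$, $\phi(0)=0$, for a complement $\mathfrak i^c$ of $\mathfrak i$, then $\frac{d}{dt}|_{t=0}W_t$ is $\dot\phi(0)$ followed by the projection to $\mathfrak g/\mathfrak i$). $\Lambda\subset\mathrm{Hom}(\wedge^2\mathfrak g,\mathfrak g)$ is the space of Lie brackets on the vector space $\mathfrak g$ with the subspace topology. The ideal $\mathfrak i\lhd(\mathfrak g,\mu_{\mathfrak g})$ is (topologically) stable if for each neighborhood $U$ of $\mathfrak i$ in $\mathrm{Gr}_k(\mathfrak g)$ there is a neighborhood $V$ of $\mu_{\mathfrak g}$ in $\Lambda$ such that for every $\mu'\in V$ there exists $\mathfrak i'\in U$ that is an ideal of $(\mathfrak g,\mu')$. An infinitesimal deformation of $\mathfrak i\lhd\mathfrak g$ is an element of $H^0(\mathfrak i\lhd\mathfrak g)=Z^0(\mathfrak i\lhd\mathfrak g)\subseteq\mathrm{Hom}(\mathfrak i,\mathfrak g/\mathfrak i)$; it is a deformation class if it equals $\frac{d}{dt}|_{t=0}\mathfrak i_t$ for a smooth curve $[0,1]\to\mathrm{Gr}_k(\mathfrak g)$, $t\mapsto\mathfrak i_t$, of ideals of $\mathfrak g$ with $\mathfrak i_0=\mathfrak i$. *)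

theory Defs
  imports "HOL-Analysis.Analysis" "HOL-Library.Function_Algebras"
begin

instantiation "fun" :: (type, real_vector) real_vector
begin

definition scaleR_fun :: "real \<Rightarrow> ('a \<Rightarrow> 'b) \<Rightarrow> 'a \<Rightarrow> 'b"
  where "scaleR_fun c f = (\<lambda>x. c *\<^sub>R f x)"

instance
  by standard (simp_all add: scaleR_fun_def fun_eq_iff scaleR_add_right scaleR_add_left)

end

definition lie_bracket :: "('a::real_vector \<Rightarrow> 'a \<Rightarrow> 'a) \<Rightarrow> bool" where
  "lie_bracket \<mu> \<longleftrightarrow>
     (\<forall>x. linear (\<lambda>y. \<mu> x y)) \<and> (\<forall>y. linear (\<lambda>x. \<mu> x y)) \<and>
     (\<forall>x. \<mu> x x = 0) \<and>
     (\<forall>x y z. \<mu> x (\<mu> y z) + \<mu> y (\<mu> z x) + \<mu> z (\<mu> x y) = 0)"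

definition lie_ideal :: "('a::real_vector \<Rightarrow> 'a \<Rightarrow> 'a) \<Rightarrow> 'a set \<Rightarrow> bool" where
  "lie_ideal \<mu> I \<longleftrightarrow> subspace I \<and> (\<forall>x. \<forall>u\<in>I. \<mu> x u \<in> I)"

text \<open>The space of Lie brackets. The function type carries the topology of pointwise convergence;
  on bilinear maps of a finite-dimensional space this is the usual vector space topology of
  \<open>Hom(\<Lambda>\<^sup>2 g, g)\<close>.\<close>

definition bracket_topology :: "('a::real_normed_vector \<Rightarrow> 'a \<Rightarrow> 'a) topology" where
  "bracket_topology = top_of_set {\<mu>. lie_bracket \<mu>}"

text \<open>Chevalley--Eilenberg complex: the representation space is a linear subspace \<open>M\<close> of a type of vectors, acted on by \<open>\<rho>\<close>.
  An \<open>n\<close>-cochain is an alternating \<open>n\<close>-linear map, encoded as a function on lists which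
  vanishes on lists of length different from \<open>n\<close>.\<close>

definition ce_cochains :: "'m::real_vector set \<Rightarrow> nat \<Rightarrow> ('a::real_vector list \<Rightarrow> 'm) set" where
  "ce_cochains M n = {\<omega>.
     (\<forall>xs. length xs = n \<longrightarrow> \<omega> xs \<in> M) \<and>
     (\<forall>xs. length xs \<noteq> n \<longrightarrow> \<omega> xs = 0) \<and>
     (\<forall>xs j. length xs = n \<longrightarrow> j < n \<longrightarrow> linear (\<lambda>x. \<omega> (xs[j := x]))) \<and>
     (\<forall>xs i j. length xs = n \<longrightarrow> i < j \<longrightarrow> j < n \<longrightarrow> xs ! i = xs ! j \<longrightarrow> \<omega> xs = 0)}"

definition omit_nth :: "nat \<Rightarrow> 'a list \<Rightarrow> 'a list" where
  "omit_nth i xs = take i xs @ drop (Suc i) xs"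

definition ce_diff ::
  "('a \<Rightarrow> 'a \<Rightarrow> 'a) \<Rightarrow> ('a \<Rightarrow> 'm \<Rightarrow> 'm) \<Rightarrow> ('a list \<Rightarrow> 'm) \<Rightarrow> 'a list \<Rightarrow> 'm::real_vector" where
  "ce_diff \<mu> \<rho> \<omega> xs =
     (\<Sum>i<length xs. (-1) ^ i *\<^sub>R \<rho> (xs ! i) (\<omega> (omit_nth i xs))) +
     (\<Sum>j<length xs. \<Sum>i<j.
        (-1) ^ (i + j) *\<^sub>R \<omega> (\<mu> (xs ! i) (xs ! j) # omit_nth i (omit_nth j xs)))"

definition ce_cocycles ::
  "('a \<Rightarrow> 'a \<Rightarrow> 'a) \<Rightarrow> 'm set \<Rightarrow> ('a \<Rightarrow> 'm \<Rightarrow> 'm) \<Rightarrow> nat \<Rightarrow> ('a::real_vector list \<Rightarrow> 'm::real_vector) set"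
  where
  "ce_cocycles \<mu> M \<rho> n = {\<omega> \<in> ce_cochains M n. ce_diff \<mu> \<rho> \<omega> = 0}"

definition ce_coboundaries ::
  "('a \<Rightarrow> 'a \<Rightarrow> 'a) \<Rightarrow> 'm set \<Rightarrow> ('a \<Rightarrow> 'm \<Rightarrow> 'm) \<Rightarrow> nat \<Rightarrow> ('a::real_vector list \<Rightarrow> 'm::real_vector) set"
  where
  "ce_coboundaries \<mu> M \<rho> n =
     (case n of 0 \<Rightarrow> {0} | Suc m \<Rightarrow> ce_diff \<mu> \<rho> ` ce_cochains M m)"

text \<open>Cohomology as a set of cosets; the zero class is the set of coboundaries.\<close>

definition ce_cohomology ::
  "('a \<Rightarrow> 'a \<Rightarrow> 'a) \<Rightarrow> 'm set \<Rightarrow> ('a \<Rightarrow> 'm \<Rightarrow> 'm) \<Rightarrow> nat \<Rightarrow> ('a::real_vector list \<Rightarrow> 'm::real_vector) set set"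
  where
  "ce_cohomology \<mu> M \<rho> n =
     (\<lambda>\<omega>. (\<lambda>\<beta>. \<omega> + \<beta>) ` ce_coboundaries \<mu> M \<rho> n) ` ce_cocycles \<mu> M \<rho> n"

lemma ce_diff_Nil_cochain: "ce_diff \<mu> \<rho> \<omega> [x] = \<rho> x (\<omega> [])"
  by (simp add: ce_diff_def omit_nth_def)

lemma ce_diff_singleton_cochain:
  "ce_diff \<mu> \<rho> \<omega> [x, y] = \<rho> x (\<omega> [y]) - \<rho> y (\<omega> [x]) - \<omega> [\<mu> x y]"
  by (simp add: ce_diff_def omit_nth_def numeral_2_eq_2 lessThan_Suc)

text \<open>The quotient space \<open>g/I\<close> is presented by an arbitrary linear map \<open>\<pi>\<close> with kernel \<open>I\<close>:
  \<open>range \<pi>\<close> is \<open>g/I\<close> and \<open>\<pi> x\<close> is the class of \<open>x\<close>.\<close>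

definition quotient_proj :: "('a::real_vector \<Rightarrow> 'q::real_vector) \<Rightarrow> 'a set \<Rightarrow> bool" where
  "quotient_proj \<pi> I \<longleftrightarrow> linear \<pi> \<and> {x. \<pi> x = 0} = I"

lemma quotient_proj_exists:
  fixes I :: "'a::real_vector set"
  assumes "subspace I"
  shows "\<exists>\<pi> :: 'a \<Rightarrow> 'a. quotient_proj \<pi> I"
proof -
  obtain g :: "'a \<Rightarrow> 'a" where g: "range g \<subseteq> I" "linear g" "\<And>v. v \<in> I \<Longrightarrow> g v = v"
    using linear_exists_left_inverse_on[OF linear_ident assms] by auto
  have "linear (\<lambda>x. x - g x)"
    by (intro linear_compose_sub linear_ident g(2))
  moreover have "{x. x - g x = 0} = I"
    using g(1,3) by force
  ultimately show ?thesis
    unfolding quotient_proj_def by blast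
qed

definition quotient_bracket ::
  "('a \<Rightarrow> 'a \<Rightarrow> 'a) \<Rightarrow> ('a \<Rightarrow> 'q) \<Rightarrow> 'q \<Rightarrow> 'q \<Rightarrow> 'q" where
  "quotient_bracket \<mu> \<pi> p q = \<pi> (\<mu> (inv \<pi> p) (inv \<pi> q))"

lemma quotient_bracket_proj:
  assumes "lie_bracket \<mu>" "lie_ideal \<mu> I" "quotient_proj \<pi> I"
  shows "quotient_bracket \<mu> \<pi> (\<pi> x) (\<pi> y) = \<pi> (\<mu> x y)"
proof -
  define x' y' where "x' = inv \<pi> (\<pi> x)" and "y' = inv \<pi> (\<pi> y)"
  have \<pi>: "linear \<pi>" and ker: "\<And>z. \<pi> z = 0 \<longleftrightarrow> z \<in> I"
    using assms(3) by (auto simp: quotient_proj_def)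
  have "\<pi> x' = \<pi> x" "\<pi> y' = \<pi> y"
    by (simp_all add: x'_def y'_def f_inv_into_f)
  then have *: "x' - x \<in> I" "y' - y \<in> I"
    by (simp_all add: ker[symmetric] linear_diff[OF \<pi>])
  have lin: "\<And>x. linear (\<lambda>y. \<mu> x y)" "\<And>y. linear (\<lambda>x. \<mu> x y)" and alt: "\<And>x. \<mu> x x = 0"
    using assms(1) by (auto simp: lie_bracket_def)
  have anti: "\<mu> a b = - \<mu> b a" for a b
  proof -
    have "\<mu> (a + b) (a + b) = \<mu> a a + \<mu> a b + (\<mu> b a + \<mu> b b)"
      by (simp add: lin(1)[THEN linear_add] lin(2)[THEN linear_add] add_ac)
    then show ?thesis
      by (simp add: alt add_eq_0_iff2)
  qed
  have "\<mu> x' (y' - y) \<in> I" "\<mu> y (x' - x) \<in> I"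
    using assms(2) * by (auto simp: lie_ideal_def)
  then have "\<mu> x' (y' - y) - \<mu> y (x' - x) \<in> I"
    using assms(2) by (auto simp: lie_ideal_def intro: subspace_diff)
  also have "\<mu> x' (y' - y) - \<mu> y (x' - x) = \<mu> x' y' - \<mu> x y"
    using anti[of y x'] anti[of y x] by (simp add: lin(1)[THEN linear_diff])
  finally show ?thesis
    by (simp add: ker[symmetric] linear_diff[OF \<pi>] quotient_bracket_def x'_def y'_def)
qed

text \<open>\<open>Hom(I, g/I)\<close>; a map defined on \<open>I\<close> is encoded as a function that is \<open>0\<close> off \<open>I\<close>.\<close>

definition hom_quotient ::
  "'a::real_vector set \<Rightarrow> ('a \<Rightarrow> 'q::real_vector) \<Rightarrow> ('a \<Rightarrow> 'q) set" where
  "hom_quotient I \<pi> = {\<phi>.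
     (\<forall>u\<in>I. \<forall>v\<in>I. \<phi> (u + v) = \<phi> u + \<phi> v) \<and>
     (\<forall>r. \<forall>u\<in>I. \<phi> (r *\<^sub>R u) = r *\<^sub>R \<phi> u) \<and>
     (\<forall>u\<in>I. \<phi> u \<in> range \<pi>) \<and>
     (\<forall>u. u \<notin> I \<longrightarrow> \<phi> u = 0)}"

definition ad_hom ::
  "('a \<Rightarrow> 'a \<Rightarrow> 'a) \<Rightarrow> 'a set \<Rightarrow> ('a \<Rightarrow> 'q) \<Rightarrow> 'a \<Rightarrow> ('a \<Rightarrow> 'q) \<Rightarrow> 'a \<Rightarrow> 'q::real_vector" where
  "ad_hom \<mu> I \<pi> x \<phi> =
     (\<lambda>u. if u \<in> I then quotient_bracket \<mu> \<pi> (\<pi> x) (\<phi> u) - \<phi> (\<mu> x u) else 0)"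

definition ideal_coboundaries ::
  "('a \<Rightarrow> 'a \<Rightarrow> 'a) \<Rightarrow> 'a set \<Rightarrow> ('a \<Rightarrow> 'q) \<Rightarrow> nat \<Rightarrow>
     ('a::real_vector list \<Rightarrow> 'a \<Rightarrow> 'q::real_vector) set" where
  "ideal_coboundaries \<mu> I \<pi> n = ce_coboundaries \<mu> (hom_quotient I \<pi>) (ad_hom \<mu> I \<pi>) n"

definition ideal_cohomology ::
  "('a \<Rightarrow> 'a \<Rightarrow> 'a) \<Rightarrow> 'a set \<Rightarrow> ('a \<Rightarrow> 'q) \<Rightarrow> nat \<Rightarrow>
     ('a::real_vector list \<Rightarrow> 'a \<Rightarrow> 'q::real_vector) set set" where
  "ideal_cohomology \<mu> I \<pi> n = ce_cohomology \<mu> (hom_quotient I \<pi>) (ad_hom \<mu> I \<pi>) n"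

text \<open>\<open>Z\<^sup>0\<close> regarded as a subspace of \<open>Hom(I, g/I)\<close>: a \<open>0\<close>-cochain is identified with its value on
  the empty list.\<close>

definition ideal_Z0 ::
  "('a \<Rightarrow> 'a \<Rightarrow> 'a) \<Rightarrow> 'a set \<Rightarrow> ('a \<Rightarrow> 'q) \<Rightarrow> ('a::real_vector \<Rightarrow> 'q::real_vector) set" where
  "ideal_Z0 \<mu> I \<pi> = (\<lambda>\<omega>. \<omega> []) ` ce_cocycles \<mu> (hom_quotient I \<pi>) (ad_hom \<mu> I \<pi>) 0"

lemma ideal_Z0_eq:
  assumes "lie_bracket \<mu>" "lie_ideal \<mu> I" "quotient_proj \<pi> I"
  shows "ideal_Z0 \<mu> I \<pi> =
    {\<phi> \<in> hom_quotient I \<pi>. \<forall>x. \<forall>u\<in>I. quotient_bracket \<mu> \<pi> (\<pi> x) (\<phi> u) = \<phi> (\<mu> x u)}"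
  (is "_ = ?R")
proof
  show "ideal_Z0 \<mu> I \<pi> \<subseteq> ?R"
  proof
    fix \<phi> assume "\<phi> \<in> ideal_Z0 \<mu> I \<pi>"
    then obtain \<omega> where \<omega>: "\<omega> [] = \<phi>" "\<phi> \<in> hom_quotient I \<pi>" "ce_diff \<mu> (ad_hom \<mu> I \<pi>) \<omega> = 0"
      by (auto simp: ideal_Z0_def ce_cocycles_def ce_cochains_def)
    have "ad_hom \<mu> I \<pi> x \<phi> u = 0" for x u
      using ce_diff_Nil_cochain[of \<mu> "ad_hom \<mu> I \<pi>" \<omega> x] \<omega> by simp
    then have "quotient_bracket \<mu> \<pi> (\<pi> x) (\<phi> u) = \<phi> (\<mu> x u)" if "u \<in> I" for x u
      using that by (metis (no_types, lifting) ad_hom_def eq_iff_diff_eq_0)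
    then show "\<phi> \<in> ?R"
      using \<omega>(2) by blast
  qed
next
  have zero: "ad_hom \<mu> I \<pi> x 0 = 0" for x
    using quotient_bracket_proj[OF assms, of x 0] assms
    by (auto simp: ad_hom_def fun_eq_iff quotient_proj_def linear_0 lie_bracket_def)
  show "?R \<subseteq> ideal_Z0 \<mu> I \<pi>"
  proof
    fix \<phi> assume \<phi>: "\<phi> \<in> ?R"
    define \<omega> where "\<omega> = (\<lambda>xs :: 'a list. if xs = [] then \<phi> else 0)"
    have "ad_hom \<mu> I \<pi> x \<phi> = 0" for x
      using \<phi> by (auto simp: ad_hom_def fun_eq_iff)
    then have "ad_hom \<mu> I \<pi> x (\<omega> ys) = 0" for x ys
      by (simp add: \<omega>_def zero)
    then have "ce_diff \<mu> (ad_hom \<mu> I \<pi>) \<omega> xs = 0" for xs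
      by (simp add: ce_diff_def) (simp add: \<omega>_def)
    then have "ce_diff \<mu> (ad_hom \<mu> I \<pi>) \<omega> = 0"
      by (simp add: fun_eq_iff)
    moreover have "\<omega> \<in> ce_cochains (hom_quotient I \<pi>) 0"
      using \<phi> by (auto simp: ce_cochains_def \<omega>_def)
    ultimately show "\<phi> \<in> ideal_Z0 \<mu> I \<pi>"
      unfolding ideal_Z0_def ce_cocycles_def by (auto simp: \<omega>_def intro!: image_eqI[of _ _ \<omega>])
  qed
qed

definition grassmannian :: "nat \<Rightarrow> 'a::real_vector set set" where
  "grassmannian k = {W. subspace W \<and> dim W = k}"

definition complement :: "'a::real_vector set \<Rightarrow> 'a set \<Rightarrow> bool" where
  "complement W C \<longleftrightarrow>
     subspace W \<and> subspace C \<and> W \<inter> C = {0} \<and> (\<forall>x. \<exists>w\<in>W. \<exists>c\<in>C. x = w + c)"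

text \<open>\<open>Hom(W, C)\<close> for complementary \<open>W\<close> and \<open>C\<close>, as the space of operators that map \<open>W\<close> to \<open>C\<close>
  and vanish on \<open>C\<close>. In finite dimension every linear map is bounded.\<close>

definition hom_compl :: "'a::real_normed_vector set \<Rightarrow> 'a set \<Rightarrow> ('a \<Rightarrow>\<^sub>L 'a) set" where
  "hom_compl W C =
     {T. (\<forall>w\<in>W. blinfun_apply T w \<in> C) \<and> (\<forall>c\<in>C. blinfun_apply T c = 0)}"

definition graph_on :: "'a::real_normed_vector set \<Rightarrow> ('a \<Rightarrow>\<^sub>L 'a) \<Rightarrow> 'a set" where
  "graph_on W T = (\<lambda>w. w + blinfun_apply T w) ` W"

text \<open>The manifold topology: the sets that are open in every graph chart
  \<open>Hom(W, C) \<rightarrow> Gr\<^sub>k\<close>, \<open>T \<mapsto> graph T\<close>.\<close>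

definition gr_open :: "nat \<Rightarrow> 'a::real_normed_vector set set \<Rightarrow> bool" where
  "gr_open k U \<longleftrightarrow> U \<subseteq> grassmannian k \<and>
     (\<forall>W\<in>grassmannian k. \<forall>C. complement W C \<longrightarrow>
        openin (top_of_set (hom_compl W C)) {T \<in> hom_compl W C. graph_on W T \<in> U})"

definition gr_topology :: "nat \<Rightarrow> 'a::real_normed_vector set topology" where
  "gr_topology k = topology (gr_open k)"

lemma openin_gr_topology:
  "openin (gr_topology k) = (gr_open k :: 'a::real_normed_vector set set \<Rightarrow> bool)"
proof -
  have "gr_open k (U \<inter> V)" if "gr_open k U" "gr_open k V" for U V :: "'a set set"
  proof -
    have *: "{T \<in> hom_compl W C. graph_on W T \<in> U \<inter> V} =
        {T \<in> hom_compl W C. graph_on W T \<in> U} \<inter> {T \<in> hom_compl W C. graph_on W T \<in> V}" for W C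
      by blast
    show ?thesis
      using that unfolding gr_open_def * by (auto intro!: openin_Int)
  qed
  moreover have "gr_open k (\<Union>K)" if "\<forall>U\<in>K. gr_open k U" for K :: "'a set set set"
  proof -
    have *: "{T \<in> hom_compl W C. graph_on W T \<in> \<Union>K} =
        \<Union>((\<lambda>U. {T \<in> hom_compl W C. graph_on W T \<in> U}) ` K)" for W C
      by blast
    show ?thesis
      using that unfolding gr_open_def * by (auto intro!: openin_Union)
  qed
  ultimately have "istopology (gr_open k :: 'a set set \<Rightarrow> bool)"
    by (auto simp: istopology_def)
  then show ?thesis
    by (simp add: gr_topology_def)
qed

definition ideals_of_dim :: "('a::real_vector \<Rightarrow> 'a \<Rightarrow> 'a) \<Rightarrow> nat \<Rightarrow> 'a set set" where
  "ideals_of_dim \<mu> k = {W \<in> grassmannian k. lie_ideal \<mu> W}"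

definition stable_ideal :: "('a::real_normed_vector \<Rightarrow> 'a \<Rightarrow> 'a) \<Rightarrow> nat \<Rightarrow> 'a set \<Rightarrow> bool" where
  "stable_ideal \<mu> k I \<longleftrightarrow>
     (\<forall>U. openin (gr_topology k) U \<longrightarrow> I \<in> U \<longrightarrow>
       (\<exists>V. openin bracket_topology V \<and> \<mu> \<in> V \<and> (\<forall>\<mu>'\<in>V. \<exists>I'\<in>U. lie_ideal \<mu>' I')))"

text \<open>\<open>n\<close>-fold continuous differentiability of \<open>f\<close> on \<open>S \<subseteq> E\<close>, for \<open>S\<close> relatively open in the
  finite-dimensional linear space \<open>E\<close>, or a nondegenerate interval in \<open>E = \<real>\<close> (with one-sided
  derivatives at its end points). Only the values of the derivative in directions from \<open>E\<close> are
  determined and used.\<close>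

primrec Ck_on ::
  "nat \<Rightarrow> 'v::real_normed_vector set \<Rightarrow> 'v set \<Rightarrow> ('v \<Rightarrow> 'w::real_normed_vector) \<Rightarrow> bool" where
  "Ck_on 0 E S f \<longleftrightarrow> continuous_on S f"
| "Ck_on (Suc n) E S f \<longleftrightarrow>
     (\<exists>f'. (\<forall>x\<in>S. (f has_derivative f' x) (at x within S)) \<and>
           (\<forall>v\<in>E. Ck_on n E S (\<lambda>x. f' x v)))"

definition smooth_on ::
  "'v::real_normed_vector set \<Rightarrow> 'v set \<Rightarrow> ('v \<Rightarrow> 'w::real_normed_vector) \<Rightarrow> bool" where
  "smooth_on E S f \<longleftrightarrow> (\<forall>n. Ck_on n E S f)"

text \<open>\<open>P\<close> is a \<open>d\<close>-dimensional embedded submanifold of the relatively open subset \<open>Q\<close> of \<open>E\<close>,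
  with a single slice chart \<open>\<Psi>\<close> defined on all of \<open>Q\<close>.\<close>

definition slice_submanifold ::
  "'v::real_normed_vector set \<Rightarrow> 'v set \<Rightarrow> 'v set \<Rightarrow> nat \<Rightarrow> bool" where
  "slice_submanifold E Q P d \<longleftrightarrow>
     (\<exists>Q' \<Psi> \<Theta> L. openin (top_of_set E) Q \<and> openin (top_of_set E) Q' \<and>
        \<Psi> ` Q = Q' \<and> \<Theta> ` Q' = Q \<and>
        (\<forall>x\<in>Q. \<Theta> (\<Psi> x) = x) \<and> (\<forall>y\<in>Q'. \<Psi> (\<Theta> y) = y) \<and>
        smooth_on E Q \<Psi> \<and> smooth_on E Q' \<Theta> \<and>
        subspace L \<and> L \<subseteq> E \<and> dim L = d \<and> P \<subseteq> Q \<and> \<Psi> ` P = Q' \<inter> L)"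

text \<open>\<open>S \<subseteq> Gr\<^sub>k\<close> is, in some neighbourhood \<open>U\<close> of \<open>W \<in> S\<close> contained in the domain of a graph
  chart centred at \<open>W\<close>, a \<open>d\<close>-dimensional embedded submanifold of \<open>Gr\<^sub>k\<close>.\<close>

definition gr_submanifold_near ::
  "nat \<Rightarrow> 'a::real_normed_vector set set \<Rightarrow> 'a set \<Rightarrow> nat \<Rightarrow> bool" where
  "gr_submanifold_near k S W d \<longleftrightarrow> W \<in> S \<and>
     (\<exists>U C. openin (gr_topology k) U \<and> W \<in> U \<and> complement W C \<and>
        U \<subseteq> graph_on W ` hom_compl W C \<and>
        slice_submanifold (hom_compl W C)
          {T \<in> hom_compl W C. graph_on W T \<in> U}
          {T \<in> hom_compl W C. graph_on W T \<in> U \<inter> S} d)"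

definition gr_smooth_curve ::
  "nat \<Rightarrow> real set \<Rightarrow> (real \<Rightarrow> 'a::real_normed_vector set) \<Rightarrow> bool" where
  "gr_smooth_curve k J c \<longleftrightarrow>
     (\<forall>t\<in>J. c t \<in> grassmannian k) \<and>
     (\<forall>t\<in>J. \<exists>N W C \<phi>. open N \<and> t \<in> N \<and> W \<in> grassmannian k \<and> complement W C \<and>
        (\<forall>s\<in>J \<inter> N. \<phi> s \<in> hom_compl W C \<and> c s = graph_on W (\<phi> s)) \<and>
        smooth_on UNIV (J \<inter> N) \<phi>)"

text \<open>The velocity at \<open>t = 0\<close> of the curve \<open>c\<close> in \<open>Gr\<^sub>k\<close>, as the element of
  \<open>T\<^bsub>W\<^esub> Gr\<^sub>k = Hom(W, g/W)\<close> with \<open>W = c 0\<close>; here \<open>\<pi>\<close> presents \<open>g/W\<close>.\<close>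

definition gr_has_velocity ::
  "('a::real_normed_vector \<Rightarrow> 'q::real_vector) \<Rightarrow> real set \<Rightarrow> (real \<Rightarrow> 'a set) \<Rightarrow> ('a \<Rightarrow> 'q) \<Rightarrow> bool"
  where
  "gr_has_velocity \<pi> J c \<eta> \<longleftrightarrow>
     (\<exists>C \<phi> D. complement (c 0) C \<and> \<phi> 0 = 0 \<and>
        (\<forall>\<^sub>F t in at 0 within J. \<phi> t \<in> hom_compl (c 0) C \<and> c t = graph_on (c 0) (\<phi> t)) \<and>
        (\<phi> has_vector_derivative D) (at 0 within J) \<and>
        \<eta> = (\<lambda>u. if u \<in> c 0 then \<pi> (blinfun_apply D u) else 0))"

definition gr_tangent_space ::
  "('a::real_normed_vector \<Rightarrow> 'q::real_vector) \<Rightarrow> nat \<Rightarrow> 'a set set \<Rightarrow> 'a set \<Rightarrow> ('a \<Rightarrow> 'q) set"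
  where
  "gr_tangent_space \<pi> k S W =
     {\<eta>. \<exists>c. gr_smooth_curve k {-1<..<1} c \<and> c 0 = W \<and> (\<forall>t\<in>{-1<..<1}. c t \<in> S) \<and>
          gr_has_velocity \<pi> {-1<..<1} c \<eta>}"

definition deformation_class ::
  "('a::real_normed_vector \<Rightarrow> 'a \<Rightarrow> 'a) \<Rightarrow> nat \<Rightarrow> 'a set \<Rightarrow> ('a \<Rightarrow> 'q::real_vector) \<Rightarrow> ('a \<Rightarrow> 'q) \<Rightarrow> bool"
  where
  "deformation_class \<mu> k I \<pi> \<eta> \<longleftrightarrow>
     (\<exists>c. gr_smooth_curve k {0..1} c \<and> c 0 = I \<and> (\<forall>t\<in>{0..1}. lie_ideal \<mu> (c t)) \<and>
          gr_has_velocity \<pi> {0..1} c \<eta>)"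

end

theory Submission
  imports Defs
begin

text \<open>
  Fix a complement \<open>C\<close> of the ideal \<open>W\<close>, with projection \<open>p\<close> onto \<open>W\<close> and \<open>q = 1 - p\<close>. Subspaces near
  \<open>W\<close> are graphs of \<open>T \<in> Hom(W, C)\<close>, and for a bracket \<open>m\<close> the graph of \<open>T\<close> is an ideal iff
  \<open>defect m T (x, u) = (q - T) (m x (u + T u))\<close> vanishes. At the given bracket \<open>m0\<close> the defect has
  vanishing constant term, its linear part is the Chevalley--Eilenberg differential \<open>d0\<close> on
  \<open>0\<close>-cochains, and the rest is quadratic. The defect takes values in \<open>1\<close>-cochains, so \<open>defect = 0\<close>
  is an overdetermined system.

  What makes the system tractable is that the Jacobi identity of \<open>m\<close> gives a linear relation
  \<open>bianchi m T (defect m T) = 0\<close> whose operator is the differential on \<open>1\<close>-cochains at \<open>m = m0\<close>,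
  \<open>T = 0\<close> (\<open>bianchi_defect\<close>). Let \<open>h\<close> be a right inverse of \<open>d0\<close> on its image. If \<open>H\<^sup>1\<close> vanishes, a
  \<open>1\<close>-cocycle \<open>f\<close> with \<open>d0 (h f) = 0\<close> is zero; by finite dimension this injectivity is quantitative
  and survives small changes of \<open>m\<close> and \<open>T\<close>. Hence near \<open>(m0, 0)\<close> the defect vanishes as soon as
  \<open>d0 (h (defect m T)) = 0\<close> (\<open>defect_zero_if_projection_zero\<close>), and this reduced equation is
  unobstructed:

  \<^item> The map \<open>T \<mapsto> T + h (defect m T) - h (d0 T)\<close> is a small perturbation of the identity. Solving for
    the value \<open>0\<close> by Banach's fixed point theorem gives an ideal near \<open>W\<close> for every bracket near
    \<open>m0\<close>, which is stability.

  \<^item> For \<open>m = m0\<close> the map is \<open>T \<mapsto> T + B T T / 2\<close> with \<open>B\<close> bounded, symmetric and bilinear. It is a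
    diffeomorphism near \<open>0\<close>, and the graph of \<open>T\<close> is an ideal iff the image of \<open>T\<close> lies in the
    kernel \<open>Z\<close> of \<open>d0\<close>. This is a slice chart of dimension \<open>dim Z\<^sup>0\<close>.

  \<^item> Pulling back a curve in \<open>Z\<close> through \<open>0\<close> with velocity \<open>z\<close> gives a curve of ideals with velocity
    \<open>z\<close>. Conversely, differentiating \<open>defect m0 (\<phi> t) = 0\<close> at \<open>t = 0\<close> shows that velocities of curves
    of ideals are cocycles.

  The underlying space is an arbitrary real normed space with a finite spanning set, so
  completeness and boundedness of linear maps are deduced from that set. Smoothness of the inverse
  chart is read off from the quadratic equation that it solves.
\<close>

section \<open>Finite-dimensional normed spaces\<close>

text \<open>A predicate on types rather than a type class, since finite dimension of the space enters only as the
  existence of a finite spanning set.\<close>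

definition finite_dim :: "'a::real_vector itself \<Rightarrow> bool" where
  "finite_dim _ \<longleftrightarrow> (\<exists>B::'a set. finite B \<and> span B = UNIV)"

text \<open>If \<open>e > 0\<close> is at most the distance from \<open>v\<close> to \<open>W\<close>, then \<open>e * \<bar>a\<bar> \<le> norm (a *\<^sub>R v + w)\<close>; so \<open>1 / e\<close> will
  do. This drives the inductions over a spanning set below.\<close>

lemma closed_subspace_coefficient_bound:
  fixes W :: "'a::real_normed_vector set"
  assumes "subspace W" "closed W" "v \<notin> W"
  obtains K where "K \<ge> 0" "\<And>a w. w \<in> W \<Longrightarrow> \<bar>a\<bar> \<le> K * norm (a *\<^sub>R v + w)"
proof -
  have "open (- W)" "v \<in> - W" using assms by auto
  then obtain e where e: "e > 0" "ball v e \<subseteq> - W"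
    using open_contains_ball by blast
  have "\<bar>a\<bar> \<le> 1 / e * norm (a *\<^sub>R v + w)" if w: "w \<in> W" for a w
  proof (cases "a = 0")
    case False
    have "- (inverse a *\<^sub>R w) \<in> W"
      using w assms(1) by (simp add: subspace_neg subspace_scale)
    then have "\<not> dist v (- (inverse a *\<^sub>R w)) < e" using e by auto
    then have "e \<le> norm (v + inverse a *\<^sub>R w)" by (simp add: dist_norm)
    then have "\<bar>a\<bar> * e \<le> \<bar>a\<bar> * norm (v + inverse a *\<^sub>R w)"
      by (simp add: mult_left_mono)
    also have "\<dots> = norm (a *\<^sub>R (v + inverse a *\<^sub>R w))" by simp
    also have "\<dots> = norm (a *\<^sub>R v + w)" using False by (simp add: scaleR_add_right)
    finally show ?thesis using e by (simp add: field_simps)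
  qed (use e in auto)
  then show ?thesis using that[of "1/e"] e by auto
qed

lemma Cauchy_minus_sequences:
  fixes X Y :: "nat \<Rightarrow> 'a::real_normed_vector"
  assumes "Cauchy X" "Cauchy Y"
  shows "Cauchy (\<lambda>n. X n - Y n)"
proof (rule metric_CauchyI)
  fix e :: real assume "e > 0"
  then obtain M N where M: "\<And>m n. m \<ge> M \<Longrightarrow> n \<ge> M \<Longrightarrow> dist (X m) (X n) < e / 2"
    and N: "\<And>m n. m \<ge> N \<Longrightarrow> n \<ge> N \<Longrightarrow> dist (Y m) (Y n) < e / 2"
    using assms by (meson half_gt_zero metric_CauchyD)
  have "dist (X m - Y m) (X n - Y n) < e" if "m \<ge> max M N" "n \<ge> max M N" for m n
  proof -
    have "dist (X m - Y m) (X n - Y n) \<le> dist (X m) (X n) + dist (Y m) (Y n)"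
      using norm_triangle_ineq4[of "X m - X n" "Y m - Y n"] by (simp add: dist_norm algebra_simps)
    then show ?thesis using M[of m n] N[of m n] that by simp
  qed
  then show "\<exists>M. \<forall>m\<ge>M. \<forall>n\<ge>M. dist (X m - Y m) (X n - Y n) < e" by blast
qed

text \<open>Adding one vector at a time: by the coefficient bound, the coefficients of the new vector along a
  Cauchy sequence are again Cauchy, and so are the remainders in the smaller span.\<close>

lemma complete_span_finite:
  fixes B :: "'a::real_normed_vector set"
  assumes "finite B"
  shows "complete (span B)"
  using assms
proof (induction B)
  case empty
  then show ?case by (simp add: compact_imp_complete)
next
  case (insert v B)
  show ?case
  proof (cases "v \<in> span B")
    case True
    then show ?thesis using insert.IH by (simp add: span_redundant)
  next
    case False
    obtain K where K: "K \<ge> 0" "\<And>a w. w \<in> span B \<Longrightarrow> \<bar>a\<bar> \<le> K * norm (a *\<^sub>R v + w)"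
      using closed_subspace_coefficient_bound[OF subspace_span complete_imp_closed[OF insert.IH] False]
      by blast
    show ?thesis unfolding complete_def
    proof (intro allI impI, elim conjE)
      fix f :: "nat \<Rightarrow> 'a" assume f: "\<forall>n. f n \<in> span (insert v B)" "Cauchy f"
      have "\<forall>n. \<exists>a. f n - a *\<^sub>R v \<in> span B" using f(1) by (simp add: span_breakdown_eq)
      then obtain a where a: "\<And>n. f n - a n *\<^sub>R v \<in> span B" by metis
      have bd: "\<bar>a m - a n\<bar> \<le> K * norm (f m - f n)" for m n
        using K(2)[OF span_diff[OF a[of m] a[of n]], of "a m - a n"]
        by (simp add: algebra_simps)
      have "Cauchy a"
      proof (rule metric_CauchyI)
        fix e :: real assume "e > 0"
        then have "e / (K + 1) > 0" using K by simp
        then obtain M where M: "\<And>m n. m \<ge> M \<Longrightarrow> n \<ge> M \<Longrightarrow> dist (f m) (f n) < e / (K + 1)"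
          using f(2) metric_CauchyD by meson
        have "dist (a m) (a n) < e" if "m \<ge> M" "n \<ge> M" for m n
        proof -
          have "dist (a m) (a n) \<le> K * norm (f m - f n)" using bd by (simp add: dist_real_def)
          also have "\<dots> \<le> (K + 1) * norm (f m - f n)" by (simp add: mult_right_mono)
          also have "\<dots> < e" using M[OF that] K by (simp add: dist_norm field_simps)
          finally show ?thesis .
        qed
        then show "\<exists>M. \<forall>m\<ge>M. \<forall>n\<ge>M. dist (a m) (a n) < e" by blast
      qed
      then obtain a' where a': "a \<longlonglongrightarrow> a'" using Cauchy_convergent convergent_def by blast
      then have av: "(\<lambda>n. a n *\<^sub>R v) \<longlonglongrightarrow> a' *\<^sub>R v" by (intro tendsto_intros)
      have "Cauchy (\<lambda>n. f n - a n *\<^sub>R v)"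
        by (rule Cauchy_minus_sequences[OF f(2) LIMSEQ_imp_Cauchy[OF av]])
      then obtain w where w: "w \<in> span B" "(\<lambda>n. f n - a n *\<^sub>R v) \<longlonglongrightarrow> w"
        using insert.IH a unfolding complete_def by meson
      from tendsto_add[OF w(2) av]
      have "f \<longlonglongrightarrow> w + a' *\<^sub>R v" by simp
      moreover have "w + a' *\<^sub>R v \<in> span (insert v B)"
        using w(1) by (auto simp: span_breakdown_eq intro!: exI[of _ a'])
      ultimately show "\<exists>l\<in>span (insert v B). f \<longlonglongrightarrow> l" by blast
    qed
  qed
qed

lemma complete_finite_dim:
  assumes "finite_dim TYPE('a::real_normed_vector)"
  shows "complete (UNIV :: 'a set)"
  using assms complete_span_finite unfolding finite_dim_def by metis

text \<open>The same induction: split off the component along the new vector, whose size is controlled by the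
  coefficient bound.\<close>

lemma linear_bounded_on_span:
  fixes f :: "'a::real_normed_vector \<Rightarrow> 'b::real_normed_vector"
  assumes "finite B" "linear f"
  shows "\<exists>K\<ge>0. \<forall>x\<in>span B. norm (f x) \<le> K * norm x"
  using assms(1)
proof (induction B)
  case empty
  then show ?case using linear_0[OF assms(2)] by (intro exI[of _ 0]) auto
next
  case (insert v B)
  show ?case
  proof (cases "v \<in> span B")
    case True
    then show ?thesis using insert.IH by (simp add: span_redundant)
  next
    case False
    obtain K where K: "K \<ge> 0" "\<And>a w. w \<in> span B \<Longrightarrow> \<bar>a\<bar> \<le> K * norm (a *\<^sub>R v + w)"
      using closed_subspace_coefficient_bound[OF subspace_span _ False]
        complete_imp_closed complete_span_finite insert.hyps by metis
    obtain L where L: "L \<ge> 0" "\<And>x. x \<in> span B \<Longrightarrow> norm (f x) \<le> L * norm x"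
      using insert.IH by blast
    have "norm (f x) \<le> (K * norm (f v) + L * (1 + K * norm v)) * norm x"
      if x: "x \<in> span (insert v B)" for x
    proof -
      obtain a where a: "x - a *\<^sub>R v \<in> span B" using x by (auto simp: span_breakdown_eq)
      have a1: "\<bar>a\<bar> \<le> K * norm x" using K(2)[OF a, of a] by simp
      have "f x = a *\<^sub>R f v + f (x - a *\<^sub>R v)"
        by (simp add: linear_diff[OF assms(2)] linear_scale[OF assms(2)])
      then have "norm (f x) \<le> \<bar>a\<bar> * norm (f v) + norm (f (x - a *\<^sub>R v))"
        by (metis norm_scaleR norm_triangle_ineq)
      also have "\<dots> \<le> (K * norm x) * norm (f v) + L * norm (x - a *\<^sub>R v)"
        by (intro add_mono mult_right_mono a1 L a) simp
      also have "\<dots> \<le> (K * norm x) * norm (f v) + L * (norm x + (K * norm x) * norm v)"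
      proof -
        have "norm (x - a *\<^sub>R v) \<le> norm x + (K * norm x) * norm v"
          using norm_triangle_ineq4[of x "a *\<^sub>R v"] mult_right_mono[OF a1, of "norm v"] by simp
        then show ?thesis using L(1) by (simp add: mult_left_mono)
      qed
      finally show ?thesis by (simp add: algebra_simps)
    qed
    then show ?thesis using K(1) L(1)
      by (intro exI[of _ "K * norm (f v) + L * (1 + K * norm v)"]) auto
  qed
qed

lemma linear_imp_bounded_linear:
  fixes f :: "'a::real_normed_vector \<Rightarrow> 'b::real_normed_vector"
  assumes "finite_dim TYPE('a)" "linear f"
  shows "bounded_linear f"
proof -
  obtain B :: "'a set" where B: "finite B" "span B = UNIV"
    using assms(1) by (auto simp: finite_dim_def)
  obtain K where "\<And>x. norm (f x) \<le> K * norm x"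
    using linear_bounded_on_span[OF B(1) assms(2)] B(2) by auto
  then show ?thesis using assms(2)
    by (intro bounded_linear_intro[of f K]) (auto simp: linear_add linear_scale mult.commute)
qed

lemma apply_Blinfun_linear:
  fixes f :: "'a::real_normed_vector \<Rightarrow> 'b::real_normed_vector"
  assumes "finite_dim TYPE('a)" "linear f"
  shows "blinfun_apply (Blinfun f) = f"
  by (rule bounded_linear_Blinfun_apply) (rule linear_imp_bounded_linear[OF assms])

lemma linear_blinfun_apply: "linear (blinfun_apply f)"
  by (simp add: bounded_linear.linear blinfun.bounded_linear_right)

lemma linear_Blinfun_family:
  fixes g :: "'a::real_vector \<Rightarrow> 'b::real_normed_vector \<Rightarrow> 'c::real_normed_vector"
  assumes "finite_dim TYPE('b)" "\<And>x. linear (g x)" "\<And>y. linear (\<lambda>x. g x y)"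
  shows "linear (\<lambda>x. Blinfun (g x))"
  by (intro linearI blinfun_eqI)
    (simp_all add: apply_Blinfun_linear assms plus_blinfun.rep_eq scaleR_blinfun.rep_eq
      linear_add[OF assms(3)] linear_scale[OF assms(3)])

text \<open>Curried bounded bilinear operators. In finite dimension every bilinear map arises in this way, so
  analytic objects can be described by pointwise formulas.\<close>

definition blinfun2 :: "('a \<Rightarrow> 'b \<Rightarrow> 'c) \<Rightarrow>
    'a::real_normed_vector \<Rightarrow>\<^sub>L 'b::real_normed_vector \<Rightarrow>\<^sub>L 'c::real_normed_vector"
  where "blinfun2 g = Blinfun (\<lambda>x. Blinfun (g x))"

lemma apply_blinfun2:
  fixes g :: "'a::real_normed_vector \<Rightarrow> 'b::real_normed_vector \<Rightarrow> 'c::real_normed_vector"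
  assumes "finite_dim TYPE('a)" "finite_dim TYPE('b)"
    and "\<And>x. linear (g x)" "\<And>y. linear (\<lambda>x. g x y)"
  shows "blinfun_apply (blinfun_apply (blinfun2 g) x) y = g x y"
  by (simp add: blinfun2_def apply_Blinfun_linear assms linear_Blinfun_family)

text \<open>The coordinate functionals of a basis are bounded, so statements about operators reduce to their values
  on that basis.\<close>

lemma blinfun_eq_sum_coordinates:
  assumes "finite_dim TYPE('a::real_normed_vector)"
  obtains B :: "'a::real_normed_vector set" and c :: "'a \<Rightarrow> 'a \<Rightarrow>\<^sub>L real" where
    "finite B" "\<And>x. x = (\<Sum>b\<in>B. blinfun_apply (c b) x *\<^sub>R b)"
proof -
  obtain A :: "'a set" where A: "finite A" "span A = UNIV"
    using assms by (auto simp: finite_dim_def)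
  obtain B where B: "B \<subseteq> A" "independent B" "span B = UNIV"
    using maximal_independent_subset[of A] A(2) 
    by (metis span_eq span_superset subset_UNIV subset_antisym span_mono span_span)
  have fB: "finite B" using A(1) B(1) finite_subset by blast
  define c where "c b = Blinfun (\<lambda>x. representation B x b)" for b
  have "blinfun_apply (c b) x = representation B x b" for b x
    unfolding c_def
    using B by (subst apply_Blinfun_linear[OF assms])
      (auto intro!: linearI simp: representation_add representation_scale)
  then have "x = (\<Sum>b\<in>B. c b x *\<^sub>R b)" for x
    using sum_representation_eq[OF B(2) _ fB, of x] B(3) by simp
  with fB show ?thesis using that by blast
qed

text \<open>An operator is the sum of the rank-one operators \<open>x \<mapsto> c b x \<cdot> T b\<close>, each of which depends linearly
  on \<open>T b\<close>.\<close>

lemma finite_dim_blinfun: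
  assumes "finite_dim TYPE('a::real_normed_vector)" "finite_dim TYPE('b::real_normed_vector)"
  shows "finite_dim TYPE('a \<Rightarrow>\<^sub>L 'b)"
proof -
  obtain B :: "'a set" and c :: "'a \<Rightarrow> 'a \<Rightarrow>\<^sub>L real" where
    B: "finite B" "\<And>x. x = (\<Sum>b\<in>B. blinfun_apply (c b) x *\<^sub>R b)"
    using blinfun_eq_sum_coordinates[OF assms(1)] by blast
  obtain D :: "'b set" where D: "finite D" "span D = UNIV"
    using assms(2) by (auto simp: finite_dim_def)
  define r where "r b y = Blinfun (\<lambda>x. c b x *\<^sub>R y)" for b and y :: 'b
  have r: "blinfun_apply (r b y) x = c b x *\<^sub>R y" for b x y
    unfolding r_def by (subst apply_Blinfun_linear[OF assms(1)])
      (auto intro!: linearI simp: blinfun.bilinear_simps algebra_simps)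
  have lin: "linear (r b)" for b
    by (intro linearI blinfun_eqI) (simp_all add: r blinfun.bilinear_simps algebra_simps)
  have "T \<in> span (\<Union>b\<in>B. r b ` D)" for T :: "'a \<Rightarrow>\<^sub>L 'b"
  proof -
    have "T = (\<Sum>b\<in>B. r b (T b))"
    proof (rule blinfun_eqI)
      fix x
      have "T x = T (\<Sum>b\<in>B. c b x *\<^sub>R b)" using B(2) by metis
      then show "T x = (\<Sum>b\<in>B. r b (T b)) x"
        by (simp add: blinfun.sum_right blinfun.sum_left blinfun.scaleR_right r)
    qed
    moreover have "r b (T b) \<in> span (\<Union>b\<in>B. r b ` D)" if "b \<in> B" for b
    proof -
      have "r b (T b) \<in> r b ` span D" using D by auto
      also have "\<dots> = span (r b ` D)" by (simp add: linear_span_image lin)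
      also have "\<dots> \<subseteq> span (\<Union>b\<in>B. r b ` D)" using that by (intro span_mono) auto
      finally show ?thesis .
    qed
    ultimately show ?thesis by (metis (no_types, lifting) span_sum)
  qed
  then have "span (\<Union>b\<in>B. r b ` D) = UNIV" by auto
  then show ?thesis unfolding finite_dim_def using B(1) D(1)
    by (intro exI[of _ "\<Union>b\<in>B. r b ` D"]) auto
qed

text \<open>This bound compares pointwise convergence of brackets with convergence in operator norm.\<close>

lemma norm_blinfun_le_sum:
  assumes "finite_dim TYPE('a::real_normed_vector)"
  obtains B :: "'a::real_normed_vector set" and K where "finite B" "K \<ge> 0"
    "\<And>T :: 'a \<Rightarrow>\<^sub>L 'b::real_normed_vector. norm T \<le> K * (\<Sum>b\<in>B. norm (blinfun_apply T b))"
proof -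
  obtain B :: "'a set" and c :: "'a \<Rightarrow> 'a \<Rightarrow>\<^sub>L real" where
    B: "finite B" "\<And>x. x = (\<Sum>b\<in>B. blinfun_apply (c b) x *\<^sub>R b)"
    using blinfun_eq_sum_coordinates[OF assms(1)] by blast
  define K where "K = (\<Sum>b\<in>B. norm (c b))"
  have K: "K \<ge> 0" "norm (c b) \<le> K" if "b \<in> B" for b
    unfolding K_def using member_le_sum[of b B "\<lambda>b. norm (c b)"] that B(1)
    by (auto intro: sum_nonneg)
  have "norm T \<le> K * (\<Sum>b\<in>B. norm (T b))" for T :: "'a \<Rightarrow>\<^sub>L 'b"
  proof (rule norm_blinfun_bound)
    fix x
    have "T x = T (\<Sum>b\<in>B. c b x *\<^sub>R b)" using B(2) by metis
    then have "norm (T x) = norm (\<Sum>b\<in>B. c b x *\<^sub>R T b)"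
      by (simp add: blinfun.sum_right blinfun.scaleR_right)
    also have "\<dots> \<le> (\<Sum>b\<in>B. (K * norm x) * norm (T b))"
    proof (rule sum_norm_le)
      fix b assume "b \<in> B"
      have "\<bar>c b x\<bar> \<le> K * norm x"
        using norm_blinfun[of "c b" x] mult_right_mono[OF K(2)[OF \<open>b \<in> B\<close>] norm_ge_zero[of x]] by simp
      then show "norm (c b x *\<^sub>R T b) \<le> K * norm x * norm (T b)"
        by (simp add: mult_right_mono)
    qed
    finally show "norm (T x) \<le> K * (\<Sum>b\<in>B. norm (T b)) * norm x"
      by (simp add: sum_distrib_left sum_distrib_right algebra_simps)
  qed (auto simp: K_def sum_nonneg)
  moreover have "K \<ge> 0" by (simp add: K_def sum_nonneg)
  ultimately show ?thesis using that B(1) by blast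
qed

lemma dim_image_linear_inj_on:
  fixes f :: "'a::real_vector \<Rightarrow> 'b::real_vector"
  assumes "linear f" "inj_on f V" "subspace V"
  shows "dim (f ` V) = dim V"
proof -
  obtain B where B: "B \<subseteq> V" "independent B" "V \<subseteq> span B" "card B = dim V"
    using basis_exists by blast
  have V: "span B = V" using B assms(3) by (simp add: span_minimal subset_antisym)
  have "independent (f ` B)"
    using linear_independent_injective_image[OF assms(1) B(2)] assms(2) V by simp
  moreover have "card (f ` B) = card B"
    using assms(2) B(1) by (meson card_image inj_on_subset)
  moreover have "f ` V = span (f ` B)" using V linear_span_image[OF assms(1), of B] by simp
  ultimately show ?thesis using B(4) by (metis dim_span_eq_card_independent)
qed

text \<open>A counting argument with bases; the ambient space is finite-dimensional but is not an instance of a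
  class of finite-dimensional spaces.\<close>

lemma inj_linear_onto_same_dim:
  fixes f :: "'a::real_vector \<Rightarrow> 'b::real_vector"
  assumes "linear f" "inj_on f V" "subspace V" "subspace W" "f ` V \<subseteq> W" "dim V = dim W"
    and fd: "finite_dim TYPE('b)"
  shows "f ` V = W"
proof -
  obtain A :: "'b set" where A: "finite A" "span A = UNIV" using fd by (auto simp: finite_dim_def)
  have finI: "finite S" if "independent S" for S :: "'b set"
    using independent_span_bound[OF A(1) that] A(2) by simp
  have sub: "subspace (f ` V)" using assms by (simp add: linear_subspace_image)
  obtain B where B: "B \<subseteq> f ` V" "independent B" "f ` V \<subseteq> span B" "card B = dim (f ` V)"
    using basis_exists by blast
  obtain C where C: "B \<subseteq> C" "C \<subseteq> W" "independent C" "W \<subseteq> span C"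
    using maximal_independent_subset_extend[of B W] B assms(5) by blast
  have "card C = dim W" using C(2,3,4) by (metis dim_eq_card_independent dim_eq_span subset_antisym span_minimal assms(4) dim_span)
  then have "card C = card B" using B(4) dim_image_linear_inj_on[OF assms(1-3)] assms(6) by simp
  then have "B = C" using C(1) finI[OF C(3)] by (metis card_subset_eq)
  then have "W \<subseteq> f ` V" using C(4) B(1) sub span_minimal by blast
  then show ?thesis using assms(5) by blast
qed

section \<open>Calculus of \<open>Ck_on\<close>\<close>

lemma Ck_on_SucE:
  assumes "Ck_on (Suc n) E S f"
  obtains f' where "\<And>x. x \<in> S \<Longrightarrow> (f has_derivative f' x) (at x within S)"
    "\<And>v. v \<in> E \<Longrightarrow> Ck_on n E S (\<lambda>x. f' x v)"
  using assms that unfolding Ck_on.simps by meson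

lemma Ck_on_SucI:
  assumes "\<And>x. x \<in> S \<Longrightarrow> (f has_derivative f' x) (at x within S)"
    "\<And>v. v \<in> E \<Longrightarrow> Ck_on n E S (\<lambda>x. f' x v)"
  shows "Ck_on (Suc n) E S f"
  using assms unfolding Ck_on.simps by blast

lemma Ck_on_Suc_imp_Ck_on: "Ck_on (Suc n) E S f \<Longrightarrow> Ck_on n E S f"
proof (induction n arbitrary: f)
  case 0
  then show ?case
    by (metis Ck_on.simps(1) Ck_on_SucE continuous_on_eq_continuous_within has_derivative_continuous)
next
  case (Suc n)
  from Suc.prems obtain f' where "\<And>x. x \<in> S \<Longrightarrow> (f has_derivative f' x) (at x within S)"
    "\<And>v. v \<in> E \<Longrightarrow> Ck_on (Suc n) E S (\<lambda>x. f' x v)" using Ck_on_SucE by metis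
  then show ?case using Suc.IH by (intro Ck_on_SucI) auto
qed

lemma Ck_on_mono_le: "Ck_on n E S f \<Longrightarrow> m \<le> n \<Longrightarrow> Ck_on m E S f"
  proof (induction n)
  case (Suc n)
  then show ?case using Ck_on_Suc_imp_Ck_on by (metis le_Suc_eq)
qed simp

lemma Ck_on_subset:
  "Ck_on n E S f \<Longrightarrow> S' \<subseteq> S \<Longrightarrow> E' \<subseteq> E \<Longrightarrow> Ck_on n E' S' f"
proof (induction n arbitrary: f)
  case 0
  then show ?case by (auto intro: continuous_on_subset)
next
  case (Suc n)
  from Suc.prems(1) obtain f' where f': "\<And>x. x \<in> S \<Longrightarrow> (f has_derivative f' x) (at x within S)"
    "\<And>v. v \<in> E \<Longrightarrow> Ck_on n E S (\<lambda>x. f' x v)" by (rule Ck_on_SucE) blast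
  have "(f has_derivative f' x) (at x within S')" if "x \<in> S'" for x
    using f'(1) that Suc.prems(2) by (meson has_derivative_subset subsetD)
  moreover have "Ck_on n E' S' (\<lambda>x. f' x v)" if "v \<in> E'" for v
    using f'(2) that Suc.IH Suc.prems(2,3) by blast
  ultimately show ?case by (rule Ck_on_SucI)
qed

lemma Ck_on_const: "Ck_on n E S (\<lambda>x. c)"
proof (induction n arbitrary: c)
  case (Suc n)
  show ?case by (rule Ck_on_SucI[of _ _ "\<lambda>x v. 0"]) (auto intro: Suc)
qed simp

lemma Ck_on_linear:
  assumes "bounded_linear f" shows "Ck_on n E S f"
proof (cases n)
  case 0
  then show ?thesis using assms by (simp add: linear_continuous_on)
next
  case (Suc m)
  show ?thesis unfolding Suc
    by (rule Ck_on_SucI[of _ _ "\<lambda>x. f"]) (auto intro: assms Ck_on_const bounded_linear_imp_has_derivative)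
qed

lemma Ck_on_add:
  "Ck_on n E S f \<Longrightarrow> Ck_on n E S g \<Longrightarrow> Ck_on n E S (\<lambda>x. f x + g x)"
proof (induction n arbitrary: f g)
  case 0
  then show ?case by (auto intro: continuous_on_add)
next
  case (Suc n)
  from Suc.prems obtain f' g' where
    "\<And>x. x \<in> S \<Longrightarrow> (f has_derivative f' x) (at x within S)" "\<And>v. v \<in> E \<Longrightarrow> Ck_on n E S (\<lambda>x. f' x v)"
    "\<And>x. x \<in> S \<Longrightarrow> (g has_derivative g' x) (at x within S)" "\<And>v. v \<in> E \<Longrightarrow> Ck_on n E S (\<lambda>x. g' x v)"
    using Ck_on_SucE by metis
  then show ?case
    by (intro Ck_on_SucI[where f' = "\<lambda>x v. f' x v + g' x v"] has_derivative_add Suc.IH) simp_all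
qed

lemma Ck_on_bounded_linear_compose:
  assumes "bounded_linear L"
  shows "Ck_on n E S f \<Longrightarrow> Ck_on n E S (\<lambda>x. L (f x))"
proof (induction n arbitrary: f)
  case 0
  then show ?case using assms by (auto intro: bounded_linear.continuous_on)
next
  case (Suc n)
  from Suc.prems obtain f' where
    "\<And>x. x \<in> S \<Longrightarrow> (f has_derivative f' x) (at x within S)" "\<And>v. v \<in> E \<Longrightarrow> Ck_on n E S (\<lambda>x. f' x v)"
    using Ck_on_SucE by metis
  then show ?case
    by (intro Ck_on_SucI[where f' = "\<lambda>x v. L (f' x v)"] bounded_linear.has_derivative[OF assms] Suc.IH) simp_all
qed

text \<open>Induction through the Leibniz rule; the factors themselves are used at the lower order.\<close>

lemma Ck_on_bounded_bilinear:
  assumes "bounded_bilinear b"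
  shows "Ck_on n E S f \<Longrightarrow> Ck_on n E S g \<Longrightarrow> Ck_on n E S (\<lambda>x. b (f x) (g x))"
proof (induction n arbitrary: f g)
  case 0
  then show ?case using assms by (auto intro: bounded_bilinear.continuous_on)
next
  case (Suc n)
  from Suc.prems obtain f' g' where
    f': "\<And>x. x \<in> S \<Longrightarrow> (f has_derivative f' x) (at x within S)" "\<And>v. v \<in> E \<Longrightarrow> Ck_on n E S (\<lambda>x. f' x v)" and
    g': "\<And>x. x \<in> S \<Longrightarrow> (g has_derivative g' x) (at x within S)" "\<And>v. v \<in> E \<Longrightarrow> Ck_on n E S (\<lambda>x. g' x v)"
    using Ck_on_SucE by metis
  have C: "Ck_on n E S f" "Ck_on n E S g" using Suc.prems Ck_on_Suc_imp_Ck_on by blast+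
  have D: "Ck_on n E S (\<lambda>x. b (f x) (g' x v) + b (f' x v) (g x))" if "v \<in> E" for v
    by (rule Ck_on_add[OF Suc.IH[OF C(1) g'(2)[OF that]] Suc.IH[OF f'(2)[OF that] C(2)]])
  show ?case by (rule Ck_on_SucI[OF bounded_bilinear.FDERIV[OF assms f'(1) g'(1)] D])
qed

text \<open>Differentiability of the second factor is replaced by continuity, since its increment is multiplied
  by a factor of first order. This makes it possible to differentiate secant identities whose second
  factor is only known to be continuous.\<close>

lemma has_derivative_mult_vanishing:
  assumes "bounded_bilinear b"
    and f: "(f has_derivative f') (at x within S)" "f x = 0"
    and g: "continuous (at x within S) g"
  shows "((\<lambda>y. b (f y) (g y)) has_derivative (\<lambda>v. b (f' v) (g x))) (at x within S)"
proof -
  interpret bounded_bilinear b by fact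
  have bl: "bounded_linear f'" using f(1) by (rule has_derivative_bounded_linear)
  obtain K where K: "\<And>v. norm (f' v) \<le> norm v * K" "K > 0"
    using bounded_linear.pos_bounded[OF bl] by blast
  have "((\<lambda>y. b (f y) (g x)) has_derivative (\<lambda>v. b (f' v) (g x))) (at x within S)"
    by (rule bounded_linear.has_derivative[OF bounded_linear_left f(1)])
  moreover have "((\<lambda>y. b (f y) (g y - g x)) has_derivative (\<lambda>v. 0)) (at x within S)"
  proof -
    obtain B where B: "\<And>u v. norm (b u v) \<le> norm u * norm v * B" "B > 0"
      using pos_bounded by blast
    have lim: "((\<lambda>y. norm (f y - f' (y - x)) / norm (y - x)) \<longlongrightarrow> 0) (at x within S)"
      using f unfolding has_derivative_iff_norm by simp
    have limg: "((\<lambda>y. norm (g y - g x)) \<longlongrightarrow> 0) (at x within S)"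
      using g unfolding continuous_within by (simp add: tendsto_norm_zero_iff LIM_zero)
    have z: "((\<lambda>y. (norm (f y - f' (y - x)) / norm (y - x) + K) * norm (g y - g x) * B) \<longlongrightarrow>
        (0 + K) * 0 * B) (at x within S)"
      by (intro tendsto_intros lim limg)
    have "((\<lambda>y. norm (b (f y) (g y - g x)) / norm (y - x)) \<longlongrightarrow> 0) (at x within S)"
    proof (rule tendsto_sandwich[OF _ _ tendsto_const])
      show "\<forall>\<^sub>F y in at x within S. 0 \<le> norm (b (f y) (g y - g x)) / norm (y - x)" by simp
      show "\<forall>\<^sub>F y in at x within S. norm (b (f y) (g y - g x)) / norm (y - x) \<le>
          (norm (f y - f' (y - x)) / norm (y - x) + K) * norm (g y - g x) * B"
      proof (rule eventuallyI)
        fix y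
        show "norm (b (f y) (g y - g x)) / norm (y - x) \<le>
          (norm (f y - f' (y - x)) / norm (y - x) + K) * norm (g y - g x) * B"
        proof (cases "y = x")
          case False
          have "norm (f y) \<le> norm (f y - f' (y - x)) + norm (f' (y - x))"
            by (metis diff_add_cancel norm_triangle_ineq)
          also have "\<dots> \<le> norm (f y - f' (y - x)) + norm (y - x) * K" using K by simp
          also have "\<dots> = (norm (f y - f' (y - x)) / norm (y - x) + K) * norm (y - x)"
            using False by (simp add: field_simps)
          finally have "norm (f y) * norm (g y - g x) * B \<le> 
            (norm (f y - f' (y - x)) / norm (y - x) + K) * norm (y - x) * norm (g y - g x) * B"
            using B(2) by (intro mult_right_mono) auto
          with B(1)[of "f y" "g y - g x"] have "norm (b (f y) (g y - g x)) \<le>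
            (norm (f y - f' (y - x)) / norm (y - x) + K) * norm (g y - g x) * B * norm (y - x)"
            by (simp add: mult_ac)
          then show ?thesis using False by (simp add: pos_divide_le_eq)
        qed (use B K in simp)
      qed
      show "((\<lambda>y. (norm (f y - f' (y - x)) / norm (y - x) + K) * norm (g y - g x) * B) \<longlongrightarrow> 0)
         (at x within S)" using z by simp
    qed
    then show ?thesis unfolding has_derivative_iff_norm using f(2) by (simp add: zero_left)
  qed
  ultimately have "((\<lambda>y. b (f y) (g x) + b (f y) (g y - g x)) has_derivative
      (\<lambda>v. b (f' v) (g x) + 0)) (at x within S)"
    by (rule has_derivative_add)
  then show ?thesis by (simp add: diff_right)
qed

text \<open>The resolvent identity \<open>J y = J x - J x \<circ> (A y - A x) \<circ> J y\<close> is differentiated with the product rule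
  above.\<close>

lemma has_derivative_inverse_operator:
  fixes A J :: "'s::real_normed_vector \<Rightarrow> 'v::real_normed_vector \<Rightarrow>\<^sub>L 'v"
  assumes "(A has_derivative A') (at x within S)" "x \<in> S"
    and "\<And>y. y \<in> S \<Longrightarrow> J y o\<^sub>L A y = id_blinfun" "\<And>y. y \<in> S \<Longrightarrow> A y o\<^sub>L J y = id_blinfun"
    and "continuous (at x within S) J"
  shows "(J has_derivative (\<lambda>v. - (J x o\<^sub>L (A' v o\<^sub>L J x)))) (at x within S)"
proof -
  have "((\<lambda>y. A y - A x) has_derivative A') (at x within S)"
    using assms(1) by (auto intro!: derivative_eq_intros)
  from has_derivative_mult_vanishing[OF bounded_bilinear_blinfun_compose this _ assms(5)]
  have "((\<lambda>y. (A y - A x) o\<^sub>L J y) has_derivative (\<lambda>v. A' v o\<^sub>L J x)) (at x within S)" by simp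
  from bounded_linear.has_derivative[OF bounded_bilinear.bounded_linear_right[OF
      bounded_bilinear_blinfun_compose, of "J x"] this]
  have *: "((\<lambda>y. J x - (J x o\<^sub>L ((A y - A x) o\<^sub>L J y))) has_derivative
      (\<lambda>v. 0 - (J x o\<^sub>L (A' v o\<^sub>L J x)))) (at x within S)"
    by (intro has_derivative_diff has_derivative_const)
  have "J x - (J x o\<^sub>L ((A y - A x) o\<^sub>L J y)) = J y" if "y \<in> S" for y
  proof (rule blinfun_eqI)
    fix v
    have "A y (J y v) = v" using assms(4)[OF that] by (metis blinfun_apply_blinfun_compose blinfun_apply_id_blinfun id_apply)
    moreover have "J x (A x u) = u" for u
      using assms(3)[OF assms(2)] by (metis blinfun_apply_blinfun_compose blinfun_apply_id_blinfun id_apply)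
    ultimately show "(J x - (J x o\<^sub>L ((A y - A x) o\<^sub>L J y))) v = J y v"
      by (simp add: blinfun.bilinear_simps)
  qed
  from has_derivative_transform[OF assms(2) _ *, of J] this show ?thesis by simp
qed

text \<open>The derivative \<open>- J A' J\<close> of the inverse only involves \<open>J\<close> at the lower order, so induction applies.\<close>

lemma Ck_on_inverse_operator:
  fixes A J :: "'s::real_normed_vector \<Rightarrow> 'v::real_normed_vector \<Rightarrow>\<^sub>L 'v"
  assumes "\<And>y. y \<in> S \<Longrightarrow> J y o\<^sub>L A y = id_blinfun" "\<And>y. y \<in> S \<Longrightarrow> A y o\<^sub>L J y = id_blinfun"
    and cont: "continuous_on S J"
  shows "Ck_on n E S A \<Longrightarrow> Ck_on n E S J"
proof (induction n)
  case 0
  then show ?case using cont by simp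
next
  case (Suc n)
  then obtain A' where A': "\<And>x. x \<in> S \<Longrightarrow> (A has_derivative A' x) (at x within S)"
    "\<And>v. v \<in> E \<Longrightarrow> Ck_on n E S (\<lambda>x. A' x v)" using Ck_on_SucE by metis
  have J: "Ck_on n E S J" using Suc Ck_on_Suc_imp_Ck_on by blast
  have "(J has_derivative (\<lambda>v. - (J x o\<^sub>L (A' x v o\<^sub>L J x)))) (at x within S)" if "x \<in> S" for x
    using that cont
    by (intro has_derivative_inverse_operator[OF A'(1) _ assms(1,2)])
       (auto simp: continuous_on_eq_continuous_within)
  moreover have "Ck_on n E S (\<lambda>x. - (J x o\<^sub>L (A' x v o\<^sub>L J x)))" if "v \<in> E" for v
    using Ck_on_bounded_linear_compose[OF bounded_linear_minus[OF bounded_linear_ident]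
      Ck_on_bounded_bilinear[OF bounded_bilinear_blinfun_compose J
        Ck_on_bounded_bilinear[OF bounded_bilinear_blinfun_compose A'(2)[OF that] J]]] .
  ultimately show ?case by (rule Ck_on_SucI)
qed

lemma Ck_on_sin_cos:
  fixes M :: real
  shows "Ck_on n E S (\<lambda>t. sin (M * t)) \<and> Ck_on n E S (\<lambda>t. cos (M * t))"
proof (induction n)
  case 0
  show ?case by (auto intro!: continuous_intros)
next
  case (Suc n)
  have "Ck_on n E S (\<lambda>t. (v * M) * cos (M * t))" for v
    by (rule Ck_on_bounded_linear_compose[OF bounded_linear_mult_right conjunct2[OF Suc]])
  moreover have "((\<lambda>t. sin (M * t)) has_derivative (\<lambda>v. (v * M) * cos (M * x))) (at x within S)" for x
    by (auto intro!: derivative_eq_intros)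
  ultimately have 1: "Ck_on (Suc n) E S (\<lambda>t. sin (M * t))"
    by (intro Ck_on_SucI[where f' = "\<lambda>x v. (v * M) * cos (M * x)"])
  have "Ck_on n E S (\<lambda>t. (- (v * M)) * sin (M * t))" for v
    by (rule Ck_on_bounded_linear_compose[OF bounded_linear_mult_right conjunct1[OF Suc]])
  moreover have "((\<lambda>t. cos (M * t)) has_derivative (\<lambda>v. (- (v * M)) * sin (M * x))) (at x within S)" for x
    by (auto intro!: derivative_eq_intros)
  ultimately have "Ck_on (Suc n) E S (\<lambda>t. cos (M * t))"
    by (intro Ck_on_SucI[where f' = "\<lambda>x v. (- (v * M)) * sin (M * x)"])
  with 1 show ?case ..
qed

section \<open>Inverting a quadratic perturbation of the identity\<close>

text \<open>\<open>T \<mapsto> y - N T\<close> is a contraction of the ball of radius \<open>2 * norm (y - N 0)\<close> into itself.\<close>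

lemma perturbed_identity_solvable:
  fixes N :: "'v::real_normed_vector \<Rightarrow> 'v" and y :: 'v
  assumes "complete (UNIV :: 'v set)"
    and lip: "\<And>S T :: 'v. norm S \<le> r \<Longrightarrow> norm T \<le> r \<Longrightarrow> norm (N S - N T) \<le> 1 / 2 * norm (S - T)"
    and y: "2 * norm (y - N 0) \<le> r"
  shows "\<exists>T::'v. norm T \<le> 2 * norm (y - N 0) \<and> T + N T = y"
proof -
  define \<rho> where "\<rho> = 2 * norm (y - N 0)"
  have \<rho>: "0 \<le> \<rho>" "\<rho> \<le> r" using y by (auto simp: \<rho>_def)
  have "\<exists>!T\<in>cball 0 \<rho>. y - N T = T"
  proof (rule Banach_fix)
    show "complete (cball 0 \<rho> :: 'v set)"
      by (rule complete_closed_subset[OF closed_cball subset_UNIV assms(1)])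
    show "(\<lambda>T. y - N T) ` cball 0 \<rho> \<subseteq> cball 0 \<rho>"
    proof clarsimp
      fix T :: 'v assume T: "norm T \<le> \<rho>"
      have "norm (y - N T) \<le> norm (y - N 0) + norm (N 0 - N T)"
        using norm_triangle_ineq[of "y - N 0" "N 0 - N T"] by simp
      also have "norm (N 0 - N T) \<le> 1 / 2 * norm T"
        using lip[of 0 T] T \<rho> by simp
      finally show "norm (y - N T) \<le> \<rho>" using T by (simp add: \<rho>_def)
    qed
    fix S T :: 'v assume "S \<in> cball 0 \<rho>" "T \<in> cball 0 \<rho>"
    then show "dist (y - N S) (y - N T) \<le> 1 / 2 * dist S T"
      using lip[of T S] \<rho> by (simp add: dist_norm norm_minus_commute)
  qed (use \<rho> in auto)
  then obtain T where "norm T \<le> \<rho>" "y - N T = T" by auto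
  then show ?thesis unfolding \<rho>_def by (metis diff_add_cancel)
qed

text \<open>The choice of inverses is Lipschitz by the resolvent identity, since all of them have norm at most
  \<open>2\<close>.\<close>

lemma inverse_near_identity:
  assumes "complete (UNIV :: 'v::real_normed_vector set)"
  obtains inv :: "('v::real_normed_vector \<Rightarrow>\<^sub>L 'v) \<Rightarrow> 'v \<Rightarrow>\<^sub>L 'v" where
    "\<And>K. norm K \<le> 1 / 2 \<Longrightarrow> inv K o\<^sub>L (id_blinfun + K) = id_blinfun"
    "\<And>K. norm K \<le> 1 / 2 \<Longrightarrow> (id_blinfun + K) o\<^sub>L inv K = id_blinfun"
    "continuous_on {K. norm K \<le> 1 / 2} inv"
proof -
  have ex: "\<exists>J. (J o\<^sub>L (id_blinfun + K) = id_blinfun \<and> (id_blinfun + K) o\<^sub>L J = id_blinfun) \<and> norm J \<le> 2"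
    if K: "norm K \<le> 1 / 2" for K :: "'v \<Rightarrow>\<^sub>L 'v"
  proof -
    have Kle: "norm (K u) \<le> 1 / 2 * norm u" for u
      using norm_blinfun[of K u] mult_right_mono[OF K norm_ge_zero[of u]] by simp
    have "\<exists>T. norm T \<le> 2 * norm y \<and> T + K T = y" for y
    proof -
      have "norm (K S - K T) \<le> 1 / 2 * norm (S - T)" for S T
        using Kle[of "S - T"] by (simp add: blinfun.diff_right)
      then show ?thesis
        using perturbed_identity_solvable[OF assms, where N = "blinfun_apply K" and y = y and r = "2 * norm y"]
        by simp
    qed
    then obtain j where j: "\<And>y. norm (j y) \<le> 2 * norm y" "\<And>y. j y + K (j y) = y" by metis
    have uniq: "S = T" if "S + K S = T + K T" for S T
    proof -
      have "S - T = K (T - S)" using that by (simp add: blinfun.diff_right algebra_simps)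
      then have "norm (S - T) \<le> 1 / 2 * norm (S - T)" using Kle[of "T - S"] by (simp add: norm_minus_commute)
      then show ?thesis by simp
    qed
    have bl: "bounded_linear j"
    proof (rule bounded_linear_intro[of j 2])
      show "j (x + y) = j x + j y" for x y
      proof (rule uniq)
        have "j x + j y + K (j x + j y) = (j x + K (j x)) + (j y + K (j y))"
          by (simp only: blinfun.add_right add_ac)
        then show "j (x + y) + K (j (x + y)) = j x + j y + K (j x + j y)" by (simp only: j(2))
      qed
      show "j (r *\<^sub>R x) = r *\<^sub>R j x" for r x
        by (rule uniq) (simp add: j(2) blinfun.scaleR_right flip: scaleR_add_right)
    qed (use j(1) in \<open>simp add: mult.commute\<close>)
    have ap: "blinfun_apply (Blinfun j) = j" using bl by (rule bounded_linear_Blinfun_apply)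
    have "j (x + K x) = x" for x by (rule uniq) (simp add: j(2))
    then show ?thesis using j
      by (intro exI[of _ "Blinfun j"]) (auto intro!: blinfun_eqI norm_blinfun_bound simp: ap blinfun.add_left)
  qed
  define inv where "inv K = (SOME J. (J o\<^sub>L (id_blinfun + K) = id_blinfun \<and>
    (id_blinfun + K) o\<^sub>L J = id_blinfun) \<and> norm J \<le> 2)" for K :: "'v \<Rightarrow>\<^sub>L 'v"
  have inv: "inv K o\<^sub>L (id_blinfun + K) = id_blinfun" "(id_blinfun + K) o\<^sub>L inv K = id_blinfun"
    "norm (inv K) \<le> 2" if "norm K \<le> 1/2" for K
    using someI_ex[OF ex[OF that]] unfolding inv_def by blast+
  have "norm (inv K - inv L) \<le> 4 * norm (K - L)" if "norm K \<le> 1/2" "norm L \<le> 1/2" for K L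
  proof (rule norm_blinfun_bound)
    fix x
    have "inv K (inv L x + L (inv L x)) = inv K x"
      using arg_cong[OF inv(2)[OF that(2)], of "\<lambda>A. blinfun_apply A x"] by (simp add: blinfun.add_left)
    moreover have "inv K (inv L x + K (inv L x)) = inv L x"
      using arg_cong[OF inv(1)[OF that(1)], of "\<lambda>A. blinfun_apply A (inv L x)"] by (simp add: blinfun.add_left)
    ultimately have "(inv K - inv L) x = - inv K ((K - L) (inv L x))"
      by (simp add: blinfun.bilinear_simps) (metis add_diff_cancel_left)
    then have "norm ((inv K - inv L) x) = norm (inv K ((K - L) (inv L x)))" by simp
    also have "\<dots> \<le> norm (inv K) * (norm (K - L) * (norm (inv L) * norm x))"
      by (intro order_trans[OF norm_blinfun] mult_left_mono norm_blinfun) auto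
    also have "\<dots> \<le> 2 * (norm (K - L) * (2 * norm x))"
      using inv(3)[OF that(1)] inv(3)[OF that(2)] by (intro mult_mono) auto
    finally show "norm ((inv K - inv L) x) \<le> 4 * norm (K - L) * norm x" by simp
  qed simp
  then have "continuous_on {K. norm K \<le> 1/2} inv"
    by (intro lipschitz_on_continuous_on[of 4] lipschitz_onI) (auto simp: dist_norm)
  then show ?thesis using that inv by blast
qed

context
  fixes B :: "'v::real_normed_vector \<Rightarrow>\<^sub>L 'v \<Rightarrow>\<^sub>L 'v" and r :: real
  assumes complete: "complete (UNIV :: 'v set)"
    and sym: "\<And>S T. B S T = B T S"
    and small: "norm B * r \<le> 1 / 2"
begin

text \<open>Secants of the quadratic map are again given by \<open>B\<close>; symmetry of \<open>B\<close> is essential here.\<close>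

lemma quadratic_difference:
  "(1 / 2) *\<^sub>R B S S - (1 / 2) *\<^sub>R B T T = ((1 / 2) *\<^sub>R B (S + T)) (S - T)"
proof -
  have "B (S + T) (S - T) = B S S - B T T"
    using sym[of S T] by (simp add: blinfun.bilinear_simps)
  then show ?thesis by (simp add: blinfun.scaleR_left scaleR_diff_right)
qed

lemma norm_quadratic_secant:
  assumes "norm S \<le> r" "norm T \<le> r"
  shows "norm ((1 / 2) *\<^sub>R B (S + T)) \<le> 1 / 2"
proof -
  have "norm (B (S + T)) \<le> norm B * (2 * r)"
    using norm_triangle_ineq[of S T] assms
    by (intro order_trans[OF norm_blinfun] mult_left_mono) auto
  then show ?thesis using small by simp
qed

lemma quadratic_lipschitz:
  assumes "norm S \<le> r" "norm T \<le> r"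
  shows "norm ((1 / 2) *\<^sub>R B S S - (1 / 2) *\<^sub>R B T T) \<le> 1 / 2 * norm (S - T)"
  unfolding quadratic_difference
  by (intro order_trans[OF norm_blinfun] mult_right_mono norm_quadratic_secant assms) auto

lemma quadratic_expansive:
  assumes "norm S \<le> r" "norm T \<le> r"
  shows "norm (S - T) \<le> 2 * norm ((S + (1 / 2) *\<^sub>R B S S) - (T + (1 / 2) *\<^sub>R B T T))"
  using quadratic_lipschitz[OF assms]
    norm_triangle_ineq4[of "(S + (1 / 2) *\<^sub>R B S S) - (T + (1 / 2) *\<^sub>R B T T)" 
      "(1 / 2) *\<^sub>R B S S - (1 / 2) *\<^sub>R B T T"]
  by (simp add: algebra_simps)

lemma quadratic_solvable:
  assumes "norm y < r / 2"
  shows "\<exists>T. norm T < r \<and> T + (1 / 2) *\<^sub>R B T T = y"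
  using perturbed_identity_solvable[OF complete, of r "\<lambda>T. (1 / 2) *\<^sub>R B T T" y]
    quadratic_lipschitz assms by force

text \<open>Smoothness of the inverse of \<open>T \<mapsto> T + B T T / 2\<close>, composed with an arbitrary \<open>\<beta>\<close>: taking for \<open>\<beta>\<close> the
  identity gives the inverse chart, taking a curve gives its preimage, and no general chain rule is
  needed. By the secant identity \<open>\<beta> y - \<beta> x = (1 + B (\<gamma> x + \<gamma> y) / 2) (\<gamma> y - \<gamma> x)\<close> the derivative of \<open>\<gamma>\<close>
  is \<open>(1 + B (\<gamma> x))\<inverse> \<circ> \<beta>'\<close>, which is as smooth as \<open>\<gamma>\<close> and \<open>\<beta>'\<close>.\<close>

lemma Ck_on_quadratic_solution:
  fixes \<beta> \<gamma> :: "'s::real_normed_vector \<Rightarrow> 'v"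
  assumes \<gamma>: "\<And>x. x \<in> S \<Longrightarrow> norm (\<gamma> x) \<le> r" "\<And>x. x \<in> S \<Longrightarrow> \<gamma> x + (1 / 2) *\<^sub>R B (\<gamma> x) (\<gamma> x) = \<beta> x"
  shows "Ck_on n E S \<beta> \<Longrightarrow> Ck_on n E S \<gamma>"
proof (induction n)
  case 0
  show ?case unfolding Ck_on.simps
  proof (subst continuous_on_iff, intro ballI allI impI)
    fix x e assume "x \<in> S" "0 < (e::real)"
    then obtain d where d: "d > 0" "\<And>y. y \<in> S \<Longrightarrow> dist y x < d \<Longrightarrow> dist (\<beta> y) (\<beta> x) < e / 2"
      using 0 unfolding Ck_on.simps continuous_on_iff by (meson half_gt_zero)
    have "dist (\<gamma> y) (\<gamma> x) < e" if "y \<in> S" "dist y x < d" for y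
      using quadratic_expansive[OF \<gamma>(1) \<gamma>(1), of y x] \<gamma>(2) d(2)[OF that] that \<open>x \<in> S\<close>
      by (simp add: dist_norm)
    then show "\<exists>d>0. \<forall>y\<in>S. dist y x < d \<longrightarrow> dist (\<gamma> y) (\<gamma> x) < e" using d(1) by blast
  qed
next
  case (Suc n)
  have Cn: "Ck_on n E S \<beta>" "Ck_on n E S \<gamma>" using Suc Ck_on_Suc_imp_Ck_on by blast+
  then have cont: "continuous_on S \<gamma>" using Ck_on_mono_le[of n E S \<gamma> 0] by simp
  obtain inv :: "('v \<Rightarrow>\<^sub>L 'v) \<Rightarrow> 'v \<Rightarrow>\<^sub>L 'v" where inv:
    "\<And>K. norm K \<le> 1 / 2 \<Longrightarrow> inv K o\<^sub>L (id_blinfun + K) = id_blinfun"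
    "\<And>K. norm K \<le> 1 / 2 \<Longrightarrow> (id_blinfun + K) o\<^sub>L inv K = id_blinfun"
    "continuous_on {K. norm K \<le> 1 / 2} inv"
    using inverse_near_identity[OF complete] by blast
  define J where "J x y = inv ((1 / 2) *\<^sub>R B (\<gamma> x + \<gamma> y))" for x y
  obtain \<beta>' where \<beta>': "\<And>x. x \<in> S \<Longrightarrow> (\<beta> has_derivative \<beta>' x) (at x within S)"
    "\<And>v. v \<in> E \<Longrightarrow> Ck_on n E S (\<lambda>x. \<beta>' x v)" using Suc.prems Ck_on_SucE by metis
  have der: "(\<gamma> has_derivative (\<lambda>v. J x x (\<beta>' x v))) (at x within S)" if x: "x \<in> S" for x
  proof -
    have "continuous_on S (J x)"
    proof -
      have "continuous_on S (\<lambda>y. (1 / 2) *\<^sub>R B (\<gamma> x + \<gamma> y))" by (intro continuous_intros cont)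
      then show ?thesis unfolding J_def
        by (rule continuous_on_compose2[OF inv(3)]) (use norm_quadratic_secant[OF \<gamma>(1)[OF x] \<gamma>(1)] in auto)
    qed
    then have J: "continuous (at x within S) (J x)"
      using x by (simp add: continuous_on_eq_continuous_within)
    have "((\<lambda>y. \<beta> y - \<beta> x) has_derivative \<beta>' x) (at x within S)"
      using \<beta>'(1)[OF x] by (auto intro!: derivative_eq_intros)
    then have d: "((\<lambda>y. J x y (\<beta> y - \<beta> x)) has_derivative (\<lambda>v. J x x (\<beta>' x v))) (at x within S)"
      using J by (intro has_derivative_mult_vanishing[where b = "\<lambda>u j. blinfun_apply j u"
        and f = "\<lambda>y. \<beta> y - \<beta> x" and g = "J x"] bounded_bilinear.flip[OF bounded_bilinear_blinfun_apply]) simp_all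
    have "((\<lambda>y. \<gamma> x + J x y (\<beta> y - \<beta> x)) has_derivative (\<lambda>v. 0 + J x x (\<beta>' x v))) (at x within S)"
      by (rule has_derivative_add[OF has_derivative_const d])
    then have "((\<lambda>y. \<gamma> x + J x y (\<beta> y - \<beta> x)) has_derivative (\<lambda>v. J x x (\<beta>' x v))) (at x within S)"
      by simp
    moreover have "\<gamma> x + J x y (\<beta> y - \<beta> x) = \<gamma> y" if y: "y \<in> S" for y
    proof -
      have "\<beta> y - \<beta> x = (id_blinfun + (1 / 2) *\<^sub>R B (\<gamma> x + \<gamma> y)) (\<gamma> y - \<gamma> x)"
      proof -
        have "(id_blinfun + (1 / 2) *\<^sub>R B (\<gamma> x + \<gamma> y)) (\<gamma> y - \<gamma> x) =
            (\<gamma> y - \<gamma> x) + ((1 / 2) *\<^sub>R B (\<gamma> y + \<gamma> x)) (\<gamma> y - \<gamma> x)"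
          by (simp add: blinfun.add_left add.commute[of "\<gamma> x" "\<gamma> y"])
        also have "\<dots> = \<beta> y - \<beta> x"
          unfolding quadratic_difference[symmetric] \<gamma>(2)[OF x, symmetric] \<gamma>(2)[OF y, symmetric]
          by simp
        finally show ?thesis by simp
      qed
      then have "J x y (\<beta> y - \<beta> x) = \<gamma> y - \<gamma> x"
        using arg_cong[OF inv(1)[OF norm_quadratic_secant[OF \<gamma>(1)[OF x] \<gamma>(1)[OF y]]], of "\<lambda>A. blinfun_apply A (\<gamma> y - \<gamma> x)"]
        by (simp add: J_def)
      then show ?thesis by simp
    qed
    ultimately show ?thesis
      by (intro has_derivative_transform[OF x, of \<gamma> "\<lambda>y. \<gamma> x + J x y (\<beta> y - \<beta> x)"]) simp_all
  qed
  have JJ: "Ck_on n E S (\<lambda>x. J x x)"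
  proof (rule Ck_on_inverse_operator)
    show "Ck_on n E S (\<lambda>x. id_blinfun + (1 / 2) *\<^sub>R B (\<gamma> x + \<gamma> x))"
        by (rule Ck_on_add[OF Ck_on_const Ck_on_bounded_linear_compose[OF bounded_linear_compose[OF
         bounded_linear_scaleR_right blinfun.bounded_linear_right] Ck_on_add[OF Cn(2) Cn(2)]]])
    have "continuous_on S (\<lambda>y. (1 / 2) *\<^sub>R B (\<gamma> y + \<gamma> y))" by (intro continuous_intros cont)
    then show "continuous_on S (\<lambda>x. J x x)" unfolding J_def
      by (rule continuous_on_compose2[OF inv(3)]) (use norm_quadratic_secant[OF \<gamma>(1) \<gamma>(1)] in auto)
  qed (use inv norm_quadratic_secant \<gamma>(1) in \<open>auto simp: J_def\<close>)
  show ?case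
    by (rule Ck_on_SucI[OF der Ck_on_bounded_bilinear[OF bounded_bilinear_blinfun_apply JJ \<beta>'(2)]])
qed

end

section \<open>Graph charts of the Grassmannian\<close>

lemma complement_exists:
  assumes "subspace W" shows "\<exists>C. complement W C"
proof -
  obtain g :: "'a \<Rightarrow> 'a" where g: "range g \<subseteq> W" "linear g" "\<And>v. v \<in> W \<Longrightarrow> g v = v"
    using linear_exists_left_inverse_on[OF linear_ident assms] by auto
  have "subspace {x. g x = 0}" by (rule linear_subspace_kernel[OF g(2)])
  moreover have "W \<inter> {x. g x = 0} = {0}"
    using g(3) assms by (auto simp: subspace_0 linear_0[OF g(2)])
  moreover have "\<exists>w\<in>W. \<exists>c\<in>{x. g x = 0}. x = w + c" for x
  proof -
    have "g x \<in> W" "g (g x) = g x" using g(1,3) by auto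
    then show ?thesis
      by (intro bexI[where x = "g x"] bexI[where x = "x - g x"]) (auto simp: linear_diff[OF g(2)])
  qed
  ultimately show ?thesis using assms unfolding complement_def by blast
qed

locale complement_pair =
  fixes W C :: "'a::real_normed_vector set" and p :: "'a \<Rightarrow>\<^sub>L 'a"
  assumes finite_dim: "finite_dim TYPE('a)"
    and complement: "complement W C"
    and p_in: "\<And>x. p x \<in> W"
    and p_on: "\<And>w. w \<in> W \<Longrightarrow> p w = w"
    and p_compl: "\<And>c. c \<in> C \<Longrightarrow> p c = 0"
    and diff_p_in: "\<And>x. x - p x \<in> C"

text \<open>Uniqueness of the decomposition along the complement makes the projection linear.\<close>

lemma complement_pair_exists:
  fixes W C :: "'a::real_normed_vector set"
  assumes fd: "finite_dim TYPE('a)" and c: "complement W C"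
  shows "\<exists>p. complement_pair W C p"
proof -
  have W: "subspace W" and C: "subspace C" and WC: "W \<inter> C = {0}"
    using c by (auto simp: complement_def)
  have "\<forall>x. \<exists>w. w \<in> W \<and> x - w \<in> C"
    using c unfolding complement_def by (metis add_diff_cancel_left')
  then obtain f where f: "\<And>x. f x \<in> W" "\<And>x. x - f x \<in> C" by metis
  have uniq: "f x = w" if "w \<in> W" "x - w \<in> C" for x w
  proof -
    have "f x - w \<in> W" using f that W by (simp add: subspace_diff)
    moreover have "(x - w) - (x - f x) \<in> C" by (rule subspace_diff[OF C that(2) f(2)])
    ultimately have "f x - w \<in> W \<inter> C" by simp
    then show ?thesis using WC by simp
  qed
  have "linear f"
  proof (rule linearI)
    fix x y show "f (x + y) = f x + f y"
      using subspace_add[OF W f(1) f(1)] subspace_add[OF C f(2) f(2)]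
      by (intro uniq) (simp_all add: algebra_simps)
  next
    fix r x show "f (r *\<^sub>R x) = r *\<^sub>R f x"
      using subspace_scale[OF W f(1)] subspace_scale[OF C f(2)]
      by (intro uniq) (simp_all add: scaleR_diff_right[symmetric])
  qed
  then have "blinfun_apply (Blinfun f) = f" by (rule apply_Blinfun_linear[OF fd])
  moreover have "f w = w" if "w \<in> W" for w using that C by (intro uniq) (simp_all add: subspace_0)
  moreover have "f c = 0" if "c \<in> C" for c using that W by (intro uniq) (simp_all add: subspace_0)
  ultimately show ?thesis using f fd c
    by (intro exI[of _ "Blinfun f"]) (simp add: complement_pair_def)
qed

context complement_pair
begin

abbreviation Hom where "Hom \<equiv> hom_compl W C"

lemma subspaces: "subspace W" "subspace C"
  using complement by (auto simp: complement_def)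

lemma p_p [simp]: "p (p x) = p x" using p_in p_on by blast

lemma W_iff: "x \<in> W \<longleftrightarrow> p x = x" using p_in p_on by metis

lemma C_iff: "x \<in> C \<longleftrightarrow> p x = 0" using p_compl diff_p_in by (metis diff_zero)

text \<open>The description of \<open>Hom(W, C)\<close> by equations in \<open>p\<close> lets the simplifier handle membership.\<close>

lemma hom_compl_iff: "T \<in> Hom \<longleftrightarrow> (\<forall>x. p (T x) = 0) \<and> (\<forall>x. T (p x) = T x)"
proof
  assume T: "T \<in> Hom"
  have *: "T (p x) = T x" for x
    using T diff_p_in[of x] by (auto simp: hom_compl_def blinfun.diff_right)
  moreover have "T (p x) \<in> C" for x using T p_in by (simp add: hom_compl_def)
  ultimately show "(\<forall>x. p (T x) = 0) \<and> (\<forall>x. T (p x) = T x)" by (simp add: C_iff)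
next
  assume "(\<forall>x. p (T x) = 0) \<and> (\<forall>x. T (p x) = T x)"
  then show "T \<in> Hom"
    by (auto simp: hom_compl_def C_iff) (metis blinfun.zero_right)
qed

lemma Hom_p [simp]: "T \<in> Hom \<Longrightarrow> p (T x) = 0" "T \<in> Hom \<Longrightarrow> T (p x) = T x"
  by (auto simp: hom_compl_iff)

lemma Hom_Hom [simp]:
  assumes "S \<in> Hom" "T \<in> Hom" shows "S (T x) = 0"
  using Hom_p(2)[OF assms(1), of "T x"] by (simp only: Hom_p(1)[OF assms(2)] blinfun.zero_right)

lemma subspace_Hom: "subspace Hom"
  unfolding subspace_def hom_compl_iff by (simp add: blinfun.bilinear_simps)

lemma mem_graph_iff:
  assumes "T \<in> Hom" shows "v \<in> graph_on W T \<longleftrightarrow> v - p v = T v"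
proof
  assume "v \<in> graph_on W T"
  then show "v - p v = T v" using assms by (auto simp: graph_on_def blinfun.add_right p_on)
next
  assume "v - p v = T v"
  then have "v = p v + T (p v)" using assms by (simp add: algebra_simps)
  then show "v \<in> graph_on W T" unfolding graph_on_def using p_in by blast
qed

lemma graph_inj:
  assumes "S \<in> Hom" "T \<in> Hom" "graph_on W S = graph_on W T" shows "S = T"
proof (rule blinfun_eqI)
  fix x
  have "p x + T x \<in> graph_on W S"
    using assms by (simp add: mem_graph_iff blinfun.add_right)
  then have "p x + T x - p (p x + T x) = S (p x + T x)" using assms(1) mem_graph_iff by blast
  then show "S x = T x" using assms by (simp add: blinfun.add_right)
qed

lemma graph_zero: "graph_on W 0 = W" by (simp add: graph_on_def)

lemma graph_in_grassmannian:
  assumes "T \<in> Hom" shows "graph_on W T \<in> grassmannian (dim W)"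
proof -
  have lin: "linear (\<lambda>w. w + T w)"
    by (intro linear_compose_add linear_ident linear_blinfun_apply)
  have "inj_on (\<lambda>w. w + T w) W"
  proof (rule inj_onI)
    fix v w assume "v \<in> W" "w \<in> W" "v + T v = w + T w"
    then have "p (v + T v) = p (w + T w)" by simp
    then show "v = w" using assms \<open>v \<in> W\<close> \<open>w \<in> W\<close> by (simp add: blinfun.add_right p_on)
  qed
  then show ?thesis unfolding grassmannian_def graph_on_def
    using lin subspaces by (auto simp: dim_image_linear_inj_on linear_subspace_image)
qed

text \<open>A transition map between graph charts is locally Lipschitz. If \<open>graph T0 = graph S0\<close>, the projection
  \<open>w \<mapsto> p (w + T w)\<close> from \<open>W'\<close> to \<open>W\<close> is bounded below for \<open>T = T0\<close>, hence also for \<open>T\<close> near \<open>T0\<close>; so it is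
  bijective and the graph of \<open>T\<close> is also the graph of some \<open>S\<close> over \<open>W\<close>. The estimate comes from
  \<open>S u - S0 u = (q - S0) ((T - T0) w)\<close> with \<open>u = p (w + T w)\<close>.\<close>

lemma graph_chart_transition:
  assumes W': "complement_pair W' C' p'" "dim W' = dim W"
    and T0: "T0 \<in> hom_compl W' C'" and S0: "S0 \<in> Hom" "graph_on W' T0 = graph_on W S0"
  obtains e K where "e > 0" "\<And>T. T \<in> hom_compl W' C' \<Longrightarrow> norm (T - T0) < e \<Longrightarrow>
    \<exists>S\<in>Hom. graph_on W S = graph_on W' T \<and> norm (S - S0) \<le> K * norm (T - T0)"
proof -
  interpret other: complement_pair W' C' p' by fact
  define c where "c = norm p' * (1 + norm S0) + 1"
  have c: "c > 0" by (auto simp: c_def intro!: add_nonneg_pos mult_nonneg_nonneg)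
  have low0: "norm w \<le> c * norm (p (w + T0 w))" if "w \<in> W'" for w
  proof -
    define v where "v = w + T0 w"
    have "v \<in> graph_on W S0" using that S0(2) by (auto simp: graph_on_def v_def)
    then have "v - p v = S0 (p v)" using S0(1) by (simp add: mem_graph_iff)
    then have v: "v = p v + S0 (p v)" by (simp add: diff_eq_eq add.commute)
    have "w = p' v" using that T0 by (simp add: v_def blinfun.add_right other.p_on)
    then have "norm w \<le> norm p' * norm v" using norm_blinfun[of p' v] by simp
    also have "norm v \<le> norm (p v) + norm S0 * norm (p v)"
      using norm_triangle_ineq[of "p v" "S0 (p v)"] norm_blinfun[of S0 "p v"] v by simp
    then have "norm p' * norm v \<le> norm p' * (norm (p v) + norm S0 * norm (p v))"
      by (rule mult_left_mono) simp
    also have "\<dots> \<le> c * norm (p v)" by (simp add: c_def algebra_simps)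
    finally show ?thesis by (simp add: v_def)
  qed
  \<comment> \<open>half of the lower bound survives: perturbing \<open>T0\<close> by \<open>e\<close> changes \<open>p (w + T w)\<close> by at most \<open>norm w / (2 * c)\<close>\<close>
  define e where "e = 1 / (2 * c * (norm p + 1))"
  have e: "e > 0" using c by (auto simp: e_def intro!: mult_pos_pos add_nonneg_pos)
  have ce: "c * (norm p * e) \<le> 1 / 2"
  proof -
    have "c * (norm p * e) = 1 / 2 * (norm p / (norm p + 1))"
      using c by (simp add: e_def)
    also have "\<dots> \<le> 1 / 2 * 1" by (intro mult_left_mono) (auto simp: divide_le_eq_1 add_nonneg_pos)
    finally show ?thesis by simp
  qed
  define K where "K = (1 + norm p + norm S0 * norm p) * (2 * c * norm p)"
  have "\<exists>S\<in>Hom. graph_on W S = graph_on W' T \<and> norm (S - S0) \<le> K * norm (T - T0)"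
    if T: "T \<in> hom_compl W' C'" "norm (T - T0) < e" for T
  proof -
    define f where "f w = p (w + T w)" for w
    have low: "norm w \<le> 2 * c * norm (f w)" if "w \<in> W'" for w
    proof -
      have "p (w + T0 w) = f w - p ((T - T0) w)" by (simp add: f_def blinfun.bilinear_simps)
      then have "norm (p (w + T0 w)) \<le> norm (f w) + norm (p ((T - T0) w))"
        by (metis norm_triangle_ineq4)
      also have "norm (p ((T - T0) w)) \<le> norm p * (e * norm w)"
        using T(2) by (intro order_trans[OF norm_blinfun] mult_left_mono mult_right_mono) auto
      finally have b: "norm (p (w + T0 w)) \<le> norm (f w) + norm p * (e * norm w)" by simp
      have "norm w \<le> c * (norm (f w) + norm p * (e * norm w))"
        using low0[OF that] mult_left_mono[OF b less_imp_le[OF c]] by (rule order_trans)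
      also have "\<dots> = c * norm (f w) + c * (norm p * e) * norm w" by (simp add: algebra_simps)
      also have "\<dots> \<le> c * norm (f w) + 1 / 2 * norm w" using ce by (intro add_left_mono mult_right_mono) auto
      finally show ?thesis by simp
    qed
    have lin: "linear f" unfolding f_def
      by (intro linearI) (simp_all add: blinfun.bilinear_simps scaleR_add_right)
    have inj: "inj_on f W'"
    proof (rule inj_onI)
      fix v w assume vw: "v \<in> W'" "w \<in> W'" "f v = f w"
      then have "v - w \<in> W'" using other.subspaces by (simp add: subspace_diff)
      from low[OF this] vw(3) show "v = w" by (simp add: linear_diff[OF lin])
    qed
    have "f ` W' \<subseteq> W" by (auto simp: f_def p_in)
    from inj_linear_onto_same_dim[OF lin inj other.subspaces(1) subspaces(1) this W'(2) finite_dim]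
    have onto: "f ` W' = W" .
    obtain g where g: "range g \<subseteq> W'" "linear g" "\<And>w. w \<in> W' \<Longrightarrow> g (f w) = w"
      using linear_exists_left_inverse_on[OF lin other.subspaces(1) inj] by auto
    have fg: "f (g u) = u" if "u \<in> W" for u using that onto g(3) by auto
    define lift where "lift x = g (p x) + T (g (p x))" for x
    have "linear (\<lambda>x. lift x - p (lift x))" unfolding lift_def
      by (intro linearI)
        (simp_all add: blinfun.bilinear_simps linear_add[OF g(2)] linear_scale[OF g(2)] algebra_simps)
    then have S: "blinfun_apply (Blinfun (\<lambda>x. lift x - p (lift x))) = (\<lambda>x. lift x - p (lift x))"
      by (rule apply_Blinfun_linear[OF finite_dim])
    define S where "S = Blinfun (\<lambda>x. lift x - p (lift x))"
    have p_lift: "p (lift x) = p x" for x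
      using fg[OF p_in] by (simp add: lift_def f_def)
    have S_app: "S x = lift x - p x" for x
    proof -
      have "S x = lift x - p (lift x)" by (simp only: S_def S)
      then show ?thesis by (simp only: p_lift)
    qed
    have SH: "S \<in> Hom"
      unfolding hom_compl_iff by (simp add: S_app blinfun.diff_right p_lift) (simp add: lift_def)
    have g_in: "g u \<in> W'" for u using g(1) by auto
    have "graph_on W S = graph_on W' T"
    proof (intro equalityI subsetI)
      fix v assume "v \<in> graph_on W S"
      then obtain u where "u \<in> W" "v = u + S u" by (auto simp: graph_on_def)
      then have "v = lift u" by (simp add: S_app p_on)
      then show "v \<in> graph_on W' T" unfolding lift_def graph_on_def using g_in by blast
    next
      fix v assume "v \<in> graph_on W' T"
      then obtain w where w: "w \<in> W'" "v = w + T w" by (auto simp: graph_on_def)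
      then have "lift v = v" using g(3)[OF w(1)] by (simp add: lift_def f_def)
      then show "v \<in> graph_on W S" using SH by (simp add: mem_graph_iff S_app)
    qed
    moreover have "norm (S - S0) \<le> K * norm (T - T0)"
    proof (rule norm_blinfun_bound)
      fix x
      define w where "w = g (p x)"
      have w: "w \<in> W'" using g_in by (simp add: w_def)
      have "norm w \<le> 2 * c * norm (p x)" using low[OF w] fg[OF p_in] by (simp add: w_def)
      also have "\<dots> \<le> 2 * c * (norm p * norm x)" using c by (intro mult_left_mono norm_blinfun) auto
      finally have nw: "norm w \<le> 2 * c * norm p * norm x" by simp
      define d where "d = (T - T0) w"
      have d: "norm d \<le> norm (T - T0) * (2 * c * norm p * norm x)"
        unfolding d_def using nw by (intro order_trans[OF norm_blinfun] mult_left_mono) auto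
      have "w + T0 w \<in> graph_on W S0" using w S0(2) by (auto simp: graph_on_def)
      then have 0: "(w + T0 w) - p (w + T0 w) - S0 (p (w + T0 w)) = 0"
        using S0(1) by (simp add: mem_graph_iff)
      have "(S - S0) x = lift x - p (lift x) - S0 (p (lift x))"
        using S0(1) by (simp only: p_lift blinfun.diff_left S_app) simp
      also have "lift x = (w + T0 w) + d" by (simp add: lift_def w_def d_def blinfun.diff_left)
      also have "(w + T0 w + d) - p (w + T0 w + d) - S0 (p (w + T0 w + d)) =
          ((w + T0 w) - p (w + T0 w) - S0 (p (w + T0 w))) + (d - p d - S0 (p d))"
        by (simp only: blinfun.add_right) simp
      finally have "(S - S0) x = d - p d - S0 (p d)" using 0 by simp
      then have "norm ((S - S0) x) \<le> norm d + norm (p d) + norm (S0 (p d))"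
        using norm_triangle_ineq4[of "d - p d" "S0 (p d)"] norm_triangle_ineq4[of d "p d"] by simp
      also have "\<dots> \<le> norm d + norm p * norm d + norm S0 * (norm p * norm d)"
        by (intro add_mono order_refl norm_blinfun order_trans[OF norm_blinfun] mult_left_mono) auto
      also have "\<dots> = (1 + norm p + norm S0 * norm p) * norm d" by (simp add: algebra_simps)
      also have "\<dots> \<le> (1 + norm p + norm S0 * norm p) * (norm (T - T0) * (2 * c * norm p * norm x))"
        by (intro mult_left_mono d) auto
      also have "\<dots> = K * norm (T - T0) * norm x" by (simp add: K_def mult_ac)
      finally show "norm ((S - S0) x) \<le> K * norm (T - T0) * norm x" .
    qed (use c in \<open>auto simp: K_def intro!: mult_nonneg_nonneg\<close>)
    ultimately show ?thesis using SH by blast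
  qed
  with e show ?thesis by (rule that)
qed

text \<open>By the transition estimate, openness in the chart centred at \<open>W\<close> carries over to every other chart.\<close>

lemma gr_open_graph_image:
  assumes Q: "openin (top_of_set Hom) Q"
  shows "gr_open (dim W) (graph_on W ` Q)"
  unfolding gr_open_def
proof (intro conjI ballI allI impI)
  have QH: "Q \<subseteq> Hom" using openin_imp_subset[OF Q] .
  then show "graph_on W ` Q \<subseteq> grassmannian (dim W)" using graph_in_grassmannian by (auto simp del: Hom_p Hom_Hom)
  fix W' C' :: "'a set" assume W': "W' \<in> grassmannian (dim W)" "complement W' C'"
  obtain p' where p': "complement_pair W' C' p'"
    using complement_pair_exists[OF finite_dim W'(2)] by blast
  have dim': "dim W' = dim W" using W'(1) by (simp add: grassmannian_def)
  let ?H = "hom_compl W' C'"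
  show "openin (top_of_set ?H) {T \<in> ?H. graph_on W' T \<in> graph_on W ` Q}"
    unfolding openin_euclidean_subtopology_iff
  proof (intro conjI ballI)
    show "{T \<in> ?H. graph_on W' T \<in> graph_on W ` Q} \<subseteq> ?H" by (rule Collect_restrict)
    fix T0 assume "T0 \<in> {T \<in> ?H. graph_on W' T \<in> graph_on W ` Q}"
    then obtain S0 where T0: "T0 \<in> ?H" and S0: "S0 \<in> Q" "graph_on W' T0 = graph_on W S0" by blast
    obtain d where d: "d > 0" "\<And>S. S \<in> Hom \<Longrightarrow> dist S S0 < d \<Longrightarrow> S \<in> Q"
      using Q S0(1) unfolding openin_euclidean_subtopology_iff by metis
    obtain e K where e: "e > 0" and K: "\<And>T. T \<in> ?H \<Longrightarrow> norm (T - T0) < e \<Longrightarrow>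
      \<exists>S\<in>Hom. graph_on W S = graph_on W' T \<and> norm (S - S0) \<le> K * norm (T - T0)"
      using graph_chart_transition[OF p' dim' T0 _ S0(2)] S0(1) QH by (metis subsetD)
    have "\<exists>S\<in>Q. graph_on W' T = graph_on W S" if T: "T \<in> ?H" "dist T T0 < min e (d / (\<bar>K\<bar> + 1))" for T
    proof -
      obtain S where S: "S \<in> Hom" "graph_on W S = graph_on W' T" "norm (S - S0) \<le> K * norm (T - T0)"
        using K[OF T(1)] T(2) by (auto simp: dist_norm)
      have "K * norm (T - T0) \<le> (\<bar>K\<bar> + 1) * norm (T - T0)" by (intro mult_right_mono) auto
      also have "\<dots> < d" using T(2) by (simp add: dist_norm field_simps)
      finally have "S \<in> Q" using d(2)[OF S(1)] S(3) by (simp add: dist_norm)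
      then show ?thesis using S(2) by auto
    qed
    then show "\<exists>e>0. \<forall>T\<in>?H. dist T T0 < e \<longrightarrow> T \<in> {T \<in> ?H. graph_on W' T \<in> graph_on W ` Q}"
      using e d(1) by (intro exI[of _ "min e (d / (\<bar>K\<bar> + 1))"]) (auto simp: image_iff)
  qed
qed

end

section \<open>The defect of a graph from being an ideal\<close>

definition blinfun3 :: "('a \<Rightarrow> 'b \<Rightarrow> 'c \<Rightarrow> 'd) \<Rightarrow> 'a::real_normed_vector \<Rightarrow>\<^sub>L
    'b::real_normed_vector \<Rightarrow>\<^sub>L 'c::real_normed_vector \<Rightarrow>\<^sub>L 'd::real_normed_vector"
  where "blinfun3 g = Blinfun (\<lambda>x. blinfun2 (g x))"

lemma apply_blinfun3:
  fixes g :: "'a::real_normed_vector \<Rightarrow> 'b::real_normed_vector \<Rightarrow> 'c::real_normed_vector \<Rightarrow> 'd::real_normed_vector"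
  assumes "finite_dim TYPE('a)" "finite_dim TYPE('b)" "finite_dim TYPE('c)"
    and "\<And>x y. linear (g x y)" "\<And>x z. linear (\<lambda>y. g x y z)" "\<And>y z. linear (\<lambda>x. g x y z)"
  shows "blinfun3 g x y z = g x y z"
proof -
  have ap: "blinfun2 (g x) y z = g x y z" for x y z
    by (rule apply_blinfun2[OF assms(2-5)])
  have "linear (\<lambda>x. blinfun2 (g x))"
    by (intro linearI blinfun_eqI)
      (simp_all add: blinfun.add_left blinfun.scaleR_left ap linear_add[OF assms(6)] linear_scale[OF assms(6)])
  then show ?thesis by (simp add: blinfun3_def apply_Blinfun_linear[OF assms(1)] ap)
qed

lemma norm_blinfun2_le:
  assumes "b \<ge> 0" "\<And>x y. norm (blinfun_apply (blinfun_apply f x) y) \<le> b * norm x * norm y"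
  shows "norm f \<le> b"
  by (intro norm_blinfun_bound) (use assms in auto)

lemma norm_blinfun3_le:
  assumes "b \<ge> 0" "\<And>x y z. norm (blinfun_apply (blinfun_apply (blinfun_apply f x) y) z) \<le> b * norm x * norm y * norm z"
  shows "norm f \<le> b"
  by (intro norm_blinfun_bound norm_blinfun2_le) (use assms in auto)

lemma norm_blinfun2:
  "norm (blinfun_apply (blinfun_apply f x) y) \<le> norm f * norm x * norm y"
  by (meson mult_right_mono norm_blinfun norm_ge_zero order_trans)

lemma lie_bracket_antisym:
  assumes "lie_bracket \<mu>" shows "\<mu> x y = - \<mu> y x"
proof -
  have lin: "\<And>x. linear (\<lambda>y. \<mu> x y)" "\<And>y. linear (\<lambda>x. \<mu> x y)" and alt: "\<And>x. \<mu> x x = 0"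
    using assms by (auto simp: lie_bracket_def)
  have "\<mu> (x + y) (x + y) = \<mu> x x + \<mu> x y + (\<mu> y x + \<mu> y y)"
    by (simp add: lin(1)[THEN linear_add] lin(2)[THEN linear_add] add_ac)
  then show ?thesis by (simp add: alt add_eq_0_iff2)
qed

text \<open>The Jacobi identity in the form that says that \<open>\<mu>\<close> acts on the space by derivations.\<close>

lemma lie_bracket_jacobi:
  assumes "lie_bracket \<mu>" shows "\<mu> x (\<mu> y z) - \<mu> y (\<mu> x z) - \<mu> (\<mu> x y) z = 0"
proof -
  have "\<mu> x (\<mu> y z) + \<mu> y (\<mu> z x) + \<mu> z (\<mu> x y) = 0" "linear (\<mu> y)"
    using assms by (auto simp: lie_bracket_def)
  moreover have "\<mu> y (\<mu> z x) = - \<mu> y (\<mu> x z)"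
    using lie_bracket_antisym[OF assms, of z x] linear_neg[OF calculation(2)] by simp
  moreover have "\<mu> z (\<mu> x y) = - \<mu> (\<mu> x y) z" by (rule lie_bracket_antisym[OF assms])
  ultimately show ?thesis by simp
qed

context complement_pair
begin

abbreviation q where "q \<equiv> id_blinfun - p"

text \<open>For \<open>T \<in> Hom\<close> the kernel of \<open>q - T\<close> is the graph of \<open>T\<close>, and \<open>p u + T u\<close> is the point of the graph over
  \<open>p u\<close>; so this measures the failure of the graph to be an ideal.\<close>

definition defect :: "('a \<Rightarrow>\<^sub>L 'a \<Rightarrow>\<^sub>L 'a) \<Rightarrow> ('a \<Rightarrow>\<^sub>L 'a) \<Rightarrow> 'a \<Rightarrow>\<^sub>L 'a \<Rightarrow>\<^sub>L 'a" where
  "defect m T = blinfun2 (\<lambda>x u. (q - T) (m x (p u + T u)))"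

text \<open>For \<open>m = m0\<close>, \<open>T = 0\<close> and \<open>f\<close> a \<open>1\<close>-cochain this is the Chevalley--Eilenberg differential of \<open>f\<close>. For
  general \<open>T\<close>, the subspace \<open>W\<close> and the quotient by it are replaced by the graph of \<open>T\<close> and the quotient
  by the graph, which are identified with \<open>W\<close> and \<open>C\<close> by means of \<open>p\<close> and \<open>q - T\<close>.\<close>

definition bianchi :: "('a \<Rightarrow>\<^sub>L 'a \<Rightarrow>\<^sub>L 'a) \<Rightarrow> ('a \<Rightarrow>\<^sub>L 'a) \<Rightarrow> ('a \<Rightarrow>\<^sub>L 'a \<Rightarrow>\<^sub>L 'a) \<Rightarrow> 'a \<Rightarrow>\<^sub>L 'a \<Rightarrow>\<^sub>L 'a \<Rightarrow>\<^sub>L 'a" where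
  "bianchi m T f = blinfun3 (\<lambda>x y u.
     ((q - T) (m x (f y u)) + f x (p (m y (p u + T u)))) -
     ((q - T) (m y (f x u)) + f y (p (m x (p u + T u)))) - f (m x y) u)"

text \<open>The derivative of \<open>T \<mapsto> defect m T\<close> at \<open>T = 0\<close>; if \<open>W\<close> is an ideal, it is the Chevalley--Eilenberg
  differential on \<open>0\<close>-cochains.\<close>

definition d0 :: "('a \<Rightarrow>\<^sub>L 'a \<Rightarrow>\<^sub>L 'a) \<Rightarrow> ('a \<Rightarrow>\<^sub>L 'a) \<Rightarrow> 'a \<Rightarrow>\<^sub>L 'a \<Rightarrow>\<^sub>L 'a" where
  "d0 m S = blinfun2 (\<lambda>x u. q (m x (S u)) - S (m x (p u)))"

text \<open>\<open>Hom(g, Hom(W, C))\<close>, as operators.\<close>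

definition cochains1 :: "('a \<Rightarrow>\<^sub>L 'a \<Rightarrow>\<^sub>L 'a) set" where
  "cochains1 = {f :: 'a \<Rightarrow>\<^sub>L 'a \<Rightarrow>\<^sub>L 'a. \<forall>x u. p (f x u) = 0 \<and> f x (p u) = f x u}"

lemma defect_apply: "defect m T x u = (q - T) (m x (p u + T u))"
  unfolding defect_def
  by (rule apply_blinfun2[OF finite_dim finite_dim])
    (intro linearI; simp add: blinfun.bilinear_simps algebra_simps)+

lemma d0_apply: "d0 m S x u = q (m x (S u)) - S (m x (p u))"
  unfolding d0_def
  by (rule apply_blinfun2[OF finite_dim finite_dim])
    (intro linearI; simp add: blinfun.bilinear_simps algebra_simps)+

lemma bianchi_apply: "bianchi m T f x y u =
     ((q - T) (m x (f y u)) + f x (p (m y (p u + T u)))) -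
     ((q - T) (m y (f x u)) + f y (p (m x (p u + T u)))) - f (m x y) u"
  unfolding bianchi_def
  by (rule apply_blinfun3[OF finite_dim finite_dim finite_dim])
    (intro linearI; simp add: blinfun.bilinear_simps algebra_simps)+

lemma linear_d0: "linear (d0 m)"
  by (intro linearI blinfun_eqI) (simp_all add: d0_apply blinfun.bilinear_simps algebra_simps)

lemma linear_bianchi: "linear (bianchi m T)"
  by (intro linearI blinfun_eqI) (simp_all add: bianchi_apply blinfun.bilinear_simps algebra_simps)

lemma subspace_cochains1: "subspace cochains1"
  unfolding subspace_def cochains1_def by (simp add: blinfun.bilinear_simps)

lemma defect_in_cochains1:
  assumes "T \<in> Hom" shows "defect m T \<in> cochains1"
  using assms by (simp add: cochains1_def defect_apply blinfun.bilinear_simps)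

lemma graph_ideal_iff:
  fixes m :: "'a \<Rightarrow>\<^sub>L 'a \<Rightarrow>\<^sub>L 'a"
  assumes T: "T \<in> Hom"
  shows "lie_ideal (\<lambda>x y. m x y) (graph_on W T) \<longleftrightarrow> defect m T = 0"
proof -
  have mem: "v \<in> graph_on W T \<longleftrightarrow> (q - T) v = 0" for v
    using T by (simp add: mem_graph_iff blinfun.bilinear_simps)
  have "subspace (graph_on W T)"
    using graph_in_grassmannian[OF T] by (simp add: grassmannian_def)
  then have "lie_ideal (\<lambda>x y. m x y) (graph_on W T) \<longleftrightarrow> (\<forall>x. \<forall>v\<in>graph_on W T. (q - T) (m x v) = 0)"
    by (simp add: lie_ideal_def mem)
  also have "\<dots> \<longleftrightarrow> (\<forall>x u. (q - T) (m x (p u + T u)) = 0)"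
  proof (intro iffI allI ballI)
    fix x u assume "\<forall>x. \<forall>v\<in>graph_on W T. (q - T) (m x v) = 0"
    moreover have "p u + T u \<in> graph_on W T" using T by (simp add: mem blinfun.bilinear_simps)
    ultimately show "(q - T) (m x (p u + T u)) = 0" by blast
  next
    fix x v assume *: "\<forall>x u. (q - T) (m x (p u + T u)) = 0" and "v \<in> graph_on W T"
    then have "v - p v = T v" using T by (simp add: mem_graph_iff)
    then have "p v + T v = v" by (simp add: diff_eq_eq add.commute)
    then show "(q - T) (m x v) = 0" using *[rule_format, of x v] by simp
  qed
  also have "\<dots> \<longleftrightarrow> defect m T = 0"
    by (auto simp: defect_apply[symmetric] intro!: blinfun_eqI)
  finally show ?thesis .
qed

text \<open>The analogue of the Bianchi identity. Every \<open>v\<close> splits as \<open>p v + T (p v)\<close>, in the graph, plus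
  \<open>(q - T) v\<close>. Splitting \<open>v = m y w\<close> and \<open>v = m x w\<close> in the Jacobi identity for \<open>x\<close>, \<open>y\<close> and a point \<open>w\<close> of
  the graph, and applying \<open>q - T\<close>, gives exactly the terms of \<open>bianchi\<close>.\<close>

lemma bianchi_defect:
  fixes m :: "'a \<Rightarrow>\<^sub>L 'a \<Rightarrow>\<^sub>L 'a"
  assumes "lie_bracket (\<lambda>x y. m x y)" "T \<in> Hom"
  shows "bianchi m T (defect m T) = 0"
proof (intro blinfun_eqI)
  fix x y u
  define r where "r = q - T"
  define w where "w = p u + T u"
  have split: "r v + (p (p v) + T (p v)) = v" for v
    using assms(2) by (simp add: r_def blinfun.bilinear_simps)
  have key: "r (m x (r v)) + r (m x (p (p v) + T (p v))) = r (m x v)" for x v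
    by (simp only: split flip: blinfun.add_right)
  have "bianchi m T (defect m T) x y u =
      (r (m x (r (m y w))) + r (m x (p (p (m y w)) + T (p (m y w))))) -
      (r (m y (r (m x w))) + r (m y (p (p (m x w)) + T (p (m x w))))) - r (m (m x y) w)"
    unfolding bianchi_apply defect_apply r_def[symmetric] w_def[symmetric] ..
  also have "\<dots> = r (m x (m y w) - m y (m x w) - m (m x y) w)"
    unfolding key by (simp only: blinfun.diff_right)
  also have "\<dots> = 0" using lie_bracket_jacobi[OF assms(1), of x y w] by simp
  finally show "bianchi m T (defect m T) x y u = blinfun_apply (blinfun_apply (blinfun_apply 0 x) y) u"
    by simp
qed

lemma norm_perturbed_action:
  fixes m m0 :: "'a \<Rightarrow>\<^sub>L 'a \<Rightarrow>\<^sub>L 'a" and S T :: "'a \<Rightarrow>\<^sub>L 'a"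
  assumes "norm (m - m0) \<le> s" "norm T \<le> s" "norm m \<le> M"
  shows "norm (q ((m - m0) x v) - T (m x v)) \<le> s * (norm q + M) * norm x * norm v"
proof -
  have s: "s \<ge> 0" "M \<ge> 0" using assms norm_ge_zero order_trans by blast+
  have "norm (q ((m - m0) x v)) \<le> norm q * (s * norm x * norm v)"
    by (intro order_trans[OF norm_blinfun] mult_left_mono order_trans[OF norm_blinfun2] mult_right_mono assms) auto
  moreover have "norm (T (m x v)) \<le> s * (M * norm x * norm v)"
    using s assms
    by (intro order_trans[OF norm_blinfun] mult_mono order_trans[OF norm_blinfun2] mult_right_mono) auto
  ultimately have "norm (q ((m - m0) x v) - T (m x v)) \<le>
      norm q * (s * norm x * norm v) + s * (M * norm x * norm v)"
    using norm_triangle_ineq4[of "q ((m - m0) x v)" "T (m x v)"] by linarith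
  then show ?thesis by (simp add: algebra_simps)
qed

lemma norm_perturbed_restriction:
  fixes m m0 :: "'a \<Rightarrow>\<^sub>L 'a \<Rightarrow>\<^sub>L 'a" and S T :: "'a \<Rightarrow>\<^sub>L 'a"
  assumes "norm (m - m0) \<le> s" "norm T \<le> s" "norm m \<le> M"
  shows "norm ((m - m0) y (p u) + m y (T u)) \<le> s * (norm p + M) * norm y * norm u"
proof -
  have s: "s \<ge> 0" "M \<ge> 0" using assms norm_ge_zero order_trans by blast+
  have "norm ((m - m0) y (p u)) \<le> s * norm y * (norm p * norm u)"
    using s by (intro order_trans[OF norm_blinfun2] mult_mono norm_blinfun assms) auto
  moreover have "norm (m y (T u)) \<le> M * norm y * (s * norm u)"
    using s assms by (intro order_trans[OF norm_blinfun2] mult_mono order_trans[OF norm_blinfun] mult_right_mono) auto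
  ultimately have "norm ((m - m0) y (p u) + m y (T u)) \<le> s * norm y * (norm p * norm u) + M * norm y * (s * norm u)"
    using norm_triangle_ineq[of "(m - m0) y (p u)" "m y (T u)"] by linarith
  then show ?thesis by (simp add: algebra_simps)
qed

text \<open>Explicit continuity of \<open>bianchi\<close> in \<open>(m, T)\<close>, uniform in \<open>f\<close>.\<close>

lemma norm_bianchi_diff:
  fixes m m0 :: "'a \<Rightarrow>\<^sub>L 'a \<Rightarrow>\<^sub>L 'a" and S T :: "'a \<Rightarrow>\<^sub>L 'a"
  assumes "norm (m - m0) \<le> s" "norm T \<le> s" "norm m \<le> M"
  shows "norm (bianchi m T f - bianchi m0 0 f) \<le>
    s * (2 * (norm q + M) + 2 * (norm p * (norm p + M)) + 1) * norm f"
proof -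
  have s: "s \<ge> 0" "M \<ge> 0" using assms norm_ge_zero order_trans by blast+
  define a where "a x v = q ((m - m0) x v) - T (m x v)" for x v
  define b where "b y u = (m - m0) y (p u) + m y (T u)" for y u
  have a: "norm (a x (f y u)) \<le> s * (norm q + M) * norm x * (norm f * norm y * norm u)" for x y u
    unfolding a_def using s
    by (intro order_trans[OF norm_perturbed_action[OF assms]] mult_left_mono norm_blinfun2) auto
  have b: "norm (f x (p (b y u))) \<le> norm f * norm x * (norm p * (s * (norm p + M) * norm y * norm u))" for x y u
    unfolding b_def using s
    by (intro order_trans[OF norm_blinfun2] mult_left_mono order_trans[OF norm_blinfun]
        norm_perturbed_restriction[OF assms]) auto
  have c: "norm (f ((m - m0) x y) u) \<le> norm f * (s * norm x * norm y) * norm u" for x y u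
    using s by (intro order_trans[OF norm_blinfun2] mult_mono order_trans[OF norm_blinfun2] mult_right_mono assms) auto
  show ?thesis
  proof (rule norm_blinfun3_le)
    fix x y u
    have "(bianchi m T f - bianchi m0 0 f) x y u =
        a x (f y u) + f x (p (b y u)) - (a y (f x u) + f y (p (b x u))) - f ((m - m0) x y) u"
      by (simp add: bianchi_apply a_def b_def blinfun.bilinear_simps)
    then have "norm ((bianchi m T f - bianchi m0 0 f) x y u) \<le>
        norm (a x (f y u)) + norm (f x (p (b y u))) + (norm (a y (f x u)) + norm (f y (p (b x u)))) + norm (f ((m - m0) x y) u)"
      using norm_triangle_ineq[of "a x (f y u)" "f x (p (b y u))"]
        norm_triangle_ineq[of "a y (f x u)" "f y (p (b x u))"]
        norm_triangle_ineq4[of "a x (f y u) + f x (p (b y u))" "a y (f x u) + f y (p (b x u))"]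
        norm_triangle_ineq4[of "a x (f y u) + f x (p (b y u)) - (a y (f x u) + f y (p (b x u)))" "f ((m - m0) x y) u"]
      by simp
    also have "\<dots> \<le> s * (norm q + M) * norm x * (norm f * norm y * norm u) +
       norm f * norm x * (norm p * (s * (norm p + M) * norm y * norm u)) +
       (s * (norm q + M) * norm y * (norm f * norm x * norm u) +
       norm f * norm y * (norm p * (s * (norm p + M) * norm x * norm u))) + 
       norm f * (s * norm x * norm y) * norm u"
      by (intro add_mono a b c)
    also have "\<dots> = s * (2 * (norm q + M) + 2 * (norm p * (norm p + M)) + 1) * norm f * norm x * norm y * norm u"
      by (simp add: algebra_simps)
    finally show "norm ((bianchi m T f - bianchi m0 0 f) x y u) \<le>
       s * (2 * (norm q + M) + 2 * (norm p * (norm p + M)) + 1) * norm f * norm x * norm y * norm u" .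
  qed (use s in auto)
qed

text \<open>Near \<open>(m0, 0)\<close> the defect minus its linearization at that point has a small Lipschitz constant in
  \<open>T\<close>, which makes the fixed point argument for stability work.\<close>

lemma norm_defect_diff:
  fixes m m0 :: "'a \<Rightarrow>\<^sub>L 'a \<Rightarrow>\<^sub>L 'a" and S T :: "'a \<Rightarrow>\<^sub>L 'a"
  assumes "norm (m - m0) \<le> s" "norm S \<le> s" "norm T \<le> s" "norm m \<le> M"
  shows "norm ((defect m T - d0 m0 T) - (defect m S - d0 m0 S)) \<le>
    s * ((norm q + M) + (norm p + M)) * norm (T - S)"
proof (rule norm_blinfun2_le)
  have s: "s \<ge> 0" "M \<ge> 0" using assms norm_ge_zero order_trans by blast+
  then show "0 \<le> s * ((norm q + M) + (norm p + M)) * norm (T - S)" by simp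
  fix x u
  define R where "R = T - S"
  have T: "T = S + R" by (simp add: R_def)
  have "((defect m T - d0 m0 T) - (defect m S - d0 m0 S)) x u =
      (q ((m - m0) x (R u)) - T (m x (R u))) - R ((m - m0) x (p u) + m x (S u))"
    unfolding T by (simp add: defect_apply d0_apply blinfun.bilinear_simps)
  also have "norm \<dots> \<le> s * (norm q + M) * norm x * (norm R * norm u) + norm R * (s * (norm p + M) * norm x * norm u)"
  proof -
    have "norm (q ((m - m0) x (R u)) - T (m x (R u))) \<le> s * (norm q + M) * norm x * (norm R * norm u)"
      using s by (intro order_trans[OF norm_perturbed_action[OF assms(1,3,4)]] mult_left_mono norm_blinfun) auto
    moreover have "norm (R ((m - m0) x (p u) + m x (S u))) \<le> norm R * (s * (norm p + M) * norm x * norm u)"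
      by (intro order_trans[OF norm_blinfun] mult_left_mono norm_perturbed_restriction[OF assms(1,2,4)]) auto
    ultimately show ?thesis
      using norm_triangle_ineq4[of "q ((m - m0) x (R u)) - T (m x (R u))" "R ((m - m0) x (p u) + m x (S u))"] by linarith
  qed
  also have "\<dots> = s * ((norm q + M) + (norm p + M)) * norm (T - S) * norm x * norm u"
    by (simp add: R_def algebra_simps)
  finally show "norm (((defect m T - d0 m0 T) - (defect m S - d0 m0 S)) x u) \<le>
     s * ((norm q + M) + (norm p + M)) * norm (T - S) * norm x * norm u" .
qed

end

section \<open>Ideals near a rigid ideal\<close>

lemma min_divide_mult_le: "d > 0 \<Longrightarrow> min b (e / d) * d \<le> e" for b d e :: real
  by (meson min.cobounded2 pos_le_divide_eq)

text \<open>\<open>exact\<close> is the vanishing of the first cohomology, with \<open>Hom(W, g/W)\<close> replaced by \<open>Hom(W, C)\<close>.\<close>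

locale rigid_ideal = complement_pair W C p
  for W C :: "'a::real_normed_vector set" and p :: "'a \<Rightarrow>\<^sub>L 'a" +
  fixes m0 :: "'a \<Rightarrow>\<^sub>L 'a \<Rightarrow>\<^sub>L 'a"
  assumes lie: "lie_bracket (\<lambda>x y. m0 x y)"
    and ideal: "lie_ideal (\<lambda>x y. m0 x y) W"
    and exact: "\<And>f. f \<in> cochains1 \<Longrightarrow> bianchi m0 0 f = 0 \<Longrightarrow> f \<in> d0 m0 ` Hom"
begin

text \<open>A linear choice of primitives in \<open>Hom\<close> for the coboundaries; on the other cochains it is an arbitrary
  linear extension.\<close>

definition h :: "('a \<Rightarrow>\<^sub>L 'a \<Rightarrow>\<^sub>L 'a) \<Rightarrow> 'a \<Rightarrow>\<^sub>L 'a" where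
  "h = (SOME h. range h \<subseteq> Hom \<and> linear h \<and> (\<forall>f\<in>d0 m0 ` Hom. d0 m0 (h f) = f))"

lemma h: "h f \<in> Hom" "linear h" "S \<in> Hom \<Longrightarrow> d0 m0 (h (d0 m0 S)) = d0 m0 S"
proof -
  have "\<exists>h. range h \<subseteq> Hom \<and> linear h \<and> (\<forall>f\<in>d0 m0 ` Hom. d0 m0 (h f) = f)"
    using linear_exists_right_inverse_on[OF linear_d0 subspace_Hom] by auto
  from someI_ex[OF this] show "h f \<in> Hom" "linear h" "S \<in> Hom \<Longrightarrow> d0 m0 (h (d0 m0 S)) = d0 m0 S"
    unfolding h_def by blast+
qed

lemma finite_dim_operators: "finite_dim TYPE('a \<Rightarrow>\<^sub>L 'a)" "finite_dim TYPE('a \<Rightarrow>\<^sub>L 'a \<Rightarrow>\<^sub>L 'a)"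
    "finite_dim TYPE('a \<Rightarrow>\<^sub>L 'a \<Rightarrow>\<^sub>L 'a \<Rightarrow>\<^sub>L 'a)"
  by (intro finite_dim_blinfun finite_dim)+

lemma h_bounded: obtains H where "H \<ge> 0" "\<And>f. norm (h f) \<le> H * norm f"
proof -
  have "bounded_linear h" by (rule linear_imp_bounded_linear[OF finite_dim_operators(2) h(2)])
  from bounded_linear.nonneg_bounded[OF this] show ?thesis using that by (auto simp: mult.commute)
qed

lemma h_zero_diff: "h 0 = 0" "h (f - g) = h f - h g" "h (f + g) = h f + h g"
  using h(2) by (auto simp: linear_0 linear_diff linear_add)

text \<open>A cocycle is a coboundary \<open>d0 S\<close>, and \<open>d0 (h (d0 S)) = d0 S\<close>. So the differential is injective on the
  cochains killed by \<open>d0 \<circ> h\<close>, hence bounded below there.\<close>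

lemma bianchi_coercive:
  obtains \<kappa> where "\<kappa> \<ge> 0"
    "\<And>f. f \<in> cochains1 \<Longrightarrow> d0 m0 (h f) = 0 \<Longrightarrow> norm f \<le> \<kappa> * norm (bianchi m0 0 f)"
proof -
  define V where "V = cochains1 \<inter> {f. d0 m0 (h f) = 0}"
  have "linear (\<lambda>f. d0 m0 (h f))"
    using linear_compose[OF h(2) linear_d0] by (simp add: o_def)
  then have V: "subspace V" unfolding V_def
    by (intro subspace_inter subspace_cochains1 linear_subspace_kernel)
  have "inj_on (bianchi m0 0) V"
    unfolding linear_inj_on_iff_eq_0[OF linear_bianchi V]
  proof (intro ballI impI)
    fix f assume f: "f \<in> V" "bianchi m0 0 f = 0"
    then obtain S where S: "S \<in> Hom" "f = d0 m0 S" using exact by (auto simp: V_def)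
    then show "f = 0" using f(1) h(3)[OF S(1)] by (simp add: V_def)
  qed
  then obtain g where g: "linear g" "\<And>f. f \<in> V \<Longrightarrow> g (bianchi m0 0 f) = f"
    using linear_exists_left_inverse_on[OF linear_bianchi V] by blast
  from bounded_linear.nonneg_bounded[OF linear_imp_bounded_linear[OF finite_dim_operators(3) g(1)]]
  obtain \<kappa> where \<kappa>: "\<kappa> \<ge> 0" "\<And>x. norm (g x) \<le> norm x * \<kappa>" by blast
  have "norm f \<le> \<kappa> * norm (bianchi m0 0 f)" if "f \<in> cochains1" "d0 m0 (h f) = 0" for f
    using \<kappa>(2)[of "bianchi m0 0 f"] g(2)[of f] that by (simp add: V_def mult.commute)
  with \<kappa>(1) show ?thesis by (rule that)
qed

text \<open>The operator \<open>bianchi m T\<close> annihilates the defect and is close to the coercive operator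
  \<open>bianchi m0 0\<close>, so the norm of the defect is at most half of itself.\<close>

lemma defect_zero_if_projection_zero:
  obtains s where "s > 0" "s \<le> 1" "\<And>m T. \<lbrakk>lie_bracket (\<lambda>x y. blinfun_apply (blinfun_apply m x) y); norm (m - m0) \<le> s; T \<in> Hom;
    norm T \<le> s; d0 m0 (h (defect m T)) = 0\<rbrakk> \<Longrightarrow> defect m T = 0"
proof -
  obtain \<kappa> where \<kappa>: "\<kappa> \<ge> 0"
    "\<And>f. f \<in> cochains1 \<Longrightarrow> d0 m0 (h f) = 0 \<Longrightarrow> norm f \<le> \<kappa> * norm (bianchi m0 0 f)"
    using bianchi_coercive by blast
  define M where "M = norm m0 + 1"
  define c where "c = 2 * (norm q + M) + 2 * (norm p * (norm p + M)) + 1"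
  have c: "c > 0"
  proof -
    have "M \<ge> 0" "norm p * (norm p + M) \<ge> 0" by (simp_all add: M_def)
    then show ?thesis unfolding c_def by (intro add_nonneg_pos add_nonneg_nonneg mult_nonneg_nonneg) auto
  qed
  \<comment> \<open>chosen so that \<open>\<kappa> * (s * c) \<le> 1 / 2\<close>, where \<open>s * c\<close> bounds the change of \<open>bianchi\<close>\<close>
  define s where "s = min 1 (1 / (2 * c * (\<kappa> + 1)))"
  have s: "s > 0" "s \<le> 1" using c \<kappa>(1) by (auto simp: s_def)
  have "\<kappa> * (s * c) \<le> 1 / 2"
  proof -
    have "s * (2 * c * (\<kappa> + 1)) \<le> 1"
      unfolding s_def using c \<kappa>(1) by (intro min_divide_mult_le) simp
    moreover have "s * (2 * c * (\<kappa> + 1)) = 2 * (\<kappa> * (s * c)) + 2 * (s * c)" by (simp add: algebra_simps)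
    moreover have "s * c > 0" using s c by simp
    ultimately show ?thesis by linarith
  qed
  note ksc = this
  have "defect m T = 0" if m: "lie_bracket (\<lambda>x y. blinfun_apply (blinfun_apply m x) y)" "norm (m - m0) \<le> s" and
    T: "T \<in> Hom" "norm T \<le> s" and 0: "d0 m0 (h (defect m T)) = 0" for m T
  proof -
    have M: "norm m \<le> M" using norm_triangle_ineq[of m0 "m - m0"] m(2) s(2) by (simp add: M_def)
    have "norm (defect m T) \<le> \<kappa> * norm (bianchi m0 0 (defect m T))"
      using \<kappa>(2) defect_in_cochains1[OF T(1)] 0 by blast
    also have "norm (bianchi m0 0 (defect m T)) = norm (bianchi m T (defect m T) - bianchi m0 0 (defect m T))"
      using bianchi_defect[OF m(1) T(1)] by simp
    also have "\<kappa> * \<dots> \<le> \<kappa> * (s * c * norm (defect m T))"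
      unfolding c_def by (intro mult_left_mono norm_bianchi_diff m(2) T(2) M \<kappa>(1))
    also have "\<dots> = (\<kappa> * (s * c)) * norm (defect m T)" by (simp add: algebra_simps)
    also have "\<dots> \<le> 1 / 2 * norm (defect m T)" by (intro mult_right_mono ksc) simp
    finally show "defect m T = 0" by simp
  qed
  with s show ?thesis by (rule that)
qed

lemma ideal_invariant: "p (m0 x (p u)) = m0 x (p u)"
  using ideal p_in p_on by (auto simp: lie_ideal_def)

text \<open>The \<open>d0\<close>-image of the perturbed identity is the reduced equation, because \<open>d0 T\<close> cancels against
  \<open>d0 (h (d0 T))\<close>.\<close>

lemma d0_projection:
  assumes "T \<in> Hom" 
  shows "d0 m0 (T + (h (defect m T) - h (d0 m0 T))) = d0 m0 (h (defect m T))"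
  using h(3)[OF assms] by (simp add: linear_add[OF linear_d0] linear_diff[OF linear_d0])

text \<open>A zero \<open>T\<close> of the perturbed identity \<open>T + N T\<close> is in the image of \<open>h\<close>, hence in \<open>Hom\<close>, and solves the
  reduced equation.\<close>

lemma nearby_ideal_exists:
  assumes "\<epsilon> > 0"
  obtains s where "s > 0" "\<And>m. \<lbrakk>lie_bracket (\<lambda>x y. blinfun_apply (blinfun_apply m x) y); norm (m - m0) \<le> s\<rbrakk> \<Longrightarrow>
    \<exists>T\<in>Hom. norm T < \<epsilon> \<and> lie_ideal (\<lambda>x y. m x y) (graph_on W T)"
proof -
  obtain s1 where s1: "s1 > 0" "s1 \<le> 1" "\<And>m T. \<lbrakk>lie_bracket (\<lambda>x y. blinfun_apply (blinfun_apply m x) y); norm (m - m0) \<le> s1; T \<in> Hom;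
    norm T \<le> s1; d0 m0 (h (defect m T)) = 0\<rbrakk> \<Longrightarrow> defect m T = 0"
    using defect_zero_if_projection_zero by blast
  obtain H where H: "H \<ge> 0" "\<And>f. norm (h f) \<le> H * norm f" using h_bounded by blast
  define M where "M = norm m0 + 1"
  define c where "c = (norm q + M) + (norm p + M)"
  have c: "c \<ge> 0" by (simp add: c_def M_def)
  \<comment> \<open>on the ball of radius \<open>r\<close> the map \<open>N\<close> below contracts by the factor \<open>1 / 2\<close>; the summand \<open>1\<close> guards against \<open>H * c = 0\<close>\<close>
  define r where "r = min (min s1 (\<epsilon> / 2)) (1 / (2 * H * c + 1))"
  have Hc: "2 * H * c + 1 > 0" using H(1) c by (simp add: add_nonneg_pos)
  have r: "r > 0" "r \<le> s1" "r < \<epsilon>" using s1(1) assms Hc by (auto simp: r_def)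
  have Hcr: "H * (r * c) \<le> 1 / 2"
  proof -
    have "r * (2 * H * c + 1) \<le> 1" unfolding r_def using Hc by (rule min_divide_mult_le)
    then have "2 * (H * (r * c)) + r \<le> 1" by (simp add: algebra_simps)
    then show ?thesis using r(1) by simp
  qed
  \<comment> \<open>for brackets within \<open>r / d\<close> of \<open>m0\<close> the constant term satisfies \<open>2 * norm (N 0) \<le> r\<close>, so the solution lies in that ball\<close>
  define d where "d = 2 * H * (norm q * norm p) + 1"
  have d: "d > 0" using H(1) by (simp add: d_def add_nonneg_pos)
  define s where "s = min r (r / d)"
  have s: "s > 0" "s \<le> r" "s * d \<le> r" using r(1) d min_divide_mult_le[OF d] by (auto simp: s_def)
  have "\<exists>T\<in>Hom. norm T < \<epsilon> \<and> lie_ideal (\<lambda>x y. m x y) (graph_on W T)"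
    if m: "lie_bracket (\<lambda>x y. blinfun_apply (blinfun_apply m x) y)" "norm (m - m0) \<le> s" for m
  proof -
    have mr: "norm (m - m0) \<le> r" using m(2) s(2) by simp
    have M: "norm m \<le> M" using norm_triangle_ineq[of m0 "m - m0"] mr r(2) s1(2) by (simp add: M_def)
    define N where "N T = h (defect m T) - h (d0 m0 T)" for T
    have "norm (N S - N T) \<le> 1 / 2 * norm (S - T)" if "norm S \<le> r" "norm T \<le> r" for S T
    proof -
      have "norm (N S - N T) = norm (h ((defect m S - d0 m0 S) - (defect m T - d0 m0 T)))"
        by (simp add: N_def h_zero_diff)
      also have "\<dots> \<le> H * (r * c * norm (S - T))"
        unfolding c_def by (intro order_trans[OF H(2)] mult_left_mono norm_defect_diff mr M that H(1))
      also have "\<dots> = (H * (r * c)) * norm (S - T)" by (simp add: algebra_simps)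
      also have "\<dots> \<le> 1 / 2 * norm (S - T)" by (intro mult_right_mono Hcr) simp
      finally show ?thesis .
    qed
    moreover have "2 * norm (0 - N 0) \<le> r"
    proof -
      have "norm (defect m 0) \<le> norm q * norm p * s"
      proof (rule norm_blinfun2_le)
        fix x u
        have "defect m 0 x u = q ((m - m0) x (p u))"
          using ideal_invariant[of x u] by (simp add: defect_apply blinfun.bilinear_simps)
        also have "norm \<dots> \<le> norm q * (s * norm x * (norm p * norm u))"
          using s(1) m(2) by (intro order_trans[OF norm_blinfun] mult_left_mono
            order_trans[OF norm_blinfun2] mult_mono norm_blinfun) auto
        finally show "norm (defect m 0 x u) \<le> norm q * norm p * s * norm x * norm u" by (simp add: mult_ac)
      qed (use s(1) in simp)
      then have "norm (h (defect m 0)) \<le> H * (norm q * norm p * s)"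
        using H by (meson mult_left_mono order_trans)
      then have "2 * norm (0 - N 0) \<le> 2 * H * (norm q * norm p) * s"
        by (simp add: N_def linear_0[OF linear_d0] h_zero_diff)
      also have "\<dots> \<le> s * d" using s(1) by (simp add: d_def algebra_simps)
      finally show ?thesis using s(3) by simp
    qed
    ultimately obtain T where T: "norm T \<le> 2 * norm (0 - N 0)" "T + N T = 0"
      using perturbed_identity_solvable[OF complete_finite_dim[OF finite_dim_operators(1)], of r N 0] by blast
    have nT: "norm T \<le> r" using T(1) \<open>2 * norm (0 - N 0) \<le> r\<close> by simp
    have "T = h (d0 m0 T) - h (defect m T)" using T(2) by (simp add: N_def algebra_simps)
    then have TH: "T \<in> Hom" using subspace_diff[OF subspace_Hom h(1) h(1)] by metis
    have "d0 m0 (h (defect m T)) = 0"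
      using d0_projection[OF TH, of m] T(2) by (simp add: N_def linear_0[OF linear_d0])
    then have "defect m T = 0"
      using s1(3)[OF m(1) _ TH] mr nT r(2) by simp
    then have "lie_ideal (\<lambda>x y. m x y) (graph_on W T)" by (simp add: graph_ideal_iff[OF TH])
    then show ?thesis using TH nT r(3) by (intro bexI[of _ T]) auto
  qed
  with s(1) show ?thesis by (rule that)
qed

text \<open>Twice the polarization of the quadratic part \<open>T \<mapsto> - T (m0 x (T u))\<close> of the defect.\<close>

definition quadratic :: "('a \<Rightarrow>\<^sub>L 'a) \<Rightarrow> ('a \<Rightarrow>\<^sub>L 'a) \<Rightarrow> 'a \<Rightarrow>\<^sub>L 'a \<Rightarrow>\<^sub>L 'a" where
  "quadratic T S = blinfun2 (\<lambda>x u. - T (m0 x (S u)) - S (m0 x (T u)))"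

definition B :: "('a \<Rightarrow>\<^sub>L 'a) \<Rightarrow>\<^sub>L ('a \<Rightarrow>\<^sub>L 'a) \<Rightarrow>\<^sub>L ('a \<Rightarrow>\<^sub>L 'a)" where
  "B = blinfun2 (\<lambda>T S. h (quadratic T S))"

lemma quadratic_apply: "quadratic T S x u = - T (m0 x (S u)) - S (m0 x (T u))"
  unfolding quadratic_def
  by (rule apply_blinfun2[OF finite_dim finite_dim])
    (intro linearI; simp add: blinfun.bilinear_simps algebra_simps)+

lemma B_apply: "B T S = h (quadratic T S)"
  unfolding B_def
proof (rule apply_blinfun2[OF finite_dim_operators(1,1)])
  show "linear (\<lambda>S. h (quadratic T S))" for T
    by (rule linear_compose[OF _ h(2), unfolded o_def], intro linearI blinfun_eqI)
      (simp_all add: quadratic_apply blinfun.bilinear_simps algebra_simps)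
  show "linear (\<lambda>T. h (quadratic T S))" for S
    by (rule linear_compose[OF _ h(2), unfolded o_def], intro linearI blinfun_eqI)
      (simp_all add: quadratic_apply blinfun.bilinear_simps algebra_simps)
qed

lemma B_sym: "B S T = B T S"
proof -
  have "quadratic S T = quadratic T S" by (intro blinfun_eqI) (simp add: quadratic_apply)
  then show ?thesis by (simp add: B_apply)
qed

text \<open>The perturbed identity \<open>T + h (defect m0 T) - h (d0 m0 T)\<close>, written as a quadratic map on all operators
  so that it can be inverted on open balls and restricted to \<open>Hom\<close> afterwards.\<close>

definition straighten :: "('a \<Rightarrow>\<^sub>L 'a) \<Rightarrow> 'a \<Rightarrow>\<^sub>L 'a" where
  "straighten T = T + (1 / 2) *\<^sub>R B T T"

lemma straighten_eq:
  assumes "T \<in> Hom" shows "straighten T = T + (h (defect m0 T) - h (d0 m0 T))"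
proof -
  have "defect m0 T - d0 m0 T = (1 / 2) *\<^sub>R quadratic T T"
  proof (intro blinfun_eqI)
    fix x u
    have "defect m0 T x u - d0 m0 T x u = - T (m0 x (T u))"
      using ideal_invariant[of x u] by (simp add: defect_apply d0_apply blinfun.bilinear_simps)
    also have "\<dots> = (1 / 2) *\<^sub>R quadratic T T x u"
    proof -
      have "quadratic T T x u = 2 *\<^sub>R (- T (m0 x (T u)))" by (simp add: quadratic_apply scaleR_2)
      then show ?thesis by simp
    qed
    finally show "(defect m0 T - d0 m0 T) x u = ((1 / 2) *\<^sub>R quadratic T T) x u"
      by (simp add: blinfun.bilinear_simps)
  qed
  then have "h (defect m0 T) - h (d0 m0 T) = (1 / 2) *\<^sub>R B T T"
    by (simp add: B_apply linear_scale[OF h(2)] flip: h_zero_diff(2))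
  then show ?thesis by (simp add: straighten_def)
qed

lemma straighten_in_Hom_iff: "straighten T \<in> Hom \<longleftrightarrow> T \<in> Hom"
proof -
  have "(1 / 2) *\<^sub>R B T T \<in> Hom" using h(1) by (simp add: B_apply subspace_scale[OF subspace_Hom])
  then show ?thesis unfolding straighten_def
    using subspace_add[OF subspace_Hom] subspace_diff[OF subspace_Hom] by (metis add_diff_cancel_right')
qed

text \<open>The \<open>0\<close>-cocycles, with values in \<open>C\<close> instead of \<open>g/W\<close>.\<close>

definition Z where "Z = {T \<in> Hom. d0 m0 T = 0}"

lemma subspace_Z: "subspace Z"
proof -
  have "Z = Hom \<inter> {T. d0 m0 T = 0}" by (auto simp: Z_def)
  then show ?thesis by (simp add: subspace_inter subspace_Hom linear_subspace_kernel linear_d0)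
qed

text \<open>Membership of \<open>straighten T\<close> in \<open>Z\<close> is the reduced equation \<open>d0 (h (defect m0 T)) = 0\<close>.\<close>

lemma chart_radius:
  obtains r where "r > 0" "norm B * r \<le> 1 / 2"
    "\<And>T. T \<in> Hom \<Longrightarrow> norm T < r \<Longrightarrow> lie_ideal (\<lambda>x y. m0 x y) (graph_on W T) \<longleftrightarrow> straighten T \<in> Z"
proof -
  obtain s1 where s1: "s1 > 0" "s1 \<le> 1" "\<And>m T. \<lbrakk>lie_bracket (\<lambda>x y. blinfun_apply (blinfun_apply m x) y); norm (m - m0) \<le> s1; T \<in> Hom;
    norm T \<le> s1; d0 m0 (h (defect m T)) = 0\<rbrakk> \<Longrightarrow> defect m T = 0"
    using defect_zero_if_projection_zero by blast
  define r where "r = min s1 (1 / (2 * norm B + 1))"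
  have B: "2 * norm B + 1 > 0" by (simp add: add_nonneg_pos)
  have r: "r > 0" "r \<le> s1" using s1(1) B by (auto simp: r_def)
  have Br: "norm B * r \<le> 1 / 2"
  proof -
    have "r * (2 * norm B + 1) \<le> 1" unfolding r_def using B by (rule min_divide_mult_le)
    then have "2 * (norm B * r) + r \<le> 1" by (simp add: algebra_simps)
    then show ?thesis using r(1) by simp
  qed
  have "lie_ideal (\<lambda>x y. m0 x y) (graph_on W T) \<longleftrightarrow> straighten T \<in> Z" if T: "T \<in> Hom" "norm T < r" for T
  proof -
    have "straighten T \<in> Z \<longleftrightarrow> d0 m0 (h (defect m0 T)) = 0"
      using straighten_in_Hom_iff[of T] T(1) d0_projection[OF T(1), of m0] by (simp add: Z_def straighten_eq)
    also have "\<dots> \<longleftrightarrow> defect m0 T = 0"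
      using s1(3)[OF lie _ T(1)] s1(1) T(2) r(2) by (auto simp: h_zero_diff linear_0[OF linear_d0])
    finally show ?thesis using graph_ideal_iff[OF T(1)] by simp
  qed
  with r(1) Br show ?thesis by (rule that)
qed

end

section \<open>Stability, slice chart and integration of cocycles\<close>

context rigid_ideal
begin

abbreviation bracket where "bracket \<equiv> \<lambda>x y. m0 x y"

text \<open>Evaluations at pairs of vectors are continuous for pointwise convergence, and finitely many of them
  control the operator norm of the difference of two brackets.\<close>

lemma stable: "stable_ideal bracket (dim W) W"
  unfolding stable_ideal_def
proof (intro allI impI)
  fix U assume U: "openin (gr_topology (dim W)) U" "W \<in> U"
  have "W \<in> grassmannian (dim W)" using subspaces by (simp add: grassmannian_def)
  then have "openin (top_of_set Hom) {T \<in> Hom. graph_on W T \<in> U}"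
    using U(1) complement unfolding openin_gr_topology gr_open_def by blast
  moreover have "0 \<in> {T \<in> Hom. graph_on W T \<in> U}"
    using U(2) subspace_0[OF subspace_Hom] by (simp add: graph_zero)
  ultimately obtain \<epsilon> where \<epsilon>: "\<epsilon> > 0" "\<And>T. T \<in> Hom \<Longrightarrow> dist T 0 < \<epsilon> \<Longrightarrow> graph_on W T \<in> U"
    unfolding openin_euclidean_subtopology_iff by blast
  obtain s where s: "s > 0" "\<And>m. \<lbrakk>lie_bracket (\<lambda>x y. blinfun_apply (blinfun_apply m x) y); norm (m - m0) \<le> s\<rbrakk> \<Longrightarrow>
    \<exists>T\<in>Hom. norm T < \<epsilon> \<and> lie_ideal (\<lambda>x y. m x y) (graph_on W T)"
    using nearby_ideal_exists[OF \<epsilon>(1)] by blast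
  obtain D :: "'a set" and K where D: "finite D" "K \<ge> 0"
    "\<And>m :: 'a \<Rightarrow>\<^sub>L 'a \<Rightarrow>\<^sub>L 'a. norm m \<le> K * (\<Sum>b\<in>D. norm (blinfun_apply m b))"
    using norm_blinfun_le_sum[OF finite_dim] by blast
  obtain D' :: "'a set" and K' where D': "finite D'" "K' \<ge> 0"
    "\<And>T :: 'a \<Rightarrow>\<^sub>L 'a. norm T \<le> K' * (\<Sum>b\<in>D'. norm (blinfun_apply T b))"
    using norm_blinfun_le_sum[OF finite_dim] by blast
  \<comment> \<open>a bound for the operator norm of \<open>\<nu> - m0\<close> that only involves finitely many values of \<open>\<nu>\<close>\<close>
  define gap :: "('a \<Rightarrow> 'a \<Rightarrow> 'a) \<Rightarrow> real" where
    "gap \<nu> = K * (\<Sum>b\<in>D. K' * (\<Sum>b'\<in>D'. norm (\<nu> b b' - m0 b b')))" for \<nu>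
  have ev: "continuous_on UNIV (\<lambda>\<nu> :: 'a \<Rightarrow> 'a \<Rightarrow> 'a. \<nu> b b')" for b b'
    by (rule continuous_on_compose2[OF continuous_on_product_coordinates continuous_on_product_coordinates]) auto
  have "continuous_on UNIV gap" unfolding gap_def by (intro continuous_intros ev)
  then have "open {\<nu>. gap \<nu> < s}" by (intro open_Collect_less) auto
  then have "openin bracket_topology ({\<nu>. lie_bracket \<nu>} \<inter> {\<nu>. gap \<nu> < s})"
    unfolding bracket_topology_def by (rule openin_open_Int)
  moreover have "bracket \<in> {\<nu>. lie_bracket \<nu>} \<inter> {\<nu>. gap \<nu> < s}"
    using lie s(1) by (simp add: gap_def)
  moreover have "\<exists>I'\<in>U. lie_ideal \<nu> I'" if \<nu>: "\<nu> \<in> {\<nu>. lie_bracket \<nu>} \<inter> {\<nu>. gap \<nu> < s}" for \<nu>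
  proof -
    define m where "m = blinfun2 \<nu>"
    have m: "m x y = \<nu> x y" for x y
      unfolding m_def using \<nu> by (intro apply_blinfun2[OF finite_dim finite_dim]) (auto simp: lie_bracket_def)
    then have lm: "lie_bracket (\<lambda>x y. m x y)" using \<nu> by simp
    have "norm (m - m0) \<le> K * (\<Sum>b\<in>D. norm ((m - m0) b))" by (rule D(3))
    also have "\<dots> \<le> K * (\<Sum>b\<in>D. K' * (\<Sum>b'\<in>D'. norm ((m - m0) b b')))"
      by (intro mult_left_mono sum_mono D'(3) D(2))
    also have "\<dots> = gap \<nu>" by (simp add: gap_def blinfun.diff_left m)
    finally have "norm (m - m0) \<le> s" using \<nu> by simp
    then obtain T where "T \<in> Hom" "norm T < \<epsilon>" "lie_ideal (\<lambda>x y. m x y) (graph_on W T)"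
      using s(2)[OF lm] by blast
    then show ?thesis using \<epsilon>(2)[of T] by (auto simp: m)
  qed
  ultimately show "\<exists>V. openin bracket_topology V \<and> bracket \<in> V \<and> (\<forall>\<mu>'\<in>V. \<exists>I'\<in>U. lie_ideal \<mu>' I')"
    by blast
qed

lemma complete_operators: "complete (UNIV :: ('a \<Rightarrow>\<^sub>L 'a) set)"
  by (rule complete_finite_dim[OF finite_dim_operators(1)])

lemma Ck_on_straighten: "Ck_on n E S straighten"
  unfolding straighten_def
  by (rule Ck_on_add[OF Ck_on_linear[OF bounded_linear_ident] Ck_on_bounded_linear_compose[OF
    bounded_linear_scaleR_right Ck_on_bounded_bilinear[OF bounded_bilinear_blinfun_apply
      Ck_on_linear[OF blinfun.bounded_linear_right] Ck_on_linear[OF bounded_linear_ident]]]])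

text \<open>\<open>straighten\<close> is the slice chart. Its domain \<open>Q\<close> is cut down so that the image is exactly a ball in
  \<open>Hom\<close>, on which the inverse \<open>\<Theta>\<close> is available.\<close>

lemma submanifold: "gr_submanifold_near (dim W) (ideals_of_dim bracket (dim W)) W (dim Z)"
proof -
  obtain r where r: "r > 0" "norm B * r \<le> 1 / 2"
    "\<And>T. T \<in> Hom \<Longrightarrow> norm T < r \<Longrightarrow> lie_ideal bracket (graph_on W T) \<longleftrightarrow> straighten T \<in> Z"
    using chart_radius by blast
  define Q where "Q = {T \<in> Hom. norm T < r \<and> norm (straighten T) < r / 2}"
  define Q' where "Q' = {T \<in> Hom. norm T < r / 2}"
  define U where "U = graph_on W ` Q"
  have "\<forall>y. norm y < r / 2 \<longrightarrow> (\<exists>T. norm T < r \<and> straighten T = y)"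
    using quadratic_solvable[OF complete_operators B_sym r(2)] unfolding straighten_def by blast
  then obtain \<Theta> where \<Theta>: "\<And>y. norm y < r / 2 \<Longrightarrow> norm (\<Theta> y) < r \<and> straighten (\<Theta> y) = y" by metis
  have inj: "S = T" if "norm S < r" "norm T < r" "straighten S = straighten T" for S T
    using quadratic_expansive[OF complete_operators B_sym r(2), of S T] that unfolding straighten_def by simp
  have cont: "continuous_on UNIV straighten" using Ck_on_straighten[of 0] by simp
  have "open {T. norm T < r \<and> norm (straighten T) < r / 2}"
    by (intro open_Collect_conj open_Collect_less continuous_intros continuous_on_compose2[OF cont]) auto
  then have oQ: "openin (top_of_set Hom) Q"
    using openin_open_Int[of "{T. norm T < r \<and> norm (straighten T) < r / 2}" Hom]
    by (simp add: Q_def Int_def)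
  have "open {T :: 'a \<Rightarrow>\<^sub>L 'a. norm T < r / 2}"
    by (intro open_Collect_less continuous_intros)
  then have oQ': "openin (top_of_set Hom) Q'"
    using openin_open_Int[of "{T. norm T < r / 2}" Hom] by (simp add: Q'_def Int_def)
  have QU: "{T \<in> Hom. graph_on W T \<in> U} = Q"
  proof (intro equalityI subsetI)
    fix T assume "T \<in> {T \<in> Hom. graph_on W T \<in> U}"
    then obtain S where "T \<in> Hom" "S \<in> Q" "graph_on W T = graph_on W S" by (auto simp: U_def)
    moreover then have "T = S" using graph_inj by (simp add: Q_def)
    ultimately show "T \<in> Q" by simp
  qed (auto simp: U_def Q_def)
  have s0: "straighten 0 = 0" by (simp add: straighten_def)
  have W0: "W \<in> U"
    using r(1) subspace_0[OF subspace_Hom] graph_zero s0 by (force simp: U_def Q_def)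
  have P: "{T \<in> Hom. graph_on W T \<in> U \<inter> ideals_of_dim bracket (dim W)} = {T \<in> Q. straighten T \<in> Z}"
    using QU r(3) graph_in_grassmannian by (auto simp: ideals_of_dim_def Q_def)
  have QQ': "straighten T \<in> Q'" if "T \<in> Q" for T
    using that straighten_in_Hom_iff by (simp add: Q_def Q'_def)
  have Q'Q: "\<Theta> y \<in> Q" "straighten (\<Theta> y) = y" if "y \<in> Q'" for y
    using that \<Theta>[of y] straighten_in_Hom_iff[of "\<Theta> y"] by (auto simp: Q_def Q'_def)
  have \<Theta>s: "\<Theta> (straighten T) = T" if "T \<in> Q" for T
  proof (rule inj)
    show "norm (\<Theta> (straighten T)) < r" using Q'Q(1)[OF QQ'[OF that]] unfolding Q_def by blast
    show "norm T < r" using that unfolding Q_def by blast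
    show "straighten (\<Theta> (straighten T)) = straighten T" by (rule Q'Q(2)[OF QQ'[OF that]])
  qed
  have "Ck_on n Hom Q' \<Theta>" for n
  proof (rule Ck_on_quadratic_solution[OF complete_operators B_sym r(2)])
    show "norm (\<Theta> y) \<le> r" if "y \<in> Q'" for y
      using Q'Q(1)[OF that] unfolding Q_def by (simp add: less_imp_le)
    show "\<Theta> y + (1 / 2) *\<^sub>R B (\<Theta> y) (\<Theta> y) = y" if "y \<in> Q'" for y
      using Q'Q(2)[OF that] unfolding straighten_def .
    show "Ck_on n Hom Q' (\<lambda>y. y)" by (rule Ck_on_linear[OF bounded_linear_ident])
  qed
  then have sm: "smooth_on Hom Q straighten" "smooth_on Hom Q' \<Theta>"
    using Ck_on_straighten by (auto simp: smooth_on_def)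
  have "slice_submanifold Hom Q {T \<in> Q. straighten T \<in> Z} (dim Z)"
    unfolding slice_submanifold_def
  proof (intro exI conjI)
    show "straighten ` Q = Q'" "\<Theta> ` Q' = Q" using QQ' Q'Q \<Theta>s by (auto simp: image_iff) metis+
    show "straighten ` {T \<in> Q. straighten T \<in> Z} = Q' \<inter> Z" using QQ' Q'Q by (auto simp: image_iff) metis
    show "Z \<subseteq> Hom" by (auto simp: Z_def)
  qed (use oQ oQ' sm subspace_Z \<Theta>s Q'Q in auto)
  moreover have "openin (gr_topology (dim W)) U"
    unfolding openin_gr_topology U_def by (rule gr_open_graph_image[OF oQ])
  moreover have "U \<subseteq> graph_on W ` Hom" by (auto simp: U_def Q_def)
  moreover have "W \<in> ideals_of_dim bracket (dim W)"
    using ideal subspaces by (simp add: ideals_of_dim_def grassmannian_def)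
  ultimately show ?thesis unfolding gr_submanifold_near_def
    using complement W0 P QU by (intro conjI exI[of _ U] exI[of _ C]) auto
qed

text \<open>The preimage under \<open>straighten\<close> of a curve in \<open>Z\<close> with velocity \<open>z\<close> at \<open>0\<close>. The curve must exist for all
  times while staying in a small ball, hence the reparametrization by a sine of small amplitude.\<close>

lemma cocycle_integrates:
  assumes "z \<in> Z"
  obtains \<gamma> :: "real \<Rightarrow> 'a \<Rightarrow>\<^sub>L 'a" where "\<gamma> 0 = 0" "\<And>t. \<gamma> t \<in> Hom"
    "\<And>t. lie_ideal bracket (graph_on W (\<gamma> t))" "smooth_on UNIV UNIV \<gamma>"
    "(\<gamma> has_vector_derivative z) (at 0)"
proof -
  obtain r where r: "r > 0" "norm B * r \<le> 1 / 2"
    "\<And>T. T \<in> Hom \<Longrightarrow> norm T < r \<Longrightarrow> lie_ideal bracket (graph_on W T) \<longleftrightarrow> straighten T \<in> Z"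
    using chart_radius by blast
  \<comment> \<open>amplitude \<open>1 / M\<close> keeps the curve \<open>\<beta>\<close> inside the ball of radius \<open>r / 2\<close>, frequency \<open>M\<close> restores the velocity \<open>z\<close>\<close>
  define M where "M = 2 * norm z / r + 1"
  have M: "M > 0" using r(1) by (simp add: M_def add_nonneg_pos)
  define \<beta> where "\<beta> t = (sin (M * t) / M) *\<^sub>R z" for t
  have "norm z / M < r / 2"
    using M r(1) by (simp add: M_def field_simps)
  moreover have "norm (\<beta> t) \<le> norm z / M" for t
    using M abs_sin_le_one[of "M * t"] mult_right_mono[of "\<bar>sin (M * t)\<bar>" 1 "norm z / M"] 
    by (simp add: \<beta>_def)
  ultimately have \<beta>r: "norm (\<beta> t) < r / 2" for t by (meson le_less_trans)
  then have "\<forall>t. \<exists>T. norm T < r \<and> straighten T = \<beta> t"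
    using quadratic_solvable[OF complete_operators B_sym r(2)] unfolding straighten_def by blast
  then obtain \<gamma> where \<gamma>: "\<And>t. norm (\<gamma> t) < r" "\<And>t. straighten (\<gamma> t) = \<beta> t" by metis
  have \<beta>Z: "\<beta> t \<in> Z" for t unfolding \<beta>_def by (rule subspace_scale[OF subspace_Z assms])
  have H: "\<gamma> t \<in> Hom" for t
    using \<beta>Z[of t] straighten_in_Hom_iff[of "\<gamma> t"] by (simp add: \<gamma>(2) Z_def)
  have id: "lie_ideal bracket (graph_on W (\<gamma> t))" for t
    using r(3)[OF H \<gamma>(1)] \<beta>Z by (simp add: \<gamma>(2))
  have eq: "\<gamma> t + (1 / 2) *\<^sub>R B (\<gamma> t) (\<gamma> t) = \<beta> t" for t
    using \<gamma>(2)[of t] by (simp add: straighten_def)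
  have 0: "\<gamma> 0 = 0"
    using quadratic_expansive[OF complete_operators B_sym r(2), of "\<gamma> 0" 0] \<gamma>(1)[of 0] r(1) eq[of 0]
    by (simp add: \<beta>_def)
  have "Ck_on n UNIV UNIV \<beta>" for n
  proof -
    have "Ck_on n UNIV UNIV (\<lambda>t. sin (M * t) *\<^sub>R ((1 / M) *\<^sub>R z))"
      by (rule Ck_on_bounded_linear_compose[OF bounded_linear_scaleR_left conjunct1[OF Ck_on_sin_cos]])
    then show ?thesis by (simp add: \<beta>_def[abs_def])
  qed
  then have C: "Ck_on n UNIV UNIV \<gamma>" for n
    using Ck_on_quadratic_solution[OF complete_operators B_sym r(2), of UNIV \<gamma> \<beta>] \<gamma>(1) eq
    by (simp add: less_imp_le)
  obtain \<gamma>' where \<gamma>': "(\<gamma> has_derivative \<gamma>') (at 0)"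
    using C[of "Suc 0"] by auto
  have "\<gamma>' = (\<lambda>v. v *\<^sub>R \<gamma>' 1)"
  proof (rule ext)
    show "\<gamma>' v = v *\<^sub>R \<gamma>' 1" for v
      using linear_scale[OF has_derivative_linear[OF \<gamma>'], of v 1] by simp
  qed
  then have d\<gamma>: "(\<gamma> has_vector_derivative \<gamma>' 1) (at 0)"
    using \<gamma>' unfolding has_vector_derivative_def by (rule subst[where P = "\<lambda>g. (\<gamma> has_derivative g) (at 0)"])
  have "(\<beta> has_vector_derivative z) (at 0)"
    unfolding \<beta>_def using M
    by (auto intro!: derivative_eq_intros simp: has_real_derivative_iff_has_vector_derivative[symmetric])
  moreover have "((\<lambda>t. B (\<gamma> t) (\<gamma> t)) has_vector_derivative 0) (at 0)"
  proof -
    have "((\<lambda>t. B (\<gamma> t)) has_vector_derivative B (\<gamma>' 1)) (at 0)"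
      by (rule bounded_linear.has_vector_derivative[OF blinfun.bounded_linear_right d\<gamma>])
    from bounded_bilinear.has_vector_derivative[OF bounded_bilinear_blinfun_apply this d\<gamma>]
    show ?thesis by (simp add: 0)
  qed
  ultimately have "((\<lambda>t. \<beta> t - (1 / 2) *\<^sub>R B (\<gamma> t) (\<gamma> t)) has_vector_derivative z - (1 / 2) *\<^sub>R 0) (at 0)"
    by (intro has_vector_derivative_diff bounded_linear.has_vector_derivative[OF bounded_linear_scaleR_right])
  moreover have "(\<lambda>t. \<beta> t - (1 / 2) *\<^sub>R B (\<gamma> t) (\<gamma> t)) = \<gamma>"
    by (rule ext) (simp add: eq[symmetric])
  ultimately have "(\<gamma> has_vector_derivative z) (at 0)" by simp
  with 0 H id show ?thesis using C by (intro that) (auto simp: smooth_on_def)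
qed

lemma cocycle_curve:
  assumes "z \<in> Z" "0 \<in> J"
  obtains c where "gr_smooth_curve (dim W) J c" "c 0 = W" "\<And>t. lie_ideal bracket (c t)"
    "gr_has_velocity \<pi> J c (\<lambda>u. if u \<in> W then \<pi> (z u) else 0)"
proof -
  obtain \<gamma> :: "real \<Rightarrow> 'a \<Rightarrow>\<^sub>L 'a" where \<gamma>: "\<gamma> 0 = 0" "\<And>t. \<gamma> t \<in> Hom"
    "\<And>t. lie_ideal bracket (graph_on W (\<gamma> t))" "smooth_on UNIV UNIV \<gamma>"
    "(\<gamma> has_vector_derivative z) (at 0)"
    using cocycle_integrates[OF assms(1)] by blast
  define c where "c t = graph_on W (\<gamma> t)" for t
  have c0: "c 0 = W" by (simp add: c_def \<gamma>(1) graph_zero)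
  have gr: "c t \<in> grassmannian (dim W)" for t
    unfolding c_def using \<gamma>(2) by (rule graph_in_grassmannian)
  have "smooth_on UNIV (J \<inter> UNIV) \<gamma>"
    using \<gamma>(4) Ck_on_subset unfolding smooth_on_def by blast
  then have "gr_smooth_curve (dim W) J c"
    unfolding gr_smooth_curve_def using gr \<gamma>(2) complement subspaces
    by (intro conjI ballI exI[where x = UNIV] exI[where x = W] exI[where x = C] exI[where x = \<gamma>])
      (auto simp: c_def grassmannian_def)
  moreover have "gr_has_velocity \<pi> J c (\<lambda>u. if u \<in> W then \<pi> (z u) else 0)"
    unfolding gr_has_velocity_def c0
  proof (intro exI conjI)
    show "\<forall>\<^sub>F t in at 0 within J. \<gamma> t \<in> Hom \<and> c t = graph_on W (\<gamma> t)"
      using \<gamma>(2) by (simp add: c_def)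
    show "(\<gamma> has_vector_derivative z) (at 0 within J)"
      using \<gamma>(5) by (rule has_vector_derivative_at_within)
  qed (use complement \<gamma>(1) in auto)
  ultimately show ?thesis using that c0 \<gamma>(3) by (simp add: c_def)
qed

end

section \<open>Comparison with the Chevalley--Eilenberg complex of the quotient\<close>

text \<open>The complement \<open>C\<close> and the presentation \<open>\<pi>\<close> of the quotient are unrelated choices; \<open>\<pi>\<close> restricts to an
  isomorphism from \<open>C\<close> onto the quotient, which transports cochains between the two pictures.\<close>

locale presented_ideal = complement_pair I C p
  for I C :: "'a::real_normed_vector set" and p :: "'a \<Rightarrow>\<^sub>L 'a" +
  fixes \<mu> :: "'a \<Rightarrow> 'a \<Rightarrow> 'a" and \<pi> :: "'a \<Rightarrow> 'q::real_vector"
  assumes lie: "lie_bracket \<mu>"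
    and ideal: "lie_ideal \<mu> I"
    and proj: "quotient_proj \<pi> I"
begin

definition m :: "'a \<Rightarrow>\<^sub>L 'a \<Rightarrow>\<^sub>L 'a" where "m = blinfun2 \<mu>"

lemma m_apply [simp]: "m x y = \<mu> x y"
  unfolding m_def using lie by (intro apply_blinfun2[OF finite_dim finite_dim]) (auto simp: lie_bracket_def)

lemma linear_pi: "linear \<pi>" and pi_zero: "\<pi> z = 0 \<longleftrightarrow> z \<in> I"
  using proj by (auto simp: quotient_proj_def)

lemmas pi_add = linear_add[OF linear_pi] and pi_diff = linear_diff[OF linear_pi]
  and pi_scale = linear_scale[OF linear_pi]

lemma pi_q: "\<pi> (x - p x) = \<pi> x"
  using pi_zero[of "p x"] p_in by (simp add: pi_diff)

lemma pi_inj: "p a = 0 \<Longrightarrow> p b = 0 \<Longrightarrow> \<pi> a = \<pi> b \<Longrightarrow> a = b"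
proof -
  assume *: "p a = 0" "p b = 0" "\<pi> a = \<pi> b"
  then have "a - b \<in> I" by (simp add: pi_diff flip: pi_zero)
  then show "a = b" using *(1,2) by (simp add: W_iff blinfun.diff_right)
qed

lemma bracket_in_ideal: "u \<in> I \<Longrightarrow> \<mu> x u \<in> I"
  using ideal by (simp add: lie_ideal_def)

lemma quotient_bracket_pi: "quotient_bracket \<mu> \<pi> (\<pi> x) (\<pi> y) = \<pi> (\<mu> x y)"
  by (rule quotient_bracket_proj[OF lie ideal proj])

text \<open>The canonical map \<open>Hom(I, C) \<rightarrow> Hom(I, g/I)\<close>.\<close>

definition to_hom :: "('a \<Rightarrow>\<^sub>L 'a) \<Rightarrow> 'a \<Rightarrow> 'q" where
  "to_hom T = (\<lambda>u. if u \<in> I then \<pi> (T u) else 0)"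

lemma to_hom_in_hom_quotient: "to_hom T \<in> hom_quotient I \<pi>"
  using subspaces(1) by (auto simp: hom_quotient_def to_hom_def blinfun.bilinear_simps pi_add pi_scale
      subspace_add subspace_scale)

lemma linear_to_hom: "linear to_hom"
  by (intro linearI ext)
    (auto simp: to_hom_def blinfun.bilinear_simps pi_add pi_scale scaleR_fun_def)

lemma inj_on_to_hom: "inj_on to_hom Hom"
proof (rule inj_onI)
  fix S T assume *: "S \<in> Hom" "T \<in> Hom" "to_hom S = to_hom T"
  show "S = T"
  proof (rule blinfun_eqI)
    fix x
    have "\<pi> (S (p x)) = \<pi> (T (p x))"
      using fun_cong[OF *(3), of "p x"] by (simp add: to_hom_def p_in)
    then have "S (p x) = T (p x)" by (rule pi_inj[OF Hom_p(1)[OF *(1)] Hom_p(1)[OF *(2)]])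
    then show "S x = T x" unfolding Hom_p(2)[OF *(1)] Hom_p(2)[OF *(2)] .
  qed
qed

text \<open>\<open>inv \<pi>\<close> need not be linear, but its component in \<open>C\<close> is, being determined by its image under \<open>\<pi>\<close>.\<close>

lemma to_hom_surj:
  assumes "\<phi> \<in> hom_quotient I \<pi>" obtains T where "T \<in> Hom" "to_hom T = \<phi>"
proof -
  have \<phi>: "\<And>u v. u \<in> I \<Longrightarrow> v \<in> I \<Longrightarrow> \<phi> (u + v) = \<phi> u + \<phi> v"
    "\<And>r u. u \<in> I \<Longrightarrow> \<phi> (r *\<^sub>R u) = r *\<^sub>R \<phi> u" "\<And>u. u \<in> I \<Longrightarrow> \<phi> u \<in> range \<pi>"
    "\<And>u. u \<notin> I \<Longrightarrow> \<phi> u = 0"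
    using assms by (auto simp: hom_quotient_def)
  define s where "s x = inv \<pi> (\<phi> (p x)) - p (inv \<pi> (\<phi> (p x)))" for x
  have ps: "p (s x) = 0" for x by (simp add: s_def blinfun.diff_right)
  have pis: "\<pi> (s x) = \<phi> (p x)" for x
    unfolding s_def pi_q by (rule f_inv_into_f[OF \<phi>(3)[OF p_in]])
  have "linear s"
    by (rule linearI; rule pi_inj)
      (simp_all add: ps pis pi_add pi_scale blinfun.bilinear_simps \<phi>(1,2) p_in)
  then have s: "blinfun_apply (Blinfun s) = s" by (rule apply_Blinfun_linear[OF finite_dim])
  have sp: "s (p x) = s x" for x by (simp add: s_def)
  show ?thesis
  proof
    show "Blinfun s \<in> Hom" by (simp add: hom_compl_iff s ps sp)
    show "to_hom (Blinfun s) = \<phi>"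
      by (rule ext) (simp add: to_hom_def s pis p_on \<phi>(4))
  qed
qed

lemma to_hom_in_Z0_iff:
  "to_hom T \<in> ideal_Z0 \<mu> I \<pi> \<longleftrightarrow> (\<forall>x. \<forall>u\<in>I. \<pi> (\<mu> x (T u)) = \<pi> (T (\<mu> x u)))"
  unfolding ideal_Z0_eq[OF lie ideal proj]
  by (simp add: to_hom_in_hom_quotient) (simp add: to_hom_def quotient_bracket_pi bracket_in_ideal)

lemma to_hom_cocycle_iff:
  assumes "T \<in> Hom"
  shows "to_hom T \<in> ideal_Z0 \<mu> I \<pi> \<longleftrightarrow> d0 m T = 0"
proof -
  have "d0 m T = 0 \<longleftrightarrow> (\<forall>x u. d0 m T x u = 0)"
    by (rule iffI, simp, intro blinfun_eqI, simp)
  also have "\<dots> \<longleftrightarrow> (\<forall>x u. \<pi> (d0 m T x u) = 0)"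
  proof -
    have "d0 m T x u = 0 \<longleftrightarrow> \<pi> (d0 m T x u) = 0" for x u
      using pi_inj[of "d0 m T x u" 0] assms
      by (auto simp: linear_0[OF linear_pi] d0_apply blinfun.bilinear_simps)
    then show ?thesis by simp
  qed
  also have "\<dots> \<longleftrightarrow> (\<forall>x u. \<pi> (\<mu> x (T (p u))) = \<pi> (T (\<mu> x (p u))))"
    using assms by (simp add: d0_apply blinfun.diff_left pi_diff pi_q[unfolded pi_diff])
  also have "\<dots> \<longleftrightarrow> (\<forall>x. \<forall>u\<in>I. \<pi> (\<mu> x (T u)) = \<pi> (T (\<mu> x u)))"
    by (metis p_in p_on)
  finally show ?thesis by (simp add: to_hom_in_Z0_iff)
qed

lemma ideal_Z0_eq_image: "ideal_Z0 \<mu> I \<pi> = to_hom ` {T \<in> Hom. d0 m T = 0}"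
proof (intro equalityI subsetI)
  fix \<phi> assume \<phi>: "\<phi> \<in> ideal_Z0 \<mu> I \<pi>"
  then have "\<phi> \<in> hom_quotient I \<pi>" by (simp add: ideal_Z0_eq[OF lie ideal proj])
  then obtain T where "T \<in> Hom" "to_hom T = \<phi>" by (rule to_hom_surj)
  then show "\<phi> \<in> to_hom ` {T \<in> Hom. d0 m T = 0}" using \<phi> to_hom_cocycle_iff by auto
qed (use to_hom_cocycle_iff in auto)

text \<open>Composition with \<open>\<pi>\<close> turns \<open>f\<close> into a \<open>1\<close>-cocycle on lists; a primitive of it lifts to \<open>Hom\<close>.\<close>

lemma exact_if_cohomology_trivial:
  assumes H1: "ideal_cohomology \<mu> I \<pi> 1 = {ideal_coboundaries \<mu> I \<pi> 1}"
    and f: "f \<in> cochains1" "bianchi m 0 f = 0"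
  shows "f \<in> d0 m ` Hom"
proof -
  let ?M = "hom_quotient I \<pi>" and ?\<rho> = "ad_hom \<mu> I \<pi>"
  have \<rho>0: "?\<rho> x 0 = 0" for x
    using quotient_bracket_pi[of x 0] lie
    by (auto simp: ad_hom_def fun_eq_iff linear_0[OF linear_pi] lie_bracket_def linear_0)
  have \<rho>_to_hom: "?\<rho> x (to_hom T) u = (if u \<in> I then \<pi> (\<mu> x (T u)) - \<pi> (T (\<mu> x u)) else 0)" for x T u
    by (simp add: ad_hom_def to_hom_def quotient_bracket_pi bracket_in_ideal)
  define \<omega> where "\<omega> xs = (if length xs = 1 then to_hom (f (hd xs)) else 0)" for xs
  have zero_M: "0 \<in> ?M" using to_hom_in_hom_quotient[of 0] by (simp add: linear_0[OF linear_to_hom])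
  have "\<omega> \<in> ce_cochains ?M 1"
  proof -
    have "linear (\<lambda>x. to_hom (f x))"
      using linear_compose[OF linear_blinfun_apply[of f] linear_to_hom] by (simp add: o_def)
    then show ?thesis
      by (auto simp: ce_cochains_def \<omega>_def to_hom_in_hom_quotient length_Suc_conv)
  qed
  moreover have "ce_diff \<mu> ?\<rho> \<omega> = 0"
  proof
    fix xs
    show "ce_diff \<mu> ?\<rho> \<omega> xs = 0 xs"
    proof (cases "length xs = 2")
      case True
      then obtain x y where xs: "xs = [x, y]" by (auto simp: numeral_2_eq_2 length_Suc_conv)
      have "ce_diff \<mu> ?\<rho> \<omega> xs u = 0" for u
      proof (cases "u \<in> I")
        case True
        have "\<pi> (bianchi m 0 f x y u) = 0" using f(2) by (simp add: linear_0[OF linear_pi])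
        moreover have "p (\<mu> y u) = \<mu> y u" "p (\<mu> x u) = \<mu> x u" "p u = u"
          using True bracket_in_ideal p_on by auto
        ultimately show ?thesis using True
          by (simp add: xs ce_diff_singleton_cochain \<omega>_def \<rho>_to_hom bianchi_apply blinfun.bilinear_simps
              pi_diff pi_add pi_q[unfolded pi_diff]) (simp add: to_hom_def algebra_simps)
      next
        case False
        then show ?thesis
          by (simp add: xs ce_diff_singleton_cochain \<omega>_def \<rho>_to_hom) (simp add: to_hom_def)
      qed
      then show ?thesis by (simp add: fun_eq_iff)
    next
      case False
      have len: "length (omit_nth i ys) = length ys - 1" if "i < length ys" for i and ys :: "'a list"
        using that by (simp add: omit_nth_def)
      have "\<omega> (omit_nth i xs) = 0" if "i < length xs" for i
      proof -
        have "length (omit_nth i xs) \<noteq> 1" using that False len[OF that] by linarith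
        then show ?thesis by (simp add: \<omega>_def)
      qed
      moreover have "\<omega> (a # omit_nth i (omit_nth j xs)) = 0" if "j < length xs" "i < j" for a i j
      proof -
        have "length (a # omit_nth i (omit_nth j xs)) \<noteq> 1"
          using that False len[of j xs] len[of i "omit_nth j xs"] by simp
        then show ?thesis by (simp only: \<omega>_def if_False)
      qed
      ultimately show ?thesis by (simp add: ce_diff_def \<rho>0)
    qed
  qed
  ultimately have "\<omega> \<in> ce_cocycles \<mu> ?M ?\<rho> 1" by (simp add: ce_cocycles_def)
  then have "(\<lambda>\<beta>. \<omega> + \<beta>) ` ce_coboundaries \<mu> ?M ?\<rho> 1 = ce_coboundaries \<mu> ?M ?\<rho> 1"
    using H1 unfolding ideal_cohomology_def ce_cohomology_def ideal_coboundaries_def by blast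
  moreover have "0 \<in> ce_coboundaries \<mu> ?M ?\<rho> 1"
  proof -
    have "(\<lambda>_. 0) \<in> ce_cochains ?M 0" using zero_M by (auto simp: ce_cochains_def)
    moreover have "ce_diff \<mu> ?\<rho> (\<lambda>_. 0) = 0" by (rule ext) (simp add: ce_diff_def \<rho>0)
    ultimately show ?thesis by (force simp: ce_coboundaries_def)
  qed
  ultimately have "\<omega> \<in> ce_coboundaries \<mu> ?M ?\<rho> 1" by (metis (no_types, lifting) add.right_neutral image_eqI)
  then obtain \<omega>0 where \<omega>0: "\<omega>0 \<in> ce_cochains ?M 0" "\<omega> = ce_diff \<mu> ?\<rho> \<omega>0"
    by (auto simp: ce_coboundaries_def)
  then obtain S where S: "S \<in> Hom" "to_hom S = \<omega>0 []"
    using to_hom_surj[of "\<omega>0 []"] by (auto simp: ce_cochains_def)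
  have "f x u = d0 m S x u" for x u
  proof -
    have "to_hom (f x) (p u) = ?\<rho> x (to_hom S) (p u)"
      using fun_cong[OF \<omega>0(2), of "[x]"] by (simp add: ce_diff_Nil_cochain \<omega>_def S(2))
    then have "\<pi> (f x (p u)) = \<pi> (\<mu> x (S (p u))) - \<pi> (S (\<mu> x (p u)))"
      unfolding \<rho>_to_hom by (simp add: to_hom_def p_in)
    then have "\<pi> (f x u) = \<pi> (d0 m S x u)"
      using f(1) S(1) by (simp add: cochains1_def d0_apply blinfun.diff_left pi_diff pi_q[unfolded pi_diff])
    then show ?thesis using f(1) S(1)
      by - (rule pi_inj, simp_all add: cochains1_def d0_apply blinfun.bilinear_simps)
  qed
  then show ?thesis using S(1) by (intro image_eqI[of _ _ S]) (auto intro!: blinfun_eqI)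
qed

text \<open>Differentiate \<open>(q - \<phi> t) (m x (u + \<phi> t u)) = 0\<close> at \<open>t = 0\<close> and apply \<open>\<pi>\<close>.\<close>

lemma velocity_cocycle:
  fixes \<phi> :: "real \<Rightarrow> 'a \<Rightarrow>\<^sub>L 'a"
  assumes "\<phi> 0 = 0" "at 0 within J \<noteq> bot"
    and ev: "\<forall>\<^sub>F t in at 0 within J. \<phi> t \<in> Hom \<and> lie_ideal \<mu> (graph_on I (\<phi> t))"
    and D: "(\<phi> has_vector_derivative D) (at 0 within J)"
  shows "to_hom D \<in> ideal_Z0 \<mu> I \<pi>"
  unfolding to_hom_in_Z0_iff
proof (intro allI ballI)
  fix x u assume u: "u \<in> I"
  define g where "g t = (q - \<phi> t) (m x (u + \<phi> t u))" for t
  have g0: "g 0 = 0" using u bracket_in_ideal p_on by (simp add: g_def assms(1) blinfun.bilinear_simps)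
  have g_zero: "\<forall>\<^sub>F t in at 0 within J. g t = 0"
    using ev
  proof eventually_elim
    case (elim t)
    have "(\<lambda>x y. m x y) = \<mu>" by simp
    with elim have "defect m (\<phi> t) = 0" using graph_ideal_iff[of "\<phi> t" m] by simp
    then have "defect m (\<phi> t) x u = 0" by simp
    then show "g t = 0" using u by (simp add: defect_apply g_def p_on)
  qed
  have "(g has_vector_derivative 0) (at 0 within J)"
    by (simp add: has_vector_derivative_def has_derivative_within g0)
      (auto intro!: tendsto_eventually eventually_mono[OF g_zero])
  moreover have "(g has_vector_derivative q (m x (D u)) - D (m x u)) (at 0 within J)"
  proof -
    have 1: "((\<lambda>t. q - \<phi> t) has_vector_derivative 0 - D) (at 0 within J)"
      by (intro has_vector_derivative_diff has_vector_derivative_const D)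
    have "((\<lambda>t. \<phi> t u) has_vector_derivative D u) (at 0 within J)"
      by (rule bounded_linear.has_vector_derivative[OF blinfun.bounded_linear_left D])
    then have "((\<lambda>t. u + \<phi> t u) has_vector_derivative 0 + D u) (at 0 within J)"
      by (intro has_vector_derivative_add has_vector_derivative_const)
    then have 2: "((\<lambda>t. m x (u + \<phi> t u)) has_vector_derivative m x (0 + D u)) (at 0 within J)"
      by (rule bounded_linear.has_vector_derivative[OF blinfun.bounded_linear_right])
    from bounded_bilinear.has_vector_derivative[OF bounded_bilinear_blinfun_apply 1 2]
    show ?thesis unfolding g_def by (simp add: assms(1) blinfun.bilinear_simps)
  qed
  ultimately have "q (m x (D u)) - D (m x u) = 0"
    using vector_derivative_unique_within[OF assms(2)] by metis
  then have "\<pi> (q (\<mu> x (D u)) - D (\<mu> x u)) = 0" by (simp add: linear_0[OF linear_pi])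
  then show "\<pi> (\<mu> x (D u)) = \<pi> (D (\<mu> x u))" by (simp add: blinfun.diff_left pi_diff pi_q[unfolded pi_diff])
qed

end

text \<open>The velocity of a curve may be witnessed in the chart of any complement \<open>C\<close>, so the projection is
  chosen to fit that complement.\<close>

lemma tangent_space_subset_cocycles:
  fixes \<mu> :: "'a::real_normed_vector \<Rightarrow> 'a \<Rightarrow> 'a"
  assumes "finite_dim TYPE('a)" "lie_bracket \<mu>" "lie_ideal \<mu> I" "quotient_proj \<pi> I"
  shows "gr_tangent_space \<pi> k (ideals_of_dim \<mu> k) I \<subseteq> ideal_Z0 \<mu> I \<pi>"
proof
  fix \<eta> assume "\<eta> \<in> gr_tangent_space \<pi> k (ideals_of_dim \<mu> k) I"
  then obtain c where c: "c 0 = I" "\<forall>t\<in>{-1<..<1}. c t \<in> ideals_of_dim \<mu> k"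
    "gr_has_velocity \<pi> {-1<..<1} c \<eta>" unfolding gr_tangent_space_def by blast
  then obtain C \<phi> D where C: "complement I C" "\<phi> 0 = 0"
    "\<forall>\<^sub>F t in at 0 within {-1<..<1}. \<phi> t \<in> hom_compl I C \<and> c t = graph_on I (\<phi> t)"
    "(\<phi> has_vector_derivative D) (at 0 within {-1<..<1})"
    "\<eta> = (\<lambda>u. if u \<in> I then \<pi> (blinfun_apply D u) else 0)"
    unfolding gr_has_velocity_def by auto
  have ideals: "lie_ideal \<mu> (c t)" if "t \<in> {-1<..<1}" for t
    using c(2) that by (auto simp: ideals_of_dim_def)
  obtain p where "complement_pair I C p" using complement_pair_exists[OF assms(1) C(1)] by blast
  then interpret presented_ideal I C p \<mu> \<pi>
    using assms by (simp add: presented_ideal_def presented_ideal_axioms_def)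
  have "\<forall>\<^sub>F t in at 0 within {-1<..<1::real}. t \<in> {-1<..<1}"
    by (simp add: eventually_at_filter)
  with C(3) have ev: "\<forall>\<^sub>F t in at 0 within {-1<..<1}. \<phi> t \<in> Hom \<and> lie_ideal \<mu> (graph_on I (\<phi> t))"
    by eventually_elim (use ideals in metis)
  have "at (0::real) within {-1<..<1} = at 0" by (rule at_within_open) auto
  then have nb: "at (0::real) within {-1<..<1} \<noteq> bot" by simp
  have "to_hom D \<in> ideal_Z0 \<mu> I \<pi>" by (rule velocity_cocycle[OF C(2) nb ev C(4)])
  then show "\<eta> \<in> ideal_Z0 \<mu> I \<pi>" by (simp add: C(5) to_hom_def)
qed

theorem theorem6p21:
  fixes \<mu> :: "'a::real_normed_vector \<Rightarrow> 'a \<Rightarrow> 'a"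
    and I :: "'a set"
    and k :: nat
    and \<pi> :: "'a \<Rightarrow> 'q::real_vector"
  assumes "\<exists>B::'a set. finite B \<and> span B = UNIV"
    and "lie_bracket \<mu>"
    and "lie_ideal \<mu> I"
    and "dim I = k"
    and "quotient_proj \<pi> I"
    and "ideal_cohomology \<mu> I \<pi> 1 = {ideal_coboundaries \<mu> I \<pi> 1}"
  shows "stable_ideal \<mu> k I \<and>
    gr_submanifold_near k (ideals_of_dim \<mu> k) I (dim (ideal_Z0 \<mu> I \<pi>)) \<and>
    gr_tangent_space \<pi> k (ideals_of_dim \<mu> k) I = ideal_Z0 \<mu> I \<pi> \<and>
    (\<forall>\<eta>\<in>ideal_Z0 \<mu> I \<pi>. deformation_class \<mu> k I \<pi> \<eta>)"
proof -
  have fd: "finite_dim TYPE('a)" using assms(1) by (simp add: finite_dim_def)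
  have "subspace I" using assms(3) by (simp add: lie_ideal_def)
  then obtain C where "complement I C" using complement_exists by metis
  then obtain p where "complement_pair I C p" using complement_pair_exists[OF fd] by blast
  then interpret presented_ideal I C p \<mu> \<pi>
    using assms(2,3,5) by (simp add: presented_ideal_def presented_ideal_axioms_def)
  have m_eq: "(\<lambda>x y. m x y) = \<mu>" by simp
  interpret rigid_ideal I C p m
  proof
    show "lie_bracket (\<lambda>x y. m x y)" "lie_ideal (\<lambda>x y. m x y) I" using assms(2,3) by simp_all
  qed (rule exact_if_cohomology_trivial[OF assms(6)])
  have Z0: "ideal_Z0 \<mu> I \<pi> = to_hom ` Z" by (simp add: ideal_Z0_eq_image Z_def)
  have dim_Z0: "dim (ideal_Z0 \<mu> I \<pi>) = dim Z"
    unfolding Z0 by (intro dim_image_linear_inj_on linear_to_hom subspace_Z inj_on_subset[OF inj_on_to_hom])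
      (auto simp: Z_def)
  have curve: "\<exists>c. gr_smooth_curve k J c \<and> c 0 = I \<and> (\<forall>t. lie_ideal \<mu> (c t)) \<and> gr_has_velocity \<pi> J c \<eta>"
    if \<eta>: "\<eta> \<in> ideal_Z0 \<mu> I \<pi>" and J: "0 \<in> J" for \<eta> J
  proof -
    obtain z where z: "z \<in> Z" "\<eta> = to_hom z" using \<eta> Z0 by blast
    obtain c where c: "gr_smooth_curve (dim I) J c" "c 0 = I" "\<And>t. lie_ideal bracket (c t)"
      "gr_has_velocity \<pi> J c (\<lambda>u. if u \<in> I then \<pi> (blinfun_apply z u) else 0)"
      using cocycle_curve[OF z(1) J, where \<pi> = \<pi>] by blast
    have "gr_has_velocity \<pi> J c \<eta>" using c(4) by (simp add: z(2) to_hom_def)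
    then show ?thesis using c(1-3) assms(4) by (intro exI[of _ c]) simp
  qed
  have "gr_tangent_space \<pi> k (ideals_of_dim \<mu> k) I = ideal_Z0 \<mu> I \<pi>"
  proof (rule equalityI[OF tangent_space_subset_cocycles[OF fd assms(2,3,5)]], rule subsetI)
    fix \<eta> assume "\<eta> \<in> ideal_Z0 \<mu> I \<pi>"
    then obtain c where "gr_smooth_curve k {-1<..<1} c" "c 0 = I" "\<forall>t. lie_ideal \<mu> (c t)"
      "gr_has_velocity \<pi> {-1<..<1} c \<eta>" using curve[of \<eta> "{-1<..<1}"] by auto
    then show "\<eta> \<in> gr_tangent_space \<pi> k (ideals_of_dim \<mu> k) I"
      unfolding gr_tangent_space_def ideals_of_dim_def gr_smooth_curve_def by blast
  qed
  moreover have "deformation_class \<mu> k I \<pi> \<eta>" if "\<eta> \<in> ideal_Z0 \<mu> I \<pi>" for \<eta>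
    unfolding deformation_class_def using curve[OF that, of "{0..1}"] by auto
  ultimately show ?thesis
    using stable submanifold by (simp add: dim_Z0 assms(4))
qed

end
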